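(* Let $(G,P)$ be a quasi-lattice ordered group and let $X$ be a compactly aligned product system over $P$ of essential Hilbert $A$--$A$ bimodules. Let $B$ and $C$ be $C^*$-algebras, let $\psi:X\to B$ be a Nica-covariant Toeplitz representation, and let $\sigma:B\to C$ be a homomorphism. Then $\sigma\circ\psi$ is Nica covariant.
   Context: Standing assumptions: $A$ is a separable $C^*$-algebra, $P$ is a countable semigroup with identity $e$. A Hilbert bimodule over $A$ is a right Hilbert $A$-module $Y$ with a $*$-homomorphism $\phi:A\to\mathcal L(Y)$ (adjointable operators) giving the left action. It is essential if $Y=\overline{\mathrm{span}}\{\phi(a)y\}$. $\mathcal K(Y)=\overline{\mathrm{span}}\{\Theta_{x,y}:x,y\in Y\}$, $\Theta_{x,y}(z)=x\cdot\langle y,z\rangle_A$. A product system over $P$ of Hilbert $A$--$A$ bimodules is a semigroup $X$ with a semigroup homomorphism $p:X\to P$ such that each fibre $X_s=p^{-1}(s)$ is a Hilbert bimodule over $A$ (left action $\phi_s$); for $s,t\ne e$ multiplication $X_s\times X_t\to X_{st}$ extends to an isomorphism of Hilbert bimodules $X_s\otimes_AX_t\to X_{st}$; $X_e=A$ with its usual bimodule structure; and $ax=\phi_s(a)x$, $xa=x\cdot a$ for $a\in X_e$, $x\in X_s$. A Toeplitz representation of $X$ in a $C^*$-algebra $B$ is a map $\psi:X\to B$ whose restrictions $\psi_s=\psi|_{X_s}$ are linear, with $\psi_e$ a $*$-homomorphism, $\psi(xy)=\psi(x)\psi(y)$, and $\psi_s(x)^*\psi_s(y)=\psi_e(\langle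 x,y\rangle_A)$ for $x,y\in X_s$. Then $\psi^{(s)}:\mathcal K(X_s)\to B$ is the homomorphism with $\psi^{(s)}(\Theta_{x,y})=\psi_s(x)\psi_s(y)^*$. $P$ is a subsemigroup of a group $G$ with $P\cap P^{-1}=\{e\}$; $s\le t$ iff $s^{-1}t\in P$. $(G,P)$ is quasi-lattice ordered if every finite subset of $G$ with an upper bound in $P$ has a least upper bound in $P$. $s\vee t$ is the least upper bound of $s,t\in P$ if they have a common upper bound; otherwise $s\vee t=\infty$. $X$ is compactly aligned if whenever $s\vee t<\infty$, $S\in\mathcal K(X_s)$, $T\in\mathcal K(X_t)$, we have $(S\otimes_A1)(T\otimes_A1)\in\mathcal K(X_{s\vee t})$, where $(S\otimes_A1)(xy)=(Sx)y$ for $x\in X_s$, $y\in X_{s^{-1}(s\vee t)}$, and similarly for $T$. When $X$ is compactly aligned, a Toeplitz representation $\psi$ of $X$ in a $C^*$-algebra is Nica covariant if for all $s,t\in P$, $S\in\mathcal K(X_s)$, $T\in\mathcal K(X_t)$: $\psi^{(s)}(S)\psi^{(t)}(T)=\psi^{(s\vee t)}((S\otimes_A1)(T\otimes_A1))$ if $s\vee t<\infty$, and $\psi^{(s)}(S)\psi^{(t)}(T)=0$ otherwise. *)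

theory Defs
  imports "HOL-Analysis.Analysis" "HOL-Algebra.Group"
begin

section \<open>$C^*$-algebras\<close>

class scaleC =
  fixes scaleC :: "complex \<Rightarrow> 'a \<Rightarrow> 'a" (infixr "*\<^sub>C" 75)

class cstar_algebra = real_normed_algebra + complete_space + scaleC +
  fixes star :: "'a \<Rightarrow> 'a"
  assumes scaleC_add_right: "c *\<^sub>C (x + y) = c *\<^sub>C x + c *\<^sub>C y"
    and scaleC_add_left: "(c + d) *\<^sub>C x = c *\<^sub>C x + d *\<^sub>C x"
    and scaleC_scaleC: "c *\<^sub>C d *\<^sub>C x = (c * d) *\<^sub>C x"
    and scaleR_scaleC: "r *\<^sub>R x = complex_of_real r *\<^sub>C x"
    and mult_scaleC_left: "(c *\<^sub>C x) * y = c *\<^sub>C (x * y)"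
    and mult_scaleC_right: "x * (c *\<^sub>C y) = c *\<^sub>C (x * y)"
    and norm_scaleC: "norm (c *\<^sub>C x) = cmod c * norm x"
    and star_add: "star (x + y) = star x + star y"
    and star_scaleC: "star (c *\<^sub>C x) = cnj c *\<^sub>C star x"
    and star_mult: "star (x * y) = star y * star x"
    and star_star: "star (star x) = x"
    and cstar_identity: "norm (star x * x) = (norm x)\<^sup>2"

text \<open>Neither algebras nor homomorphisms are assumed to be unital.\<close>

locale star_homomorphism =
  fixes f :: "'a::cstar_algebra \<Rightarrow> 'b::cstar_algebra"
  assumes hom_add: "f (x + y) = f x + f y"
    and hom_scaleC: "f (c *\<^sub>C x) = c *\<^sub>C f x"
    and hom_mult: "f (x * y) = f x * f y"
    and hom_star: "f (star x) = star (f x)"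

definition cstar_positive :: "'a::cstar_algebra \<Rightarrow> bool" where
  "cstar_positive a \<longleftrightarrow> (\<exists>b. a = star b * b)"


section \<open>Hilbert modules and bimodules\<close>

text \<open>The fibres of a product system are different modules inside one set, so modules carry an
  explicit carrier. Inner products are linear in the second variable.\<close>

record ('a, 'x) hilbert_module = "'x partial_object" +
  vzero :: 'x ("\<zero>\<index>")
  vadd :: "'x \<Rightarrow> 'x \<Rightarrow> 'x" (infixl "\<oplus>\<index>" 65)
  vscale :: "complex \<Rightarrow> 'x \<Rightarrow> 'x" (infixr "\<odot>\<index>" 70)
  ract :: "'x \<Rightarrow> 'a \<Rightarrow> 'x"
  rinner :: "'x \<Rightarrow> 'x \<Rightarrow> 'a"

record ('a, 'x) hilbert_bimodule = "('a, 'x) hilbert_module" +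
  lact :: "'a \<Rightarrow> 'x \<Rightarrow> 'x"

definition vminus :: "('a, 'x, 'z) hilbert_module_scheme \<Rightarrow> 'x \<Rightarrow> 'x \<Rightarrow> 'x" where
  "vminus Y x y = x \<oplus>\<^bsub>Y\<^esub> (-1) \<odot>\<^bsub>Y\<^esub> y"

definition vnorm :: "('a::cstar_algebra, 'x, 'z) hilbert_module_scheme \<Rightarrow> 'x \<Rightarrow> real" where
  "vnorm Y x = sqrt (norm (rinner Y x x))"

locale hilbert_module =
  fixes Y :: "('a::cstar_algebra, 'x, 'z) hilbert_module_scheme" (structure)
  assumes zero_closed: "\<zero> \<in> carrier Y"
    and add_closed: "\<lbrakk>x \<in> carrier Y; y \<in> carrier Y\<rbrakk> \<Longrightarrow> x \<oplus> y \<in> carrier Y"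
    and scale_closed: "x \<in> carrier Y \<Longrightarrow> c \<odot> x \<in> carrier Y"
    and ract_closed: "x \<in> carrier Y \<Longrightarrow> ract Y x a \<in> carrier Y"
    and add_assoc: "\<lbrakk>x \<in> carrier Y; y \<in> carrier Y; z \<in> carrier Y\<rbrakk>
      \<Longrightarrow> (x \<oplus> y) \<oplus> z = x \<oplus> (y \<oplus> z)"
    and add_commute: "\<lbrakk>x \<in> carrier Y; y \<in> carrier Y\<rbrakk> \<Longrightarrow> x \<oplus> y = y \<oplus> x"
    and add_zero: "x \<in> carrier Y \<Longrightarrow> x \<oplus> \<zero> = x"
    and add_minus: "x \<in> carrier Y \<Longrightarrow> x \<oplus> (-1) \<odot> x = \<zero>"
    and scale_one: "x \<in> carrier Y \<Longrightarrow> 1 \<odot> x = x"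
    and scale_scale: "x \<in> carrier Y \<Longrightarrow> c \<odot> d \<odot> x = (c * d) \<odot> x"
    and scale_add_right: "\<lbrakk>x \<in> carrier Y; y \<in> carrier Y\<rbrakk> \<Longrightarrow> c \<odot> (x \<oplus> y) = c \<odot> x \<oplus> c \<odot> y"
    and scale_add_left: "x \<in> carrier Y \<Longrightarrow> (c + d) \<odot> x = c \<odot> x \<oplus> d \<odot> x"
    and ract_add_left: "\<lbrakk>x \<in> carrier Y; y \<in> carrier Y\<rbrakk>
      \<Longrightarrow> ract Y (x \<oplus> y) a = ract Y x a \<oplus> ract Y y a"
    and ract_add_right: "x \<in> carrier Y \<Longrightarrow> ract Y x (a + b) = ract Y x a \<oplus> ract Y x b"
    and ract_mult: "x \<in> carrier Y \<Longrightarrow> ract Y x (a * b) = ract Y (ract Y x a) b"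
    and ract_scale_left: "x \<in> carrier Y \<Longrightarrow> ract Y (c \<odot> x) a = c \<odot> ract Y x a"
    and ract_scale_right: "x \<in> carrier Y \<Longrightarrow> ract Y x (c *\<^sub>C a) = c \<odot> ract Y x a"
    and rinner_add: "\<lbrakk>x \<in> carrier Y; y \<in> carrier Y; z \<in> carrier Y\<rbrakk>
      \<Longrightarrow> rinner Y x (y \<oplus> z) = rinner Y x y + rinner Y x z"
    and rinner_scale: "\<lbrakk>x \<in> carrier Y; y \<in> carrier Y\<rbrakk>
      \<Longrightarrow> rinner Y x (c \<odot> y) = c *\<^sub>C rinner Y x y"
    and rinner_ract: "\<lbrakk>x \<in> carrier Y; y \<in> carrier Y\<rbrakk>
      \<Longrightarrow> rinner Y x (ract Y y a) = rinner Y x y * a"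
    and rinner_star: "\<lbrakk>x \<in> carrier Y; y \<in> carrier Y\<rbrakk> \<Longrightarrow> star (rinner Y x y) = rinner Y y x"
    and rinner_positive: "x \<in> carrier Y \<Longrightarrow> cstar_positive (rinner Y x x)"
    and rinner_definite: "\<lbrakk>x \<in> carrier Y; rinner Y x x = 0\<rbrakk> \<Longrightarrow> x = \<zero>"
    and complete: "\<lbrakk>\<forall>n::nat. u n \<in> carrier Y;
        \<forall>\<epsilon>>0. \<exists>N. \<forall>m\<ge>N. \<forall>n\<ge>N. vnorm Y (vminus Y (u m) (u n)) < \<epsilon>\<rbrakk>
      \<Longrightarrow> \<exists>x\<in>carrier Y. (\<lambda>n. vnorm Y (vminus Y (u n) x)) \<longlonglongrightarrow> 0"

text \<open>The axioms for \<open>lact\<close> say that \<open>\<phi>(a) = lact Y a\<close> defines a *-homomorphism into the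
  adjointable operators; linearity of \<open>\<phi>(a)\<close> follows from adjointability.\<close>

locale hilbert_bimodule = hilbert_module Y
  for Y :: "('a::cstar_algebra, 'x, 'z) hilbert_bimodule_scheme" (structure) +
  assumes lact_closed: "x \<in> carrier Y \<Longrightarrow> lact Y a x \<in> carrier Y"
    and lact_add: "x \<in> carrier Y \<Longrightarrow> lact Y (a + b) x = lact Y a x \<oplus> lact Y b x"
    and lact_scale: "x \<in> carrier Y \<Longrightarrow> lact Y (c *\<^sub>C a) x = c \<odot> lact Y a x"
    and lact_mult: "x \<in> carrier Y \<Longrightarrow> lact Y (a * b) x = lact Y a (lact Y b x)"
    and lact_star: "\<lbrakk>x \<in> carrier Y; y \<in> carrier Y\<rbrakk>
      \<Longrightarrow> rinner Y (lact Y a x) y = rinner Y x (lact Y (star a) y)"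

inductive_set lin_span :: "'v \<Rightarrow> ('v \<Rightarrow> 'v \<Rightarrow> 'v) \<Rightarrow> (complex \<Rightarrow> 'v \<Rightarrow> 'v) \<Rightarrow> 'v set \<Rightarrow> 'v set"
  for zero :: 'v and add :: "'v \<Rightarrow> 'v \<Rightarrow> 'v" and scale :: "complex \<Rightarrow> 'v \<Rightarrow> 'v" and S :: "'v set"
  where
    span_zero: "zero \<in> lin_span zero add scale S"
  | span_step: "\<lbrakk>x \<in> S; y \<in> lin_span zero add scale S\<rbrakk>
      \<Longrightarrow> add (scale c x) y \<in> lin_span zero add scale S"

definition essential :: "('a::cstar_algebra, 'x, 'z) hilbert_bimodule_scheme \<Rightarrow> bool" where
  "essential Y \<longleftrightarrow> (\<forall>x\<in>carrier Y. \<forall>\<epsilon>>0.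
    \<exists>y\<in>lin_span (vzero Y) (vadd Y) (vscale Y) {lact Y a z | a z. z \<in> carrier Y}.
      vnorm Y (vminus Y x y) < \<epsilon>)"

definition cstar_bimodule :: "('a::cstar_algebra, 'a) hilbert_bimodule" where
  "cstar_bimodule = \<lparr>carrier = UNIV, vzero = 0, vadd = (+), vscale = scaleC, ract = (*),
    rinner = (\<lambda>a b. star a * b), lact = (*)\<rparr>"

definition hilbert_bimodule_iso ::
  "('a::cstar_algebra, 'x, 'z) hilbert_bimodule_scheme \<Rightarrow> ('a, 'y, 'w) hilbert_bimodule_scheme
    \<Rightarrow> ('x \<Rightarrow> 'y) \<Rightarrow> bool" where
  "hilbert_bimodule_iso Y Z U \<longleftrightarrow>
    bij_betw U (carrier Y) (carrier Z) \<and>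
    (\<forall>x\<in>carrier Y. \<forall>y\<in>carrier Y. U (x \<oplus>\<^bsub>Y\<^esub> y) = U x \<oplus>\<^bsub>Z\<^esub> U y) \<and>
    (\<forall>x\<in>carrier Y. \<forall>c. U (c \<odot>\<^bsub>Y\<^esub> x) = c \<odot>\<^bsub>Z\<^esub> U x) \<and>
    (\<forall>x\<in>carrier Y. \<forall>a. U (ract Y x a) = ract Z (U x) a) \<and>
    (\<forall>x\<in>carrier Y. \<forall>a. U (lact Y a x) = lact Z a (U x)) \<and>
    (\<forall>x\<in>carrier Y. \<forall>y\<in>carrier Y. rinner Z (U x) (U y) = rinner Y x y)"


section \<open>Adjointable and compact operators\<close>

text \<open>Operators on a module are extensional functions (\<open>undefined\<close> off the carrier), so that
  equality of operators is equality on the carrier.\<close>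

definition is_adjoint ::
  "('a, 'x, 'z) hilbert_module_scheme \<Rightarrow> ('x \<Rightarrow> 'x) \<Rightarrow> ('x \<Rightarrow> 'x) \<Rightarrow> bool" where
  "is_adjoint Y T R \<longleftrightarrow> R \<in> carrier Y \<rightarrow>\<^sub>E carrier Y \<and>
    (\<forall>x\<in>carrier Y. \<forall>y\<in>carrier Y. rinner Y (T x) y = rinner Y x (R y))"

definition adjointables :: "('a, 'x, 'z) hilbert_module_scheme \<Rightarrow> ('x \<Rightarrow> 'x) set" where
  "adjointables Y = {T \<in> carrier Y \<rightarrow>\<^sub>E carrier Y. \<exists>R. is_adjoint Y T R}"

definition adjoint :: "('a, 'x, 'z) hilbert_module_scheme \<Rightarrow> ('x \<Rightarrow> 'x) \<Rightarrow> 'x \<Rightarrow> 'x" where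
  "adjoint Y T = (THE R. is_adjoint Y T R)"

definition op_add ::
  "('a, 'x, 'z) hilbert_module_scheme \<Rightarrow> ('x \<Rightarrow> 'x) \<Rightarrow> ('x \<Rightarrow> 'x) \<Rightarrow> 'x \<Rightarrow> 'x" where
  "op_add Y S T = (\<lambda>z\<in>carrier Y. S z \<oplus>\<^bsub>Y\<^esub> T z)"

definition op_scale ::
  "('a, 'x, 'z) hilbert_module_scheme \<Rightarrow> complex \<Rightarrow> ('x \<Rightarrow> 'x) \<Rightarrow> 'x \<Rightarrow> 'x" where
  "op_scale Y c T = (\<lambda>z\<in>carrier Y. c \<odot>\<^bsub>Y\<^esub> T z)"

definition op_comp ::
  "('a, 'x, 'z) hilbert_module_scheme \<Rightarrow> ('x \<Rightarrow> 'x) \<Rightarrow> ('x \<Rightarrow> 'x) \<Rightarrow> 'x \<Rightarrow> 'x" where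
  "op_comp Y S T = compose (carrier Y) S T"

definition rank_one :: "('a, 'x, 'z) hilbert_module_scheme \<Rightarrow> 'x \<Rightarrow> 'x \<Rightarrow> 'x \<Rightarrow> 'x" where
  "rank_one Y x y = (\<lambda>z\<in>carrier Y. ract Y x (rinner Y y z))"

definition finite_rank :: "('a, 'x, 'z) hilbert_module_scheme \<Rightarrow> ('x \<Rightarrow> 'x) set" where
  "finite_rank Y = lin_span (\<lambda>z\<in>carrier Y. \<zero>\<^bsub>Y\<^esub>) (op_add Y) (op_scale Y)
    {rank_one Y x y | x y. x \<in> carrier Y \<and> y \<in> carrier Y}"

text \<open>The closure is taken in operator norm: the last condition says that the
  operator norm of \<open>S - F\<close> is at most \<open>\<epsilon>\<close>.\<close>

definition compacts :: "('a::cstar_algebra, 'x, 'z) hilbert_module_scheme \<Rightarrow> ('x \<Rightarrow> 'x) set" where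
  "compacts Y = {S \<in> adjointables Y. \<forall>\<epsilon>>0. \<exists>F\<in>finite_rank Y.
    \<forall>z\<in>carrier Y. vnorm Y (vminus Y (S z) (F z)) \<le> \<epsilon> * vnorm Y z}"

definition compacts_homomorphism ::
  "('a::cstar_algebra, 'x, 'z) hilbert_module_scheme \<Rightarrow> (('x \<Rightarrow> 'x) \<Rightarrow> 'b::cstar_algebra) \<Rightarrow> bool"
  where
  "compacts_homomorphism Y \<pi> \<longleftrightarrow> \<pi> \<in> extensional (compacts Y) \<and>
    (\<forall>S\<in>compacts Y. \<forall>T\<in>compacts Y. \<pi> (op_add Y S T) = \<pi> S + \<pi> T) \<and>
    (\<forall>S\<in>compacts Y. \<forall>c. \<pi> (op_scale Y c S) = c *\<^sub>C \<pi> S) \<and>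
    (\<forall>S\<in>compacts Y. \<forall>T\<in>compacts Y. \<pi> (op_comp Y S T) = \<pi> S * \<pi> T) \<and>
    (\<forall>S\<in>compacts Y. \<pi> (adjoint Y S) = star (\<pi> S))"


section \<open>The internal tensor product\<close>

text \<open>A finite sum \<open>\<Sum>\<^sub>i y\<^sub>i \<otimes> w\<^sub>i\<close> is represented by the list of the pairs \<open>(y\<^sub>i, w\<^sub>i)\<close>.
  The tensor product over \<open>A\<close> is the Hausdorff completion, by classes of Cauchy sequences, of
  these sums for the semi-inner product determined by
  \<open>\<langle>y \<otimes> w, y' \<otimes> w'\<rangle> = \<langle>w, \<langle>y, y'\<rangle> w'\<rangle>\<close>. The relations of the algebraic tensor product
  (bilinearity and \<open>ya \<otimes> w = y \<otimes> aw\<close>) hold in the quotient because the corresponding differences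
  have seminorm zero.\<close>

definition pre_inner ::
  "('a::cstar_algebra, 'y, 'z1) hilbert_bimodule_scheme \<Rightarrow> ('a, 'w, 'z2) hilbert_bimodule_scheme
    \<Rightarrow> ('y \<times> 'w) list \<Rightarrow> ('y \<times> 'w) list \<Rightarrow> 'a" where
  "pre_inner Y W u v = (\<Sum>(y, w)\<leftarrow>u. \<Sum>(y', w')\<leftarrow>v. rinner W w (lact W (rinner Y y y') w'))"

definition pre_scale ::
  "('a, 'y, 'z1) hilbert_bimodule_scheme \<Rightarrow> complex \<Rightarrow> ('y \<times> 'w) list \<Rightarrow> ('y \<times> 'w) list" where
  "pre_scale Y c u = map (\<lambda>(y, w). (c \<odot>\<^bsub>Y\<^esub> y, w)) u"

definition pre_dist ::
  "('a::cstar_algebra, 'y, 'z1) hilbert_bimodule_scheme \<Rightarrow> ('a, 'w, 'z2) hilbert_bimodule_scheme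
    \<Rightarrow> ('y \<times> 'w) list \<Rightarrow> ('y \<times> 'w) list \<Rightarrow> real" where
  "pre_dist Y W u v =
    (let d = u @ pre_scale Y (-1) v in sqrt (norm (pre_inner Y W d d)))"

definition tensor_Cauchy ::
  "('a::cstar_algebra, 'y, 'z1) hilbert_bimodule_scheme \<Rightarrow> ('a, 'w, 'z2) hilbert_bimodule_scheme
    \<Rightarrow> (nat \<Rightarrow> ('y \<times> 'w) list) set" where
  "tensor_Cauchy Y W = {u. (\<forall>n. set (u n) \<subseteq> carrier Y \<times> carrier W) \<and>
    (\<forall>\<epsilon>>0. \<exists>N. \<forall>m\<ge>N. \<forall>n\<ge>N. pre_dist Y W (u m) (u n) < \<epsilon>)}"

definition tensor_rel ::
  "('a::cstar_algebra, 'y, 'z1) hilbert_bimodule_scheme \<Rightarrow> ('a, 'w, 'z2) hilbert_bimodule_scheme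
    \<Rightarrow> (nat \<Rightarrow> ('y \<times> 'w) list) rel" where
  "tensor_rel Y W = {(u, v). u \<in> tensor_Cauchy Y W \<and> v \<in> tensor_Cauchy Y W \<and>
    (\<lambda>n. pre_dist Y W (u n) (v n)) \<longlonglongrightarrow> 0}"

definition tensor_product ::
  "('a::cstar_algebra, 'y, 'z1) hilbert_bimodule_scheme \<Rightarrow> ('a, 'w, 'z2) hilbert_bimodule_scheme
    \<Rightarrow> ('a, (nat \<Rightarrow> ('y \<times> 'w) list) set) hilbert_bimodule" where
  "tensor_product Y W =
    (let cls = (\<lambda>u. tensor_rel Y W `` {u}); rep = (\<lambda>\<xi>. SOME u. u \<in> \<xi>) in
    \<lparr>carrier = tensor_Cauchy Y W // tensor_rel Y W,
     vzero = cls (\<lambda>n. []),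
     vadd = (\<lambda>\<xi> \<eta>. cls (\<lambda>n. rep \<xi> n @ rep \<eta> n)),
     vscale = (\<lambda>c \<xi>. cls (\<lambda>n. pre_scale Y c (rep \<xi> n))),
     ract = (\<lambda>\<xi> a. cls (\<lambda>n. map (\<lambda>(y, w). (y, ract W w a)) (rep \<xi> n))),
     rinner = (\<lambda>\<xi> \<eta>. lim (\<lambda>n. pre_inner Y W (rep \<xi> n) (rep \<eta> n))),
     lact = (\<lambda>a \<xi>. cls (\<lambda>n. map (\<lambda>(y, w). (lact Y a y, w)) (rep \<xi> n)))\<rparr>)"

definition elementary_tensor ::
  "('a::cstar_algebra, 'y, 'z1) hilbert_bimodule_scheme \<Rightarrow> ('a, 'w, 'z2) hilbert_bimodule_scheme
    \<Rightarrow> 'y \<Rightarrow> 'w \<Rightarrow> (nat \<Rightarrow> ('y \<times> 'w) list) set" where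
  "elementary_tensor Y W y w = tensor_rel Y W `` {\<lambda>n. [(y, w)]}"


section \<open>Product systems\<close>

text \<open>\<open>deg\<close> is the homomorphism \<open>p : X \<rightarrow> P\<close>, and \<open>emb\<close> is the identification of \<open>A\<close> with
  the fibre over the identity.\<close>

record ('g, 'a, 'x) product_system = "'x partial_object" +
  pmult :: "'x \<Rightarrow> 'x \<Rightarrow> 'x" (infixl "\<star>\<index>" 70)
  deg :: "'x \<Rightarrow> 'g"
  fibre :: "'g \<Rightarrow> ('a, 'x) hilbert_bimodule"
  emb :: "'a \<Rightarrow> 'x"

locale product_system = P?: monoid P
  for P :: "('g, 'k) monoid_scheme" (structure) +
  fixes X :: "('g, 'a::cstar_algebra, 'x, 'z) product_system_scheme" (structure)
  assumes pmult_closed: "\<lbrakk>x \<in> carrier X; y \<in> carrier X\<rbrakk> \<Longrightarrow> x \<star>\<^bsub>X\<^esub> y \<in> carrier X"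
    and pmult_assoc: "\<lbrakk>x \<in> carrier X; y \<in> carrier X; z \<in> carrier X\<rbrakk>
      \<Longrightarrow> (x \<star>\<^bsub>X\<^esub> y) \<star>\<^bsub>X\<^esub> z = x \<star>\<^bsub>X\<^esub> (y \<star>\<^bsub>X\<^esub> z)"
    and deg_closed: "x \<in> carrier X \<Longrightarrow> deg X x \<in> carrier P"
    and deg_pmult: "\<lbrakk>x \<in> carrier X; y \<in> carrier X\<rbrakk>
      \<Longrightarrow> deg X (x \<star>\<^bsub>X\<^esub> y) = deg X x \<otimes>\<^bsub>P\<^esub> deg X y"
    and carrier_fibre: "s \<in> carrier P \<Longrightarrow> carrier (fibre X s) = {x \<in> carrier X. deg X x = s}"
    and fibre_bimodule: "s \<in> carrier P \<Longrightarrow> hilbert_bimodule (fibre X s)"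
    and fibre_tensor: "\<lbrakk>s \<in> carrier P; t \<in> carrier P; s \<noteq> \<one>\<^bsub>P\<^esub>; t \<noteq> \<one>\<^bsub>P\<^esub>\<rbrakk> \<Longrightarrow>
      \<exists>U. hilbert_bimodule_iso (tensor_product (fibre X s) (fibre X t)) (fibre X (s \<otimes>\<^bsub>P\<^esub> t)) U \<and>
        (\<forall>x\<in>carrier (fibre X s). \<forall>y\<in>carrier (fibre X t).
          U (elementary_tensor (fibre X s) (fibre X t) x y) = x \<star>\<^bsub>X\<^esub> y)"
    and fibre_one: "hilbert_bimodule_iso cstar_bimodule (fibre X \<one>\<^bsub>P\<^esub>) (emb X)"
    and emb_pmult: "\<lbrakk>s \<in> carrier P; x \<in> carrier (fibre X s)\<rbrakk>
      \<Longrightarrow> emb X a \<star>\<^bsub>X\<^esub> x = lact (fibre X s) a x"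
    and pmult_emb: "\<lbrakk>s \<in> carrier P; x \<in> carrier (fibre X s)\<rbrakk>
      \<Longrightarrow> x \<star>\<^bsub>X\<^esub> emb X a = ract (fibre X s) x a"

definition toeplitz_representation ::
  "('g, 'k) monoid_scheme \<Rightarrow> ('g, 'a::cstar_algebra, 'x, 'z) product_system_scheme
    \<Rightarrow> ('x \<Rightarrow> 'b::cstar_algebra) \<Rightarrow> bool" where
  "toeplitz_representation P X \<psi> \<longleftrightarrow>
    (\<forall>s\<in>carrier P. \<forall>x\<in>carrier (fibre X s). \<forall>y\<in>carrier (fibre X s).
      \<psi> (x \<oplus>\<^bsub>fibre X s\<^esub> y) = \<psi> x + \<psi> y) \<and>
    (\<forall>s\<in>carrier P. \<forall>x\<in>carrier (fibre X s). \<forall>c.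
      \<psi> (c \<odot>\<^bsub>fibre X s\<^esub> x) = c *\<^sub>C \<psi> x) \<and>
    star_homomorphism (\<lambda>a. \<psi> (emb X a)) \<and>
    (\<forall>x\<in>carrier X. \<forall>y\<in>carrier X. \<psi> (x \<star>\<^bsub>X\<^esub> y) = \<psi> x * \<psi> y) \<and>
    (\<forall>s\<in>carrier P. \<forall>x\<in>carrier (fibre X s). \<forall>y\<in>carrier (fibre X s).
      star (\<psi> x) * \<psi> y = \<psi> (emb X (rinner (fibre X s) x y)))"

text \<open>\<open>rep_compacts X \<psi> s\<close> is \<open>\<psi>\<^sup>(\<^sup>s\<^sup>)\<close>.\<close>

definition rep_compacts ::
  "('g, 'a::cstar_algebra, 'x, 'z) product_system_scheme \<Rightarrow> ('x \<Rightarrow> 'b::cstar_algebra) \<Rightarrow> 'g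
    \<Rightarrow> ('x \<Rightarrow> 'x) \<Rightarrow> 'b" where
  "rep_compacts X \<psi> s = (THE \<pi>. compacts_homomorphism (fibre X s) \<pi> \<and>
    (\<forall>x\<in>carrier (fibre X s). \<forall>y\<in>carrier (fibre X s).
      \<pi> (rank_one (fibre X s) x y) = \<psi> x * star (\<psi> y)))"


section \<open>Quasi-lattice ordered groups and Nica covariance\<close>

definition ql_le :: "('g, 'k) monoid_scheme \<Rightarrow> 'g set \<Rightarrow> 'g \<Rightarrow> 'g \<Rightarrow> bool" where
  "ql_le G P s t \<longleftrightarrow> inv\<^bsub>G\<^esub> s \<otimes>\<^bsub>G\<^esub> t \<in> P"

definition upper_bounds :: "('g, 'k) monoid_scheme \<Rightarrow> 'g set \<Rightarrow> 'g set \<Rightarrow> 'g set" where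
  "upper_bounds G P F = {u \<in> P. \<forall>s\<in>F. ql_le G P s u}"

definition is_lub :: "('g, 'k) monoid_scheme \<Rightarrow> 'g set \<Rightarrow> 'g set \<Rightarrow> 'g \<Rightarrow> bool" where
  "is_lub G P F v \<longleftrightarrow> v \<in> upper_bounds G P F \<and> (\<forall>w\<in>upper_bounds G P F. ql_le G P v w)"

locale quasi_lattice_ordered = group G + submonoid P G
  for G :: "('g, 'k) monoid_scheme" (structure) and P :: "'g set" +
  assumes pointed: "P \<inter> (\<lambda>s. inv s) ` P = {\<one>}"
    and lub_exists: "\<lbrakk>finite F; F \<subseteq> carrier G; upper_bounds G P F \<noteq> {}\<rbrakk>
      \<Longrightarrow> \<exists>v. is_lub G P F v"

text \<open>\<open>s \<or> t < \<infinity>\<close> is \<open>joinable G P s t\<close>; only then is \<open>join G P s t\<close> meaningful.\<close>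

definition joinable :: "('g, 'k) monoid_scheme \<Rightarrow> 'g set \<Rightarrow> 'g \<Rightarrow> 'g \<Rightarrow> bool" where
  "joinable G P s t \<longleftrightarrow> upper_bounds G P {s, t} \<noteq> {}"

definition join :: "('g, 'k) monoid_scheme \<Rightarrow> 'g set \<Rightarrow> 'g \<Rightarrow> 'g \<Rightarrow> 'g" where
  "join G P s t = (THE v. is_lub G P {s, t} v)"

text \<open>\<open>amplify G X s r S\<close> is the operator \<open>S \<otimes>\<^sub>A 1\<close> on the fibre over \<open>r\<close>, for \<open>r \<ge> s\<close>.\<close>

definition amplify ::
  "('g, 'k) monoid_scheme \<Rightarrow> ('g, 'a::cstar_algebra, 'x, 'z) product_system_scheme
    \<Rightarrow> 'g \<Rightarrow> 'g \<Rightarrow> ('x \<Rightarrow> 'x) \<Rightarrow> 'x \<Rightarrow> 'x" where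
  "amplify G X s r S = (THE R. R \<in> adjointables (fibre X r) \<and>
    (\<forall>x\<in>carrier (fibre X s). \<forall>y\<in>carrier (fibre X (inv\<^bsub>G\<^esub> s \<otimes>\<^bsub>G\<^esub> r)).
      R (x \<star>\<^bsub>X\<^esub> y) = S x \<star>\<^bsub>X\<^esub> y))"

definition amplified_product ::
  "('g, 'k) monoid_scheme \<Rightarrow> 'g set \<Rightarrow> ('g, 'a::cstar_algebra, 'x, 'z) product_system_scheme
    \<Rightarrow> 'g \<Rightarrow> 'g \<Rightarrow> ('x \<Rightarrow> 'x) \<Rightarrow> ('x \<Rightarrow> 'x) \<Rightarrow> 'x \<Rightarrow> 'x" where
  "amplified_product G P X s t S T =
    (let r = join G P s t in op_comp (fibre X r) (amplify G X s r S) (amplify G X t r T))"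

definition compactly_aligned ::
  "('g, 'k) monoid_scheme \<Rightarrow> 'g set \<Rightarrow> ('g, 'a::cstar_algebra, 'x, 'z) product_system_scheme
    \<Rightarrow> bool" where
  "compactly_aligned G P X \<longleftrightarrow>
    (\<forall>s\<in>P. \<forall>t\<in>P. joinable G P s t \<longrightarrow>
      (\<forall>S\<in>compacts (fibre X s). \<forall>T\<in>compacts (fibre X t).
        amplified_product G P X s t S T \<in> compacts (fibre X (join G P s t))))"

definition nica_covariant ::
  "('g, 'k) monoid_scheme \<Rightarrow> 'g set \<Rightarrow> ('g, 'a::cstar_algebra, 'x, 'z) product_system_scheme
    \<Rightarrow> ('x \<Rightarrow> 'b::cstar_algebra) \<Rightarrow> bool" where
  "nica_covariant G P X \<psi> \<longleftrightarrow>
    (\<forall>s\<in>P. \<forall>t\<in>P. \<forall>S\<in>compacts (fibre X s). \<forall>T\<in>compacts (fibre X t).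
      rep_compacts X \<psi> s S * rep_compacts X \<psi> t T =
        (if joinable G P s t
         then rep_compacts X \<psi> (join G P s t) (amplified_product G P X s t S T)
         else 0))"

end

theory Submission
  imports Defs
begin

text \<open>Everything reduces to \<open>(\<sigma> \<circ> \<psi>)\<^sup>(\<^sup>s\<^sup>) = \<sigma> \<circ> \<psi>\<^sup>(\<^sup>s\<^sup>)\<close> on \<open>\<K>(X\<^sub>s)\<close>, after which \<open>\<sigma>\<close> is applied
  to both sides of the Nica covariance relation. Since \<open>\<sigma> \<circ> \<psi>\<^sup>(\<^sup>s\<^sup>)\<close> has the defining values on
  rank one operators, the identity follows once \<open>\<psi>\<^sup>(\<^sup>s\<^sup>)\<close> is known to exist and to be unique.

  Existence: for \<open>F = \<Sum>\<Theta>\<^bsub>x,y\<^esub>\<close> and \<open>T = \<Sum>\<psi>(x) \<psi>(y)\<^sup>*\<close> with \<open>T\<close> self-adjoint, the powers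
  \<open>T\<^bsup>n+1\<^esup> = \<Sum>\<psi>(F\<^bsup>n\<^esup> x) \<psi>(y)\<^sup>*\<close> grow at most like \<open>\<parallel>F\<parallel>\<^bsup>n\<^esup>\<close>, so \<open>\<parallel>T\<parallel> \<le> \<parallel>F\<parallel>\<close>.
  Uniqueness: *-homomorphisms are contractive. If \<open>\<parallel>b\<parallel> < 1\<close> and \<open>b = b\<^sup>*\<close>, then \<open>1 - b\<^sup>2 = (1 - e)\<^sup>2\<close> for some
  \<open>e\<close> commuting with \<open>b\<close>, and \<open>b + i (1 - e)\<close> is unitary; both facts survive a homomorphism and bound
  the image of \<open>b\<close>. No spectral theory is used.

  Cauchy-Schwarz in a Hilbert module needs the positivity of \<open>b\<^sup>* b\<close> (Kelley and Vaught). A lower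
  bound \<open>b\<^sup>* b \<ge> -l\<close> is encoded by norms, as \<open>\<parallel>c - b\<^sup>* b\<parallel> \<le> c + l\<close> for large \<open>c\<close>, and is improved by a
  constant factor by passing to \<open>b (b\<^sup>* b + m)\<^bsup>-1/2\<^esup>\<close> with \<open>m > l\<close>.\<close>

section \<open>Square roots and positivity in unital $C^*$-algebras\<close>

lemma star_zero [simp]: "star (0::'a::cstar_algebra) = 0"
  using star_add[of "0::'a" 0] by simp

lemma star_minus [simp]: "star (- x) = - star (x::'a::cstar_algebra)"
  using star_add[of x "-x"] by (simp add: eq_neg_iff_add_eq_0 add.commute)

lemma star_diff: "star (x - y) = star x - star (y::'a::cstar_algebra)"
  using star_add[of x "-y"] by simp

lemma star_scaleR: "star (r *\<^sub>R x) = r *\<^sub>R star (x::'a::cstar_algebra)"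
  by (simp add: scaleR_scaleC star_scaleC)

declare star_star [simp]

lemma scaleC_zero_left [simp]: "0 *\<^sub>C x = (0::'a::cstar_algebra)"
  using scaleC_add_left[of 0 0 x] by simp

lemma scaleC_zero_right [simp]: "c *\<^sub>C 0 = (0::'a::cstar_algebra)"
  using scaleC_add_right[of c 0 "0::'a"] by simp

lemma scaleC_one [simp]: "1 *\<^sub>C x = (x::'a::cstar_algebra)"
  using scaleR_scaleC[of 1 x] by simp

lemma scaleC_minus_left: "(- c) *\<^sub>C x = - (c *\<^sub>C (x::'a::cstar_algebra))"
  using scaleC_add_left[of c "-c" x] by (simp add: eq_neg_iff_add_eq_0 add.commute)

lemma scaleC_minus_one [simp]: "(- 1) *\<^sub>C x = - (x::'a::cstar_algebra)"
  by (simp add: scaleC_minus_left)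

lemma scaleC_minus_right: "c *\<^sub>C (- x) = - (c *\<^sub>C (x::'a::cstar_algebra))"
  using scaleC_add_right[of c x "-x"] by (simp add: eq_neg_iff_add_eq_0 add.commute)

lemma scaleC_diff_right: "c *\<^sub>C (x - y) = c *\<^sub>C x - c *\<^sub>C (y::'a::cstar_algebra)"
  using scaleC_add_right[of c x "-y"] by (simp add: scaleC_minus_right)

text \<open>The C*-identity and submultiplicativity give \<open>norm y \<le> norm (star y)\<close>
  for every \<open>y\<close>; taking \<open>x\<close> and \<open>star x\<close> for \<open>y\<close>
  yields equality.\<close>

lemma norm_star [simp]: "norm (star x) = norm (x::'a::cstar_algebra)"
proof -
  have *: "norm y \<le> norm (star y)" for y :: 'a
  proof (cases "norm y = 0")
    case False
    have "norm y * norm y \<le> norm (star y) * norm y"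
      using norm_mult_ineq[of "star y" y] cstar_identity[of y] by (simp add: power2_eq_square)
    with False show ?thesis by simp
  qed simp
  show ?thesis using *[of x] *[of "star x"] by simp
qed

lemma norm_mult_star: "norm (x * star x) = (norm (x::'a::cstar_algebra))\<^sup>2"
  using cstar_identity[of "star x"] by simp

lemma continuous_star: "(f \<longlonglongrightarrow> l) \<Longrightarrow> (\<lambda>n. star (f n)) \<longlonglongrightarrow> star (l::'a::cstar_algebra)"
  unfolding tendsto_iff dist_norm by (simp flip: star_diff)

text \<open>Nondegeneracy without a unit: the choice \<open>y = star (a - b)\<close> makes
  \<open>star (a - b) * (a - b)\<close> vanish.\<close>

lemma left_mult_cancel:
  assumes "\<And>y. y * a = y * (b::'a::cstar_algebra)" shows "a = b"
  using assms[of "star (a - b)"] cstar_identity[of "a - b"] by (simp add: right_diff_distrib)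

text \<open>Banach's fixed point theorem is applied inside such sets, so that the fixed points are
  automatically self-adjoint and commute with everything in \<open>C\<close>.\<close>

lemma closed_commute_hermitian: "closed {e::'a::cstar_algebra. star e = e \<and> (\<forall>y\<in>C. y * e = e * y)}"
proof -
  have "closed {e::'a. star e = e}"
  proof -
    have "closed {e::'a. star e - e = 0}"
      unfolding closed_sequential_limits
    proof safe
      fix f :: "nat \<Rightarrow> 'a" and l assume *: "\<forall>n. f n \<in> {e. star e - e = 0}" and l: "f \<longlonglongrightarrow> l"
      have "(\<lambda>n. star (f n) - f n) \<longlonglongrightarrow> star l - l"
        by (intro tendsto_intros continuous_star l)
      moreover have "(\<lambda>n. star (f n) - f n) = (\<lambda>n. 0)" using * by auto
      ultimately show "star l - l = 0" by (metis LIMSEQ_const_iff)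
    qed
    thus ?thesis by simp
  qed
  moreover have "closed {e::'a. \<forall>y\<in>C. y * e = e * y}"
    unfolding Ball_def by (intro closed_Collect_all closed_Collect_imp closed_Collect_eq continuous_intros) auto
  ultimately have "closed ({e::'a. star e = e} \<inter> {e::'a. \<forall>y\<in>C. y * e = e * y})" by (rule closed_Int)
  thus ?thesis by (simp add: Collect_conj_eq)
qed

text \<open>The element \<open>1 - e\<close> is a square root of \<open>1 - z\<close>; this formulation needs no unit.\<close>

lemma one_minus_sqrt_exists:
  fixes z :: "'a::cstar_algebra"
  assumes z: "star z = z" "norm z < 1"
  shows "\<exists>e. star e = e \<and> norm e < 1 \<and> e + e = z + e * e \<and> (\<forall>y. y * z = z * y \<longrightarrow> y * e = e * y)"
proof -
  define q where "q = norm z"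
  define C where "C = {y. y * z = z * y}"
  \<comment> \<open>The equation for \<open>e\<close> is the fixed point equation of
    \<open>F\<close>. On the ball of radius \<open>q\<close> the map is Lipschitz with constant
    \<open>q\<close>; from \<open>q < 1\<close> come both the invariance of the ball, as
    \<open>q + q * q \<le> 2 * q\<close>, and the contraction.\<close>
  define S where "S = cball 0 q \<inter> {e. star e = e \<and> (\<forall>y\<in>C. y * e = e * y)}"
  define F where "F = (\<lambda>e. (1/2) *\<^sub>R (z + e * e))"
  have q: "0 \<le> q" "q < 1" using z by (auto simp: q_def)
  have "complete S" unfolding S_def
    by (intro closed_Int closed_cball closed_commute_hermitian complete_eq_closed[THEN iffD2])
  moreover have "0 \<in> S" using q by (simp add: S_def)
  hence "S \<noteq> {}" by blast
  moreover have "F ` S \<subseteq> S"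
  proof
    fix f assume "f \<in> F ` S"
    then obtain e where e: "e \<in> S" "f = F e" by auto
    have "norm (z + e * e) \<le> q + q * q"
      using e norm_mult_ineq[of e e] mult_mono[of "norm e" q "norm e" q] q
      by (intro norm_triangle_le) (auto simp: S_def q_def)
    also have "\<dots> \<le> 2 * q" using q mult_left_le[of q q] by auto
    finally have "norm f \<le> q" by (simp add: e(2) F_def)
    moreover have "star f = f" using e z by (simp add: F_def S_def star_scaleR star_add star_mult)
    moreover have "\<forall>y\<in>C. y * f = f * y"
    proof
      fix y assume y: "y \<in> C"
      have ye: "y * e = e * y" using e y by (simp add: S_def)
      have "y * (e * e) = (y * e) * e" by (simp only: mult.assoc)
      also have "\<dots> = e * (y * e)" by (simp only: ye mult.assoc)
      also have "\<dots> = e * e * y" by (simp only: ye mult.assoc)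
      finally have "y * (e * e) = e * e * y" .
      thus "y * f = f * y" using y by (simp add: e F_def C_def distrib_left distrib_right)
    qed
    ultimately show "f \<in> S" by (simp add: S_def)
  qed
  moreover have "dist (F x) (F y) \<le> q * dist x y" if xy: "x \<in> S" "y \<in> S" for x y
  proof -
    have "F x - F y = (1/2) *\<^sub>R (x * (x - y) + (x - y) * y)"
      by (simp add: F_def algebra_simps)
    moreover have "norm (x * (x - y) + (x - y) * y) \<le> q * norm (x - y) + norm (x - y) * q"
      using xy by (intro norm_triangle_mono order_trans[OF norm_mult_ineq] mult_mono) (use q in \<open>auto simp: S_def\<close>)
    ultimately show "dist (F x) (F y) \<le> q * dist x y" by (simp add: dist_norm)
  qed
  ultimately obtain e where e: "e \<in> S" "F e = e"
    using Banach_fix[of S q F] q by blast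
  have "e + e = (2::real) *\<^sub>R F e" using e by (simp add: scaleR_2)
  also have "\<dots> = z + e * e" by (simp add: F_def)
  finally have "e + e = z + e * e" .
  moreover have "star e = e" "norm e < 1" using e(1) q by (simp_all add: S_def)
  moreover have "\<forall>y. y * z = z * y \<longrightarrow> y * e = e * y" using e(1) unfolding S_def C_def by blast
  ultimately show ?thesis by blast
qed

section \<open>Unital algebras and lower bounds of self-adjoint elements\<close>

class unital_cstar_algebra = cstar_algebra + monoid_mult

lemma star_one [simp]: "star (1::'a::unital_cstar_algebra) = 1"
  by (metis mult_1_left mult_1_right star_mult star_star)

text \<open>Only an inequality, because the class admits the zero algebra, whose unit has norm
  0.\<close>

lemma norm_one_le: "norm (1::'a::unital_cstar_algebra) \<le> 1"
proof -
  have "(norm (1::'a))\<^sup>2 = norm (1::'a)" using cstar_identity[of "1::'a"] by simp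
  thus ?thesis by (metis order_refl power2_eq_square mult_cancel_right1 norm_zero zero_le_one norm_ge_zero)
qed

lemma norm_scaleR_one_le: "norm (c *\<^sub>R (1::'a::unital_cstar_algebra)) \<le> \<bar>c\<bar>"
  using mult_left_mono[OF norm_one_le, of "\<bar>c\<bar>"] by simp

text \<open>The element \<open>x + i y\<close> is \<open>\<surd>s\<close> times a unitary.\<close>

lemma norm_le_of_sum_squares:
  fixes x y :: "'a::unital_cstar_algebra"
  assumes xy: "star x = x" "star y = y" "x * y = y * x" "x * x + y * y = s *\<^sub>R 1" and s: "0 \<le> s"
  shows "(norm x)\<^sup>2 \<le> s"
proof -
  define u where "u = x + \<i> *\<^sub>C y"
  have su: "star u = x - \<i> *\<^sub>C y"
    using xy by (simp add: u_def star_add star_scaleC scaleC_minus_left)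
  have "star u * u = (x - \<i> *\<^sub>C y) * (x + \<i> *\<^sub>C y)"
    by (simp only: su) (simp only: u_def)
  also have "\<dots> = x * x + y * y"
    using xy by (simp add: algebra_simps mult_scaleC_left mult_scaleC_right scaleC_scaleC scaleC_diff_right)
  finally have "star u * u = x * x + y * y" .
  hence "(norm u)\<^sup>2 \<le> s"
    using norm_scaleR_one_le[of s, where 'a='a] s xy cstar_identity[of u] by simp
  hence u: "norm u \<le> sqrt s" by (rule real_le_rsqrt)
  have "u + star u = x + x" by (simp only: su) (simp add: u_def)
  hence "x = (1/2) *\<^sub>R (u + star u)" by (simp flip: scaleR_2)
  hence "norm x \<le> (norm u + norm u) / 2"
    using norm_triangle_ineq[of u "star u"] norm_star[of u] by simp
  hence "norm x \<le> sqrt s" using u by simp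
  thus ?thesis using s by (metis norm_ge_zero power_mono real_sqrt_pow2)
qed

text \<open>For self-adjoint \<open>h\<close> this says \<open>h \<ge> -l\<close>.\<close>

definition lower_bound :: "real \<Rightarrow> 'a::unital_cstar_algebra \<Rightarrow> bool" where
  "lower_bound l h \<longleftrightarrow> star h = h \<and> (\<exists>c\<^sub>0. \<forall>c\<ge>c\<^sub>0. norm (c *\<^sub>R 1 - h) \<le> c + l)"

text \<open>A single constant suffices: passing from \<open>c\<^sub>0\<close> to \<open>c\<close>
  adds a multiple of the unit of norm at most \<open>c - c\<^sub>0\<close>.\<close>

lemma lower_boundI:
  fixes h :: "'a::unital_cstar_algebra"
  assumes "star h = h" "norm (c\<^sub>0 *\<^sub>R 1 - h) \<le> c\<^sub>0 + l"
  shows "lower_bound l h"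
  unfolding lower_bound_def
proof (intro conjI exI allI impI)
  fix c assume "c\<^sub>0 \<le> c"
  have "c *\<^sub>R 1 - h = (c - c\<^sub>0) *\<^sub>R 1 + (c\<^sub>0 *\<^sub>R 1 - h)" by (simp add: algebra_simps)
  also have "norm \<dots> \<le> (c - c\<^sub>0) + (c\<^sub>0 + l)"
    using norm_scaleR_one_le[of "c - c\<^sub>0", where 'a='a] \<open>c\<^sub>0 \<le> c\<close> assms by (intro norm_triangle_mono) auto
  finally show "norm (c *\<^sub>R 1 - h) \<le> c + l" by simp
qed fact

lemma lower_bound_norm: "star h = h \<Longrightarrow> lower_bound (norm h) h"
  by (rule lower_boundI[of _ 0]) auto

lemma lower_bound_mono: "lower_bound l h \<Longrightarrow> l \<le> m \<Longrightarrow> lower_bound m h"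
  unfolding lower_bound_def by force

lemma lower_bound_add:
  assumes "lower_bound l h" "lower_bound m k" shows "lower_bound (l + m) (h + k)"
proof -
  from assms obtain c d where *: "\<And>x. x \<ge> c \<Longrightarrow> norm (x *\<^sub>R 1 - h) \<le> x + l"
    "\<And>x. x \<ge> d \<Longrightarrow> norm (x *\<^sub>R 1 - k) \<le> x + m" and h: "star h = h" "star k = k"
    unfolding lower_bound_def by blast
  have "(c + d) *\<^sub>R 1 - (h + k) = (c *\<^sub>R 1 - h) + (d *\<^sub>R 1 - k)" by (simp add: algebra_simps)
  also have "norm \<dots> \<le> (c + l) + (d + m)" by (intro norm_triangle_mono * order_refl)
  finally show ?thesis using h by (intro lower_boundI[of _ "c + d"]) (auto simp: star_add)
qed

lemma lower_bound_scaleR: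
  assumes "lower_bound l h" "0 < a" shows "lower_bound (a * l) (a *\<^sub>R h)"
proof -
  from assms obtain c where "norm (c *\<^sub>R 1 - h) \<le> c + l" "star h = h" by (auto simp: lower_bound_def)
  moreover have "(a * c) *\<^sub>R 1 - a *\<^sub>R h = a *\<^sub>R (c *\<^sub>R 1 - h)" by (simp add: algebra_simps)
  ultimately show ?thesis using assms
    by (intro lower_boundI[of _ "a * c"]) (auto simp: star_scaleR simp flip: distrib_left)
qed

lemma lower_bound_add_scaleR_one:
  assumes "lower_bound l h" shows "lower_bound (l - m) (h + m *\<^sub>R 1)"
proof -
  from assms obtain c where "norm (c *\<^sub>R 1 - h) \<le> c + l" "star h = h" by (auto simp: lower_bound_def)
  thus ?thesis
    by (intro lower_boundI[of _ "c + m"]) (auto simp: star_add star_scaleR algebra_simps)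
qed

text \<open>Scale so that \<open>z = k * k / c\<close> has norm below 1 and write
  \<open>1 - z\<close> as the square of \<open>x = 1 - e\<close>. Then \<open>x\<close> commutes
  with \<open>k\<close>, and the squares of \<open>x\<close> and of \<open>k / sqrt c\<close> add up
  to 1; this forces \<open>norm (1 - z) \<le> 1\<close>.\<close>

lemma lower_bound_square:
  fixes k :: "'a::unital_cstar_algebra"
  assumes k: "star k = k" shows "lower_bound 0 (k * k)"
proof -
  define c where "c = (norm k)\<^sup>2 + 1"
  define z where "z = (1 / c) *\<^sub>R (k * k)"
  have c: "c > 0" by (simp add: c_def add_nonneg_pos)
  have "norm (k * k) < c" using cstar_identity[of k] k by (simp add: c_def)
  hence "norm z < 1" using c by (simp add: z_def divide_less_eq)
  moreover have "star z = z" by (simp add: z_def star_scaleR star_mult k)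
  ultimately obtain e where e: "star e = e" "e + e = z + e * e" "\<And>y. y * z = z * y \<Longrightarrow> y * e = e * y"
    using one_minus_sqrt_exists by blast
  have "k * e = e * k" by (rule e(3)) (simp add: z_def mult.assoc)
  define x where "x = 1 - e"
  have sq: "x * x = 1 - z" using e(2) by (simp add: x_def algebra_simps)
  have "(norm x)\<^sup>2 \<le> 1"
  proof (rule norm_le_of_sum_squares)
    show "x * ((1 / sqrt c) *\<^sub>R k) = ((1 / sqrt c) *\<^sub>R k) * x"
      using \<open>k * e = e * k\<close> by (simp add: x_def left_diff_distrib right_diff_distrib scaleR_right_diff_distrib)
    show "x * x + ((1 / sqrt c) *\<^sub>R k) * ((1 / sqrt c) *\<^sub>R k) = 1 *\<^sub>R 1"
      using c by (simp add: sq z_def)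
  qed (simp_all add: x_def star_diff star_scaleR e(1) k)
  hence "norm (1 - z) \<le> 1" using norm_mult_ineq[of x x] by (simp add: sq power2_eq_square)
  moreover have "c *\<^sub>R 1 - k * k = c *\<^sub>R (1 - z)" using c by (simp add: z_def algebra_simps)
  ultimately have "norm (c *\<^sub>R 1 - k * k) \<le> c + 0" using c by simp
  thus ?thesis using k by (intro lower_boundI) (auto simp: star_mult)
qed

text \<open>The Neumann series in the form of the fixed point equation \<open>v = 1 + e * v\<close>.
  Working inside \<open>S\<close> hands self-adjointness and commutation over to the limit.\<close>

lemma inverse_one_minus_exists:
  fixes e :: "'a::unital_cstar_algebra"
  assumes e: "star e = e" "norm e < 1"
  shows "\<exists>v. star v = v \<and> v * (1 - e) = 1 \<and> (1 - e) * v = 1 \<and> (\<forall>y. y * e = e * y \<longrightarrow> y * v = v * y)"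
proof -
  define C where "C = {y. y * e = e * y}"
  define S where "S = {v. star v = v \<and> (\<forall>y\<in>C. y * v = v * y)}"
  define F where "F = (\<lambda>v. 1 + e * v)"
  have "e \<in> C" by (simp add: C_def)
  have "complete S" unfolding S_def
    by (intro closed_commute_hermitian complete_eq_closed[THEN iffD2])
  moreover have "0 \<in> S" by (simp add: S_def)
  hence "S \<noteq> {}" by blast
  moreover have "F ` S \<subseteq> S"
  proof
    fix f assume "f \<in> F ` S"
    then obtain v where v: "v \<in> S" "f = F v" by auto
    have ev: "e * v = v * e" using v \<open>e \<in> C\<close> by (simp add: S_def)
    hence "star f = f" using v e by (simp add: F_def S_def star_add star_mult)
    moreover have "\<forall>y\<in>C. y * f = f * y"
    proof
      fix y assume y: "y \<in> C"
      have yv: "y * v = v * y" using v y by (simp add: S_def)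
      have ye: "y * e = e * y" using y by (simp add: C_def)
      have "y * (e * v) = (y * e) * v" by (simp only: mult.assoc)
      also have "\<dots> = e * (y * v)" by (simp only: ye mult.assoc)
      also have "\<dots> = e * v * y" by (simp only: yv mult.assoc)
      finally have "y * (e * v) = e * v * y" .
      thus "y * f = f * y" by (simp add: v F_def distrib_left distrib_right)
    qed
    ultimately show "f \<in> S" by (simp add: S_def)
  qed
  moreover have "dist (F x) (F y) \<le> norm e * dist x y" for x y
  proof -
    have "F x - F y = e * (x - y)" by (simp add: F_def algebra_simps)
    thus "dist (F x) (F y) \<le> norm e * dist x y" by (simp add: dist_norm norm_mult_ineq)
  qed
  ultimately obtain v where v: "v \<in> S" "F v = v"
    using Banach_fix[of S "norm e" F] e(2) norm_ge_zero by blast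
  have "e * v = v * e" using v \<open>e \<in> C\<close> by (simp add: S_def)
  moreover have "v - e * v = 1" using v(2) unfolding F_def by (metis add_diff_cancel_right')
  ultimately have "v * (1 - e) = 1" "(1 - e) * v = 1" by (simp_all add: left_diff_distrib right_diff_distrib)
  moreover have "star v = v" "\<forall>y. y * e = e * y \<longrightarrow> y * v = v * y" using v(1) unfolding S_def C_def by blast+
  ultimately show ?thesis by blast
qed

text \<open>Dividing \<open>h + m\<close> by \<open>d = c + m\<close> gives \<open>1 - z\<close>
  with \<open>z = (c - h) / d\<close>, and \<open>norm z \<le> (c + l) / (c + m)\<close>. The gap
  \<open>l < m\<close> makes this less than 1, which yields the root and also its inverse
  \<open>g\<close>.\<close>

lemma lower_bound_sqrt:
  fixes h :: "'a::unital_cstar_algebra"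
  assumes h: "lower_bound l h" and l: "l < m"
  obtains r g where "star r = r" "star g = g" "r * g = 1" "g * r = 1" "r * r = h + m *\<^sub>R 1"
    "\<And>y. y * h = h * y \<Longrightarrow> y * r = r * y" "\<And>y. y * h = h * y \<Longrightarrow> y * g = g * y"
proof -
  from h obtain c\<^sub>0 where c0: "\<And>c. c \<ge> c\<^sub>0 \<Longrightarrow> norm (c *\<^sub>R 1 - h) \<le> c + l" and sh: "star h = h"
    by (auto simp: lower_bound_def)
  \<comment> \<open>The second entry guarantees \<open>d \<ge> 1\<close>, so that division by
    \<open>d\<close> is harmless.\<close>
  define c where "c = max c\<^sub>0 (1 - m)"
  define d where "d = c + m"
  define z where "z = (1 / d) *\<^sub>R (c *\<^sub>R 1 - h)"
  have d: "d > 0" by (simp add: d_def c_def)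
  have "norm (c *\<^sub>R 1 - h) < d" using c0[of c] l by (simp add: d_def c_def)
  hence "norm z < 1" using d by (simp add: z_def divide_less_eq)
  moreover have "star z = z" by (simp add: z_def star_scaleR star_diff sh)
  ultimately obtain e where e: "star e = e" "norm e < 1" "e + e = z + e * e" "\<And>y. y * z = z * y \<Longrightarrow> y * e = e * y"
    using one_minus_sqrt_exists by blast
  from inverse_one_minus_exists[OF e(1,2)] obtain v where
    v: "star v = v" "v * (1 - e) = 1" "(1 - e) * v = 1" "\<And>y. y * e = e * y \<Longrightarrow> y * v = v * y" by blast
  have comm: "y * e = e * y" if "y * h = h * y" for y
    by (rule e(4)) (simp add: z_def left_diff_distrib right_diff_distrib that)
  show ?thesis
  proof
    show "star (sqrt d *\<^sub>R (1 - e)) = sqrt d *\<^sub>R (1 - e)" using e(1) by (simp add: star_scaleR star_diff)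
    show "star ((1 / sqrt d) *\<^sub>R v) = (1 / sqrt d) *\<^sub>R v" using v(1) by (simp add: star_scaleR)
    show "(sqrt d *\<^sub>R (1 - e)) * ((1 / sqrt d) *\<^sub>R v) = 1"
      "((1 / sqrt d) *\<^sub>R v) * (sqrt d *\<^sub>R (1 - e)) = 1"
      using d v(2,3) by simp_all
    have "(1 - e) * (1 - e) = 1 - z" using e(3) by (simp add: algebra_simps)
    hence "(sqrt d *\<^sub>R (1 - e)) * (sqrt d *\<^sub>R (1 - e)) = d *\<^sub>R (1 - z)" using d by simp
    also have "\<dots> = d *\<^sub>R 1 - (c *\<^sub>R 1 - h)" using d by (simp add: z_def scaleR_right_diff_distrib)
    also have "\<dots> = h + m *\<^sub>R 1" by (simp add: algebra_simps d_def)
    finally show "(sqrt d *\<^sub>R (1 - e)) * (sqrt d *\<^sub>R (1 - e)) = h + m *\<^sub>R 1" .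
  qed (simp_all add: left_diff_distrib right_diff_distrib comm v(4))
qed

section \<open>Comparison of norms through high powers\<close>

text \<open>A substitute for the spectral radius formula: if \<open>b < a\<close>, then
  \<open>(b / a) ^ (2 ^ n)\<close> decays faster than \<open>2 ^ n\<close> grows, so a factor linear
  in the exponent cannot rescue the estimate.\<close>

lemma le_if_powers_le:
  fixes a b K :: real
  assumes b: "0 < b" and *: "\<And>n. a ^ (2 ^ n) \<le> K * 2 ^ n * b ^ (2 ^ n)"
  shows "a \<le> b"
proof (rule ccontr)
  assume "\<not> a \<le> b"
  define x where "x = b / a"
  have x: "0 < x" "x < 1" "a > 0" using b \<open>\<not> a \<le> b\<close> by (auto simp: x_def)
  have "(\<lambda>n. real n * x ^ n) \<longlonglongrightarrow> 0" using x by (intro powser_times_n_limit_0) auto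
  hence "((\<lambda>n. real n * x ^ n) \<circ> (\<lambda>n. 2 ^ n)) \<longlonglongrightarrow> 0"
    by (rule LIMSEQ_subseq_LIMSEQ) (simp add: strict_mono_def)
  hence "(\<lambda>n. K * (real (2 ^ n) * x ^ (2 ^ n))) \<longlonglongrightarrow> K * 0"
    unfolding o_def by (rule tendsto_mult_left)
  moreover have "1 \<le> K * (real (2 ^ n) * x ^ (2 ^ n))" for n
    using *[of n] x b by (simp add: x_def power_divide field_simps)
  ultimately have "1 \<le> K * 0" by (intro LIMSEQ_le_const) auto
  thus False by simp
qed

text \<open>For self-adjoint elements the C*-identity says that squaring an element squares its
  norm; iterating it reaches the exponents that are powers of two.\<close>

lemma norm_power_hermitian:
  assumes "star x = (x::'a::unital_cstar_algebra)" shows "norm (x ^ (2 ^ n)) = norm x ^ (2 ^ n)"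
proof (induction n)
  case (Suc n)
  have "star (x ^ k) = x ^ k" for k
    by (induction k) (simp_all add: star_mult assms power_commutes)
  hence "norm (x ^ (2 ^ n) * x ^ (2 ^ n)) = (norm (x ^ (2 ^ n)))\<^sup>2"
    using cstar_identity[of "x ^ (2 ^ n)"] by simp
  thus ?case using Suc by (simp flip: power_add mult_2 power_mult add: mult.commute)
qed simp

text \<open>The spectra of \<open>x\<^sup>* x\<close> and \<open>x x\<^sup>*\<close> agree up to \<open>0\<close>; only this norm
  inequality is needed, and it follows by comparing high powers.\<close>

lemma norm_diff_star_mult_le:
  fixes x :: "'a::unital_cstar_algebra"
  assumes c: "\<bar>c\<bar> \<le> C" and C: "norm (c *\<^sub>R 1 - x * star x) \<le> C" "0 < C"
  shows "norm (c *\<^sub>R 1 - star x * x) \<le> C"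
proof -
  define u where "u = c *\<^sub>R 1 - star x * x"
  define w where "w = c *\<^sub>R 1 - x * star x"
  define M where "M = (norm x)\<^sup>2 / C + 1"
  \<comment> \<open>Intertwining transfers the geometric bound on the powers of \<open>w\<close> to
    those of \<open>u\<close>.\<close>
  have xw: "star x * w ^ n = u ^ n * star x" for n
  proof (induction n)
    case (Suc n)
    have "star x * w = u * star x" by (simp add: u_def w_def algebra_simps)
    hence "star x * w ^ Suc n = u * (star x * w ^ n)" by (simp flip: mult.assoc)
    thus ?case by (simp add: Suc mult.assoc)
  qed simp
  have pw: "norm (w ^ n) \<le> C ^ n" for n
  proof (induction n)
    case (Suc n)
    thus ?case using norm_mult_ineq[of w "w ^ n"] C
      by (auto simp: w_def[symmetric] intro!: order_trans[OF norm_mult_ineq] mult_mono)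
  qed (simp add: norm_one_le)
  \<comment> \<open>Each further factor \<open>u\<close> costs \<open>c\<close> times the previous
    power plus one term \<open>star x * w ^ n * x\<close>. The excess over \<open>C ^ n\<close>
    therefore grows only linearly in \<open>n\<close>, and \<open>le_if_powers_le\<close> discards
    it.\<close>
  have bound: "norm (u ^ n) \<le> C ^ n * (1 + n * ((norm x)\<^sup>2 / C))" for n
  proof (induction n)
    case (Suc n)
    have "u ^ Suc n = u ^ n * u" by (simp add: power_commutes)
    also have "\<dots> = c *\<^sub>R u ^ n - star x * w ^ n * x"
      by (simp add: xw) (simp add: u_def algebra_simps)
    finally have "norm (u ^ Suc n) \<le> \<bar>c\<bar> * norm (u ^ n) + norm (star x * w ^ n * x)"
      using norm_triangle_ineq4[of "c *\<^sub>R u ^ n" "star x * w ^ n * x"] by simp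
    also have "norm (star x * w ^ n * x) \<le> norm x * C ^ n * norm x"
      using pw[of n] C by (intro order_trans[OF norm_mult_ineq] mult_mono) (auto intro!: mult_mono)
    also have "\<bar>c\<bar> * norm (u ^ n) \<le> C * (C ^ n * (1 + n * ((norm x)\<^sup>2 / C)))"
      using c Suc C by (intro mult_mono) auto
    finally have "norm (u ^ Suc n) \<le> C * (C ^ n * (1 + n * ((norm x)\<^sup>2 / C))) + norm x * C ^ n * norm x" by simp
    also have "\<dots> = C ^ Suc n * (1 + Suc n * ((norm x)\<^sup>2 / C))"
      using C by (simp add: field_simps power2_eq_square)
    finally show ?case .
  qed (simp add: norm_one_le)
  have "norm u \<le> C"
  proof (rule le_if_powers_le[OF C(2), of _ M])
    fix n :: nat
    have "star u = u" by (simp add: u_def star_diff star_scaleR star_mult)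
    hence "norm u ^ (2 ^ n) \<le> C ^ (2 ^ n) * (1 + real (2 ^ n) * ((norm x)\<^sup>2 / C))"
      using bound[of "2 ^ n"] by (simp add: norm_power_hermitian)
    also have "1 + real (2 ^ n) * ((norm x)\<^sup>2 / C) \<le> M * 2 ^ n"
      by (simp add: M_def algebra_simps)
    finally show "norm u ^ (2 ^ n) \<le> M * 2 ^ n * C ^ (2 ^ n)" using C by (simp add: mult.commute)
  qed
  thus ?thesis by (simp add: u_def)
qed

section \<open>Positivity of \<open>star b * b\<close>\<close>

text \<open>Up to a factor 2 the sum consists of the squares of the self-adjoint elements
  \<open>p\<close> and \<open>q\<close>, twice the real part and, up to sign, twice the imaginary
  part of \<open>x\<close>.\<close>

lemma lower_bound_star_mult_add_mult_star:
  fixes x :: "'a::unital_cstar_algebra"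
  shows "lower_bound 0 (star x * x + x * star x)"
proof -
  define p q where "p = x + star x" and "q = \<i> *\<^sub>C (x - star x)"
  have "star p = p" "star q = q"
    by (simp_all add: p_def q_def star_add star_scaleC star_diff scaleC_minus_left flip: scaleC_minus_right)
  hence "lower_bound (0 + 0) (p * p + q * q)" by (intro lower_bound_add lower_bound_square)
  hence "lower_bound ((1/2) * (0 + 0)) ((1/2) *\<^sub>R (p * p + q * q))" by (rule lower_bound_scaleR) simp
  moreover have "q * q = - ((x - star x) * (x - star x))"
    by (simp add: q_def mult_scaleC_left mult_scaleC_right scaleC_scaleC)
  hence "p * p + q * q = 2 *\<^sub>R (star x * x + x * star x)"
    by (simp add: p_def algebra_simps scaleR_2)
  ultimately show ?thesis by simp
qed

text \<open>For \<open>x = b (b\<^sup>* b + m)\<^bsup>-1/2\<^esup>\<close> one has \<open>x\<^sup>* x \<le> 1\<close>, hence \<open>x x\<^sup>* \<le> 1\<close>. As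
  \<open>x\<^sup>* x + x x\<^sup>* \<ge> 0\<close>, this gives \<open>x\<^sup>* x \<ge> -1\<close>, that is, \<open>2 b\<^sup>* b + m \<ge> 0\<close>.\<close>

lemma lower_bound_star_mult_step:
  fixes b :: "'a::unital_cstar_algebra"
  assumes lb: "lower_bound l (star b * b)" and l: "0 < l"
  shows "lower_bound (3/4 * l) (star b * b)"
proof -
  define h where "h = star b * b"
  \<comment> \<open>The constants leave slack: the final bound is \<open>(5/9) * m\<close>, that is
    \<open>(25/36) * l\<close>, and \<open>25/36\<close> is below \<open>3/4\<close>.\<close>
  define m where "m = (5/4) * l"
  have "lower_bound l h" "l < m" using lb l by (simp_all add: h_def m_def)
  from lower_bound_sqrt[OF this] obtain r g where
    rg: "star r = r" "star g = g" "r * g = 1" "g * r = 1" and rr: "r * r = h + m *\<^sub>R 1"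
    and comm: "\<And>y. y * h = h * y \<Longrightarrow> y * r = r * y" by metis
  define x where "x = b * g"
  have xx: "star x * x = 1 - m *\<^sub>R (g * g)"
  proof -
    have "star x * x = g * h * g" by (simp add: x_def h_def star_mult rg mult.assoc)
    also have "h = r * r - m *\<^sub>R 1" by (simp add: rr)
    also have "g * (r * r - m *\<^sub>R 1) * g = (g * r) * (r * g) - m *\<^sub>R (g * g)"
      by (simp add: algebra_simps)
    finally show ?thesis by (simp add: rg)
  qed
  have rxxr: "r * (1 + star x * x) * r = 2 *\<^sub>R h + m *\<^sub>R 1"
  proof -
    have "r * (1 + star x * x) * r = r * r + r * r - m *\<^sub>R ((r * g) * (g * r))"
      by (simp add: xx algebra_simps)
    thus ?thesis by (simp add: rr rg algebra_simps scaleR_2)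
  qed
  have "lower_bound 0 ((sqrt m *\<^sub>R g) * (sqrt m *\<^sub>R g))"
    by (rule lower_bound_square) (simp add: star_scaleR rg)
  hence "lower_bound 0 (m *\<^sub>R (g * g))" using l by (simp add: m_def)
  then obtain c\<^sub>0 where c0: "\<And>c. c \<ge> c\<^sub>0 \<Longrightarrow> norm (c *\<^sub>R 1 - m *\<^sub>R (g * g)) \<le> c"
    by (auto simp: lower_bound_def)
  define c where "c = max c\<^sub>0 1"
  \<comment> \<open>By \<open>xx\<close> the bound for \<open>m *\<^sub>R (g * g)\<close> around
    \<open>c\<close> is a bound for \<open>star x * x\<close> around \<open>1 - c\<close>. Since
    \<open>c \<ge> 1\<close>, the modulus of \<open>1 - c\<close> is at most \<open>c\<close>, as
    the interchange of \<open>star x * x\<close> and \<open>x * star x\<close> demands.\<close>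
  have "norm ((1 - c) *\<^sub>R 1 - star x * x) = norm (c *\<^sub>R 1 - m *\<^sub>R (g * g))"
    by (subst norm_minus_commute) (simp add: xx algebra_simps)
  also have "\<dots> \<le> c" by (rule c0) (simp add: c_def)
  finally have "norm ((1 - c) *\<^sub>R 1 - star (star x) * star x) \<le> c"
    by (intro norm_diff_star_mult_le) (auto simp: c_def)
  hence "lower_bound 0 (1 - x * star x)"
    by (intro lower_boundI[of _ c], simp add: star_diff star_mult)
      (subst norm_minus_commute, simp add: algebra_simps)
  hence "lower_bound (0 + 0) ((1 - x * star x) + (star x * x + x * star x))"
    by (intro lower_bound_add lower_bound_star_mult_add_mult_star)
  hence "lower_bound 0 (1 + star x * x)" by simp
  \<comment> \<open>The bound just found is 0, and \<open>lower_bound_sqrt\<close> needs a shift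
    strictly above it; \<open>1/4\<close> is that shift.\<close>
  moreover have "(0::real) < 1/4" by simp
  ultimately obtain k where k: "star k = k" "k * k = (1 + star x * x) + (1/4) *\<^sub>R 1"
    and kcomm: "\<And>y. y * (1 + star x * x) = (1 + star x * x) * y \<Longrightarrow> y * k = k * y"
    by (rule lower_bound_sqrt) metis
  have gr: "r * (g * g) = (g * g) * r"
  proof -
    have "r * (g * g) = (r * g) * g" by (simp only: mult.assoc)
    also have "\<dots> = g * (g * r)" by (simp add: rg)
    finally show ?thesis by (simp only: mult.assoc)
  qed
  \<comment> \<open>Commutation turns the conjugate \<open>r * (k * k) * r\<close> into the square
    of the self-adjoint element \<open>r * k\<close>, so that \<open>lower_bound_square\<close>
    applies to it.\<close>
  have "r * k = k * r"
    by (rule kcomm) (simp add: xx gr left_diff_distrib right_diff_distrib distrib_left distrib_right)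
  hence "lower_bound 0 ((r * k) * (r * k))"
    by (intro lower_bound_square) (simp add: star_mult rg k)
  also have "(r * k) * (r * k) = (r * k) * (k * r)" by (simp only: \<open>r * k = k * r\<close>)
  also have "\<dots> = r * (k * k) * r" by (simp only: mult.assoc)
  also have "\<dots> = r * (1 + star x * x) * r + (1/4) *\<^sub>R (r * r)"
    by (simp only: k distrib_left distrib_right) simp
  also have "\<dots> = (9/4) *\<^sub>R h + ((5/4) * m) *\<^sub>R 1"
  proof -
    have "(9/4) *\<^sub>R h = 2 *\<^sub>R h + (1/4) *\<^sub>R h" "((5/4) * m) *\<^sub>R 1 = m *\<^sub>R 1 + (m/4) *\<^sub>R (1::'a)"
      by (simp_all flip: scaleR_add_left)
    thus ?thesis by (simp only: rxxr rr) (simp add: scaleR_add_right)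
  qed
  finally have "lower_bound (0 - (-(5/4) * m)) ((9/4) *\<^sub>R h + ((5/4) * m) *\<^sub>R 1 + (-(5/4) * m) *\<^sub>R 1)"
    by (rule lower_bound_add_scaleR_one)
  hence "lower_bound ((5/4) * m) ((9/4) *\<^sub>R h)" by simp
  hence "lower_bound ((4/9) * ((5/4) * m)) ((4/9) *\<^sub>R ((9/4) *\<^sub>R h))" by (rule lower_bound_scaleR) simp
  hence "lower_bound ((5/9) * m) h" by simp
  thus ?thesis using l by (auto simp: h_def m_def elim!: lower_bound_mono)
qed

text \<open>The improvement by \<open>3/4\<close> is iterated from the trivial bound by the norm.
  The 1 added in \<open>N\<close> keeps all bounds positive, which the step requires.\<close>

lemma lower_bound_star_mult:
  fixes b :: "'a::unital_cstar_algebra"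
  assumes "0 < l" shows "lower_bound l (star b * b)"
proof -
  define N where "N = norm (star b * b) + 1"
  have N: "N > 0" by (simp add: N_def add_nonneg_pos)
  have "lower_bound ((3/4) ^ n * N) (star b * b)" for n
  proof (induction n)
    case 0
    show ?case by (rule lower_bound_mono[OF lower_bound_norm]) (auto simp: N_def star_mult)
  next
    case (Suc n)
    thus ?case using lower_bound_star_mult_step[OF Suc] N by (simp add: mult.assoc)
  qed
  moreover obtain n where "(3/4) ^ n < l / N"
    using real_arch_pow_inv[of "l / N" "3/4"] assms N by auto
  hence "(3/4) ^ n * N \<le> l" using N by (simp add: field_simps)
  ultimately show ?thesis using lower_bound_mono by blast
qed

text \<open>Let \<open>s = norm (h + q)\<close>. As \<open>h \<le> h + q \<le> s\<close>, up to
  \<open>l\<close> both \<open>h\<close> and \<open>s - h\<close> have roots \<open>t\<close> and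
  \<open>r\<close>. These commute and their squares sum to \<open>s + 2 * l\<close>, so
  \<open>norm_le_of_sum_squares\<close> bounds \<open>t\<close>.\<close>

lemma norm_le_norm_add_unital:
  fixes h q :: "'a::unital_cstar_algebra"
  assumes h: "\<And>l. l > 0 \<Longrightarrow> lower_bound l h" and q: "\<And>l. l > 0 \<Longrightarrow> lower_bound l q"
  shows "norm h \<le> norm (h + q)"
proof (rule field_le_epsilon)
  fix e :: real assume "e > 0"
  \<comment> \<open>Two thirds of \<open>e\<close> pay for \<open>s + 2 * l\<close>, the last third
    for undoing the shift in \<open>h = t * t - l\<close>.\<close>
  define l where "l = e / 3"
  have l: "l > 0" "l / 2 < l" "l / 2 > 0" using \<open>e > 0\<close> by (auto simp: l_def)
  define s where "s = norm (h + q)"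
  have sa: "star (h + q) = h + q" using h[of 1] q[of 1] by (simp add: lower_bound_def star_add)
  have "lower_bound 0 (s *\<^sub>R 1 - (h + q))"
    by (rule lower_boundI[of _ s]) (simp_all add: star_diff star_scaleR sa, simp add: s_def add.commute)
  hence "lower_bound (0 + l / 2) (s *\<^sub>R 1 - (h + q) + q)" by (intro lower_bound_add q l)
  hence "lower_bound (l / 2) (s *\<^sub>R 1 - h)" by (simp add: algebra_simps)
  from lower_bound_sqrt[OF this \<open>l / 2 < l\<close>] obtain r where r: "star r = r" "r * r = s *\<^sub>R 1 - h + l *\<^sub>R 1"
    "\<And>y. y * (s *\<^sub>R 1 - h) = (s *\<^sub>R 1 - h) * y \<Longrightarrow> y * r = r * y" by metis
  from lower_bound_sqrt[OF h[OF \<open>l / 2 > 0\<close>] \<open>l / 2 < l\<close>] obtain t where t: "star t = t" "t * t = h + l *\<^sub>R 1"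
    "\<And>y. y * h = h * y \<Longrightarrow> y * t = t * y" by metis
  have "h * t = t * h" by (rule t(3)) simp
  have "t * r = r * t"
    by (rule r(3)) (simp add: \<open>h * t = t * h\<close> left_diff_distrib right_diff_distrib)
  moreover have "t * t + r * r = (s + 2 * l) *\<^sub>R 1" by (simp add: r(2) t(2) algebra_simps flip: scaleR_2)
  ultimately have "(norm t)\<^sup>2 \<le> s + 2 * l"
    using norm_le_of_sum_squares[of t r "s + 2 * l"] l by (simp add: r(1) t(1) s_def)
  hence "norm (t * t) \<le> s + 2 * l" using cstar_identity[of t] t(1) by simp
  moreover have "h = t * t - l *\<^sub>R 1" by (simp add: t(2))
  hence "norm h \<le> norm (t * t) + norm (l *\<^sub>R (1::'a))" by (simp only: norm_triangle_ineq4)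
  hence "norm h \<le> norm (t * t) + l" using norm_scaleR_one_le[of l, where 'a='a] l by linarith
  ultimately show "norm h \<le> norm (h + q) + e" by (simp add: s_def l_def)
qed


section \<open>Multiplier algebras and contractivity\<close>

instance cstar_algebra \<subseteq> banach ..

lemma bounded_linear_scaleC: "bounded_linear (\<lambda>x::'a::cstar_algebra. c *\<^sub>C x)"
  by (rule bounded_linear_intro[of _ "cmod c"])
    (auto simp: scaleC_add_right scaleR_scaleC scaleC_scaleC norm_scaleC mult.commute)

lift_definition scaleC_blinfun :: "complex \<Rightarrow> ('a::cstar_algebra \<Rightarrow>\<^sub>L 'a) \<Rightarrow> 'a \<Rightarrow>\<^sub>L 'a"
  is "\<lambda>c T x. c *\<^sub>C T x"
  by (rule bounded_linear_compose[OF bounded_linear_scaleC])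

text \<open>Double centralizers of a \<open>C\<^sup>*\<close>-algebra: operators adjointable with respect to
  \<open>\<langle>y, z\<rangle> = y\<^sup>* z\<close>, stored together with their adjoints. They supply a unit without a
  case distinction on whether the algebra is already unital.\<close>

typedef (overloaded) 'a multiplier =
  "{(T, S). \<forall>y z. star y * blinfun_apply T z = star (blinfun_apply S y) * z}
    :: (('a::cstar_algebra \<Rightarrow>\<^sub>L 'a) \<times> ('a \<Rightarrow>\<^sub>L 'a)) set"
  by (rule exI[of _ "(0, 0)"]) simp

setup_lifting type_definition_multiplier

lift_definition mop :: "'a::cstar_algebra multiplier \<Rightarrow> 'a \<Rightarrow>\<^sub>L 'a"
  is "fst :: (_ \<times> _) \<Rightarrow> ('a \<Rightarrow>\<^sub>L 'a)" .
lift_definition madj :: "'a::cstar_algebra multiplier \<Rightarrow> 'a \<Rightarrow>\<^sub>L 'a"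
  is "snd :: (_ \<times> _) \<Rightarrow> ('a \<Rightarrow>\<^sub>L 'a)" .

lemma mop_madj: "star y * mop T z = star (madj T y) * z"
  by transfer auto

lemma madj_mop: "star y * madj T z = star (mop T y) * z"
  using arg_cong[OF mop_madj[of z T y], of star] by (simp add: star_mult)

text \<open>The defining relation determines the adjoint from the operator, by
  nondegeneracy.\<close>

lemma multiplier_eqI:
  assumes "\<And>z. mop T z = mop S z" shows "T = S"
proof -
  have "x * madj T y = x * madj S y" for x y
  proof -
    have "star (madj T y) * star x = star (madj S y) * star x" by (simp flip: mop_madj add: assms)
    hence "star (star (madj T y) * star x) = star (star (madj S y) * star x)" by (rule arg_cong)
    thus ?thesis by (simp add: star_mult)
  qed
  hence "madj T y = madj S y" for y by (rule left_mult_cancel)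
  thus ?thesis using assms
    by (transfer fixing:) (auto intro!: blinfun_eqI)
qed

text \<open>Bounded linear functions are only real linear here; complex homogeneity is extracted
  from the existence of an adjoint.\<close>

lemma mop_scaleC: "mop T (c *\<^sub>C z) = c *\<^sub>C mop T z"
proof (rule left_mult_cancel)
  show "y * mop T (c *\<^sub>C z) = y * c *\<^sub>C mop T z" for y
    using mop_madj[of "star y" T "c *\<^sub>C z"] mop_madj[of "star y" T z] by (simp add: mult_scaleC_right)
qed

text \<open>Needed twice: for Cauchy sequences, whose adjoints must converge too, and for the upper
  half of the C*-identity.\<close>

lemma norm_madj_le: "norm (madj T) \<le> norm (mop T)"
proof (rule norm_blinfun_bound)
  fix y
  show "norm (madj T y) \<le> norm (mop T) * norm y"
  proof (cases "madj T y = 0")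
    case False
    have "(norm (madj T y))\<^sup>2 = norm (star y * mop T (madj T y))"
      by (simp add: mop_madj cstar_identity)
    also have "\<dots> \<le> norm y * (norm (mop T) * norm (madj T y))"
      by (intro order_trans[OF norm_mult_ineq] mult_mono norm_blinfun) auto
    finally show ?thesis using False by (simp add: power2_eq_square algebra_simps)
  qed simp
qed simp

text \<open>The lower half of the C*-identity for multipliers, obtained pointwise from the one in
  the algebra.\<close>

lemma norm_mop_square_le: "(norm (mop T))\<^sup>2 \<le> norm (madj T o\<^sub>L mop T)"
proof -
  have "norm (mop T) \<le> sqrt (norm (madj T o\<^sub>L mop T))"
  proof (rule norm_blinfun_bound)
    fix z
    have "(norm (mop T z))\<^sup>2 = norm (star z * (madj T o\<^sub>L mop T) z)"
      by (simp add: madj_mop cstar_identity)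
    also have "\<dots> \<le> norm z * (norm (madj T o\<^sub>L mop T) * norm z)"
      by (intro order_trans[OF norm_mult_ineq] mult_mono norm_blinfun) auto
    finally have "(norm (mop T z))\<^sup>2 \<le> norm (madj T o\<^sub>L mop T) * (norm z)\<^sup>2"
      by (simp add: power2_eq_square algebra_simps)
    hence "norm (mop T z) \<le> sqrt (norm (madj T o\<^sub>L mop T) * (norm z)\<^sup>2)" by (rule real_le_rsqrt)
    thus "norm (mop T z) \<le> sqrt (norm (madj T o\<^sub>L mop T)) * norm z" by (simp add: real_sqrt_mult)
  qed simp
  thus ?thesis by (metis norm_ge_zero power_mono real_sqrt_pow2)
qed

instantiation multiplier :: (cstar_algebra) "{real_normed_algebra, monoid_mult}"
begin

lift_definition zero_multiplier :: "'a multiplier" is "(0, 0)" by simp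
lift_definition one_multiplier :: "'a multiplier" is "(id_blinfun, id_blinfun)" by simp
lift_definition plus_multiplier :: "'a multiplier \<Rightarrow> 'a multiplier \<Rightarrow> 'a multiplier"
  is "\<lambda>(T, T') (S, S'). (T + S, T' + S')"
  by (auto simp: blinfun.bilinear_simps distrib_left distrib_right star_add)
lift_definition uminus_multiplier :: "'a multiplier \<Rightarrow> 'a multiplier" is "\<lambda>(T, T'). (- T, - T')"
  by (auto simp: blinfun.bilinear_simps)
lift_definition minus_multiplier :: "'a multiplier \<Rightarrow> 'a multiplier \<Rightarrow> 'a multiplier"
  is "\<lambda>(T, T') (S, S'). (T - S, T' - S')"
  by (auto simp: blinfun.bilinear_simps left_diff_distrib right_diff_distrib star_diff)
lift_definition times_multiplier :: "'a multiplier \<Rightarrow> 'a multiplier \<Rightarrow> 'a multiplier"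
  is "\<lambda>(T, T') (S, S'). (T o\<^sub>L S, S' o\<^sub>L T')" by auto
lift_definition scaleR_multiplier :: "real \<Rightarrow> 'a multiplier \<Rightarrow> 'a multiplier"
  is "\<lambda>c (T, T'). (c *\<^sub>R T, c *\<^sub>R T')" by (auto simp: blinfun.bilinear_simps star_scaleR)
definition norm_multiplier :: "'a multiplier \<Rightarrow> real" where "norm_multiplier T = norm (mop T)"
definition dist_multiplier :: "'a multiplier \<Rightarrow> 'a multiplier \<Rightarrow> real" where "dist_multiplier T S = norm (T - S)"
definition sgn_multiplier :: "'a multiplier \<Rightarrow> 'a multiplier" where "sgn_multiplier T = inverse (norm T) *\<^sub>R T"
definition uniformity_multiplier :: "('a multiplier \<times> 'a multiplier) filter" where
  "uniformity_multiplier = (INF e\<in>{0<..}. principal {(x, y). dist x y < e})"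
definition open_multiplier :: "'a multiplier set \<Rightarrow> bool" where
  "open_multiplier U \<longleftrightarrow> (\<forall>x\<in>U. \<forall>\<^sub>F (x', y) in uniformity. x' = x \<longrightarrow> y \<in> U)"

lemma mop_simps [simp]:
  "mop 0 = 0" "mop 1 = id_blinfun" "mop (T + S) = mop T + mop S" "mop (- T) = - mop T"
  "mop (T - S) = mop T - mop S" "mop (T * S) = mop T o\<^sub>L mop S" "mop (r *\<^sub>R T) = r *\<^sub>R mop T"
  by (transfer; auto)+

lemma madj_simps [simp]:
  "madj (T * S) = madj S o\<^sub>L madj T" "madj (T - S) = madj T - madj S"
  by (transfer; auto)+

instance
proof
  fix T S R :: "'a multiplier" and a b :: real
  show "T + S + R = T + (S + R)" "T + S = S + T" "0 + T = T" "- T + T = 0" "T - S = T + - S"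
    "a *\<^sub>R (T + S) = a *\<^sub>R T + a *\<^sub>R S" "(a + b) *\<^sub>R T = a *\<^sub>R T + b *\<^sub>R T"
    "a *\<^sub>R b *\<^sub>R T = (a * b) *\<^sub>R T" "1 *\<^sub>R T = T"
    "T * S * R = T * (S * R)" "(T + S) * R = T * R + S * R" "T * (S + R) = T * S + T * R"
    "a *\<^sub>R T * S = a *\<^sub>R (T * S)" "T * a *\<^sub>R S = a *\<^sub>R (T * S)" "1 * T = T" "T * 1 = T"
    by (rule multiplier_eqI; simp add: blinfun.bilinear_simps algebra_simps)+
  show "dist T S = norm (T - S)" "sgn T = inverse (norm T) *\<^sub>R T"
    by (simp_all add: dist_multiplier_def sgn_multiplier_def)
  show "(uniformity :: ('a multiplier \<times> 'a multiplier) filter) = (INF e\<in>{0<..}. principal {(x, y). dist x y < e})"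
    by (rule uniformity_multiplier_def)
  show "open U \<longleftrightarrow> (\<forall>x\<in>U. \<forall>\<^sub>F (x', y) in uniformity. x' = x \<longrightarrow> y \<in> U)" for U :: "'a multiplier set"
    by (rule open_multiplier_def)
  show "norm T = 0 \<longleftrightarrow> T = 0" by (auto simp: norm_multiplier_def intro: multiplier_eqI)
  show "norm (T + S) \<le> norm T + norm S" by (simp add: norm_multiplier_def norm_triangle_ineq)
  show "norm (a *\<^sub>R T) = \<bar>a\<bar> * norm T" by (simp add: norm_multiplier_def)
  show "norm (T * S) \<le> norm T * norm S" by (simp add: norm_multiplier_def norm_blinfun_compose)
qed

end

text \<open>Operators and adjoints converge separately in operator norm, and the defining relation
  passes to pointwise limits.\<close>

instance multiplier :: (cstar_algebra) complete_space
proof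
  fix X :: "nat \<Rightarrow> 'a multiplier" assume X: "Cauchy X"
  have d: "dist (mop T) (mop S) = dist T S" for T S :: "'a multiplier"
    by (simp add: dist_norm dist_multiplier_def norm_multiplier_def)
  have d': "dist (madj T) (madj S) \<le> dist T S" for T S :: "'a multiplier"
    using norm_madj_le[of "T - S"] by (simp add: dist_norm dist_multiplier_def norm_multiplier_def)
  have "Cauchy (\<lambda>n. mop (X n))" using X by (simp add: Cauchy_def d)
  moreover have "Cauchy (\<lambda>n. madj (X n))"
    using X unfolding Cauchy_def by (meson d' le_less_trans)
  ultimately obtain T S where lim: "(\<lambda>n. mop (X n)) \<longlonglongrightarrow> T" "(\<lambda>n. madj (X n)) \<longlonglongrightarrow> S"
    by (meson Cauchy_convergent convergent_def)
  have "star y * T z = star (S y) * z" for y z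
  proof (rule LIMSEQ_unique)
    show "(\<lambda>n. star y * mop (X n) z) \<longlonglongrightarrow> star y * T z" by (intro tendsto_intros lim)
    show "(\<lambda>n. star y * mop (X n) z) \<longlonglongrightarrow> star (S y) * z"
      unfolding mop_madj by (intro tendsto_intros continuous_star lim)
  qed
  hence "mop (Abs_multiplier (T, S)) = T" by (simp add: mop.abs_eq eq_onp_def)
  hence "dist (X n) (Abs_multiplier (T, S)) = dist (mop (X n)) T" for n
    using d[of "X n" "Abs_multiplier (T, S)"] by (simp only:)
  hence "X \<longlonglongrightarrow> Abs_multiplier (T, S)"
    using lim(1) unfolding tendsto_iff by (simp only:)
  thus "convergent X" unfolding convergent_def by blast
qed

instantiation multiplier :: (cstar_algebra) unital_cstar_algebra
begin

lift_definition scaleC_multiplier :: "complex \<Rightarrow> 'a multiplier \<Rightarrow> 'a multiplier"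
  is "\<lambda>c (T, T'). (scaleC_blinfun c T, scaleC_blinfun (cnj c) T')"
  by (auto simp: scaleC_blinfun.rep_eq mult_scaleC_right mult_scaleC_left star_scaleC)
lift_definition star_multiplier :: "'a multiplier \<Rightarrow> 'a multiplier" is "\<lambda>(T, T'). (T', T)"
  by auto (metis star_mult star_star)

lemma mop_scaleC_star [simp]: "mop (c *\<^sub>C T) = scaleC_blinfun c (mop T)" "mop (star T) = madj T"
  by (transfer; auto)+

instance
proof
  fix T S :: "'a multiplier" and a :: real and c d :: complex
  note bs = blinfun.bilinear_simps scaleC_blinfun.rep_eq
  show "c *\<^sub>C (T + S) = c *\<^sub>C T + c *\<^sub>C S" "(c + d) *\<^sub>C T = c *\<^sub>C T + d *\<^sub>C T"
    "c *\<^sub>C d *\<^sub>C T = (c * d) *\<^sub>C T" "a *\<^sub>R T = complex_of_real a *\<^sub>C T"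
    "c *\<^sub>C T * S = c *\<^sub>C (T * S)" "T * c *\<^sub>C S = c *\<^sub>C (T * S)"
    by (rule multiplier_eqI; simp add: bs scaleC_add_right scaleC_add_left scaleC_scaleC scaleR_scaleC mop_scaleC)+
  show "star (T + S) = star T + star S" "star (c *\<^sub>C T) = cnj c *\<^sub>C star T"
    "star (T * S) = star S * star T" "star (star T) = T"
    by (transfer; auto)+
  \<comment> \<open>The inequality for all scalars gives equality when it is used for
    \<open>c\<close> and for \<open>1 / c\<close>.\<close>
  have *: "norm (c *\<^sub>C T) \<le> cmod c * norm T" for c :: complex and T :: "'a multiplier"
    unfolding norm_multiplier_def
    by (rule norm_blinfun_bound)
      (auto simp: bs norm_scaleC mult.assoc intro!: mult_left_mono norm_blinfun)
  show "norm (c *\<^sub>C T) = cmod c * norm T"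
  proof (cases "c = 0")
    case True
    thus ?thesis using *[of c T] by (simp add: norm_multiplier_def)
  next
    case False
    have "T = (1 / c) *\<^sub>C c *\<^sub>C T" using False by (intro multiplier_eqI) (simp add: bs scaleC_scaleC)
    hence "norm T \<le> cmod (1 / c) * norm (c *\<^sub>C T)" using * by metis
    thus ?thesis using *[of c T] False by (simp add: norm_divide field_simps)
  qed
  have "norm (star T * T) \<le> norm (mop T) * norm (mop T)"
    unfolding norm_multiplier_def mop_simps mop_scaleC_star
    by (intro order_trans[OF norm_blinfun_compose] mult_right_mono norm_madj_le norm_ge_zero)
  thus "norm (star T * T) = (norm T)\<^sup>2"
    using norm_mop_square_le[of T] by (simp add: norm_multiplier_def power2_eq_square)
qed

end

lift_definition left_multiplier :: "'a::cstar_algebra \<Rightarrow> 'a multiplier"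
  is "\<lambda>a. (blinfun_mult_right a, blinfun_mult_right (star a))"
  by (auto simp: star_mult mult.assoc)

lemma mop_left_multiplier [simp]: "mop (left_multiplier a) z = a * z"
  by transfer auto

lemma left_multiplier_add: "left_multiplier (a + b) = left_multiplier a + left_multiplier b"
  by (rule multiplier_eqI) (simp add: blinfun.bilinear_simps distrib_right)

lemma left_multiplier_mult: "left_multiplier (a * b) = left_multiplier a * left_multiplier b"
  by (rule multiplier_eqI) (simp add: mult.assoc)

lemma left_multiplier_star: "left_multiplier (star a) = star (left_multiplier a)"
  by transfer auto

text \<open>The norm is attained on \<open>star a\<close>. Being isometric, the embedding carries
  norm inequalities of unital algebras back to arbitrary ones.\<close>

lemma norm_left_multiplier [simp]: "norm (left_multiplier a) = norm a"
proof (rule antisym)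
  show "norm (left_multiplier a) \<le> norm a"
    unfolding norm_multiplier_def by (rule norm_blinfun_bound) (auto simp: norm_mult_ineq)
  have "norm a * norm a \<le> norm (mop (left_multiplier a)) * norm a"
    using norm_blinfun[of "mop (left_multiplier a)" "star a"] norm_mult_star[of a]
    by (simp add: power2_eq_square)
  thus "norm a \<le> norm (left_multiplier a)" unfolding norm_multiplier_def by (cases "norm a = 0") auto
qed

section \<open>Norm inequalities without a unit and contractivity of homomorphisms\<close>

text \<open>Tailored to Cauchy-Schwarz, where exactly two squares are left over besides
  \<open>star a * a\<close>.\<close>

lemma norm_le_norm_add_squares:
  fixes a b d :: "'a::cstar_algebra"
  shows "norm (star a * a) \<le> norm (star a * a + (star b * b + star d * d))"
proof -
  have lb: "lower_bound l (left_multiplier (star b * b))" if "l > 0" for l and b :: 'a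
    using that by (simp add: left_multiplier_mult left_multiplier_star lower_bound_star_mult)
  have "norm (left_multiplier (star a * a)) \<le>
      norm (left_multiplier (star a * a) + left_multiplier (star b * b + star d * d))"
  proof (rule norm_le_norm_add_unital[OF lb])
    fix l :: real assume "l > 0"
    hence "lower_bound (l/2 + l/2) (left_multiplier (star b * b) + left_multiplier (star d * d))"
      by (intro lower_bound_add lb) auto
    thus "lower_bound l (left_multiplier (star b * b + star d * d))" by (simp add: left_multiplier_add)
  qed
  thus ?thesis by (simp flip: left_multiplier_add)
qed

text \<open>Here \<open>f\<close> plays the role of \<open>1 - (1 - c\<^sup>2)\<^bsup>1/2\<^esup>\<close>. The hypotheses involve no unit and are preserved by
  homomorphisms.\<close>

lemma norm_le_one_of_sum_squares:
  fixes c f :: "'a::cstar_algebra"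
  assumes "star c = c" "star f = f" "c * f = f * c" "f + f = c * c + f * f"
  shows "norm c \<le> 1"
proof -
  let ?c = "left_multiplier c" and ?f = "left_multiplier f"
  have f: "?f + ?f = ?c * ?c + ?f * ?f"
    using assms(4) by (simp flip: left_multiplier_mult left_multiplier_add)
  have "(norm ?c)\<^sup>2 \<le> 1"
  proof (rule norm_le_of_sum_squares)
    show "?c * (1 - ?f) = (1 - ?f) * ?c"
      using assms(3) by (simp add: left_diff_distrib right_diff_distrib flip: left_multiplier_mult)
    show "?c * ?c + (1 - ?f) * (1 - ?f) = 1 *\<^sub>R 1"
      using f by (simp add: algebra_simps)
  qed (use assms in \<open>simp_all add: star_diff flip: left_multiplier_star\<close>)
  thus ?thesis by (simp add: power_le_one_iff)
qed

lemma (in star_homomorphism) contractive: "norm (f a) \<le> norm a"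
proof -
  interpret linear f by unfold_locales (auto simp: hom_add scaleR_scaleC hom_scaleC)
  \<comment> \<open>With \<open>1 - e\<close> a root of \<open>1 - b * b\<close>, the element
    \<open>b\<close> commutes with \<open>e\<close>. All relations between the two are algebraic and
    free of the unit, hence they are inherited by \<open>f b\<close> and \<open>f e\<close>.\<close>
  have *: "norm (f b) \<le> 1" if b: "star b = b" "norm b < 1" for b
  proof -
    have "norm (b * b) < 1"
      using norm_mult_ineq[of b b] mult_strict_mono[of "norm b" 1 "norm b" 1] b by auto
    moreover have "star (b * b) = b * b" using b by (simp add: star_mult)
    ultimately obtain e where e: "star e = e" "e + e = b * b + e * e" "\<And>y. y * (b * b) = b * b * y \<Longrightarrow> y * e = e * y"
      using one_minus_sqrt_exists by metis
    have "b * e = e * b" by (rule e(3)) (simp add: mult.assoc)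
    show ?thesis
    proof (rule norm_le_one_of_sum_squares)
      show "star (f b) = f b" "star (f e) = f e" using b e(1) by (simp_all flip: hom_star)
      show "f b * f e = f e * f b" using \<open>b * e = e * b\<close> by (simp flip: hom_mult)
      show "f e + f e = f b * f b + f e * f e" using e(2) by (simp flip: hom_mult hom_add)
    qed
  qed
  have **: "norm (f b) \<le> norm b" if b: "star b = b" for b
  proof (rule dense_ge)
    fix t assume t: "norm b < t"
    hence "t > 0" using norm_ge_zero[of b] by linarith
    have "norm (f ((1 / t) *\<^sub>R b)) \<le> 1"
      by (rule *) (use t \<open>t > 0\<close> b in \<open>auto simp: star_scaleR\<close>)
    thus "norm (f b) \<le> t" using \<open>t > 0\<close> by (simp add: scale)
  qed
  have "(norm (f a))\<^sup>2 = norm (f (star a * a))" by (simp add: hom_mult hom_star cstar_identity)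
  also have "\<dots> \<le> (norm a)\<^sup>2" using **[of "star a * a"] by (simp add: star_mult cstar_identity)
  finally show ?thesis by (simp add: power2_le_iff_abs_le)
qed


section \<open>Hilbert modules and finite rank operators\<close>

context hilbert_module
begin

section \<open>Cauchy-Schwarz and the norm of a Hilbert module\<close>

lemma closed_simps [simp]:
  "x \<in> carrier Y \<Longrightarrow> y \<in> carrier Y \<Longrightarrow> x \<oplus> y \<in> carrier Y"
  "x \<in> carrier Y \<Longrightarrow> c \<odot> x \<in> carrier Y"
  "x \<in> carrier Y \<Longrightarrow> ract Y x a \<in> carrier Y"
  "\<zero> \<in> carrier Y"
  "x \<in> carrier Y \<Longrightarrow> y \<in> carrier Y \<Longrightarrow> vminus Y x y \<in> carrier Y"
  by (simp_all add: add_closed scale_closed ract_closed zero_closed vminus_def)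

lemma rinner_zero_right: "x \<in> carrier Y \<Longrightarrow> rinner Y x \<zero> = 0"
  using rinner_add[of x \<zero> \<zero>] by (simp add: add_zero)

lemma rinner_vminus_right:
  "\<lbrakk>x \<in> carrier Y; y \<in> carrier Y; z \<in> carrier Y\<rbrakk>
    \<Longrightarrow> rinner Y x (vminus Y y z) = rinner Y x y - rinner Y x z"
  by (simp add: vminus_def rinner_add rinner_scale)

lemma rinner_add_left:
  "\<lbrakk>x \<in> carrier Y; y \<in> carrier Y; z \<in> carrier Y\<rbrakk> \<Longrightarrow> rinner Y (x \<oplus> y) z = rinner Y x z + rinner Y y z"
  using rinner_add[of z x y] by (metis closed_simps(1) rinner_star star_add)

lemma rinner_scale_left:
  "\<lbrakk>x \<in> carrier Y; y \<in> carrier Y\<rbrakk> \<Longrightarrow> rinner Y (c \<odot> x) y = cnj c *\<^sub>C rinner Y x y"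
  using rinner_scale[of y x c] by (metis closed_simps(2) rinner_star star_scaleC)

lemma rinner_ract_left:
  "\<lbrakk>x \<in> carrier Y; y \<in> carrier Y\<rbrakk> \<Longrightarrow> rinner Y (ract Y x a) y = star a * rinner Y x y"
  using rinner_ract[of y x a] by (metis closed_simps(3) rinner_star star_mult)

lemma rinner_vminus_left:
  "\<lbrakk>x \<in> carrier Y; y \<in> carrier Y; z \<in> carrier Y\<rbrakk>
    \<Longrightarrow> rinner Y (vminus Y y z) x = rinner Y y x - rinner Y z x"
  by (simp add: vminus_def rinner_add_left rinner_scale_left)

lemmas rinner_right_simps = rinner_zero_right rinner_add rinner_scale rinner_ract rinner_vminus_right
lemmas rinner_left_simps = rinner_add_left rinner_scale_left rinner_ract_left rinner_vminus_left

text \<open>Reduces identities between vectors to identities in the coefficient algebra.\<close>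

lemma vector_eqI:
  assumes xy: "x \<in> carrier Y" "y \<in> carrier Y"
    and eq: "\<And>w. w \<in> carrier Y \<Longrightarrow> rinner Y w x = rinner Y w y"
  shows "x = y"
proof -
  have "rinner Y (vminus Y x y) (vminus Y x y) = 0"
    using xy eq by (simp add: rinner_vminus_right)
  hence "vminus Y x y = \<zero>" using xy by (intro rinner_definite) auto
  hence "x \<oplus> (-1) \<odot> y \<oplus> y = \<zero> \<oplus> y" by (simp add: vminus_def)
  moreover have "x \<oplus> (-1) \<odot> y \<oplus> y = x \<oplus> (y \<oplus> (-1) \<odot> y)"
    using xy by (simp add: add_assoc add_commute[of "(-1) \<odot> y" y])
  ultimately show ?thesis using xy by (simp add: add_minus add_zero add_commute)
qed

lemma vnorm_nonneg [simp]: "0 \<le> vnorm Y x"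
  by (simp add: vnorm_def)

lemma vnorm_power2: "(vnorm Y x)\<^sup>2 = norm (rinner Y x x)"
  by (simp add: vnorm_def)

text \<open>Put \<open>w = x a - y\<close> with \<open>a = rinner Y x y\<close>. Expanding
  \<open>rinner Y w w\<close> exhibits \<open>rinner Y y y\<close> as the sum of
  \<open>star a * a\<close>, of \<open>rinner Y w w\<close>, and of the defect
  \<open>star a * a - star a * p * a\<close>. The hypothesis provides a root \<open>1 - e\<close> of
  \<open>1 - p\<close>, so the defect is the square of \<open>c = a - e * a\<close>.\<close>

lemma norm_rinner_le_of_vnorm_less_1:
  assumes xy: "x \<in> carrier Y" "y \<in> carrier Y" and x1: "vnorm Y x < 1"
  shows "norm (rinner Y x y) \<le> vnorm Y y"
proof -
  define a where "a = rinner Y x y"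
  define p where "p = rinner Y x x"
  have "norm p < 1" using x1 by (simp add: vnorm_def p_def)
  moreover have "star p = p" using xy by (simp add: p_def rinner_star)
  ultimately obtain e where e: "star e = e" "e + e = p + e * e" using one_minus_sqrt_exists by blast
  define c where "c = a - e * a"
  have cc: "star c * c = star a * a - star a * p * a"
  proof -
    have "star c * c = star a * a - star a * (e + e - e * e) * a"
      by (simp add: c_def star_diff star_mult e(1) algebra_simps)
    thus ?thesis by (simp add: e(2))
  qed
  define w where "w = vminus Y (ract Y x a) y"
  have "w \<in> carrier Y" using xy by (simp add: w_def)
  then obtain b where b: "rinner Y w w = star b * b" using rinner_positive cstar_positive_def by metis
  have "rinner Y y x = star a" using xy by (simp add: a_def rinner_star)
  hence "rinner Y w w = star a * p * a - star a * a - star a * a + rinner Y y y"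
    using xy by (simp add: w_def rinner_right_simps rinner_left_simps a_def[symmetric] p_def[symmetric] algebra_simps)
  hence "rinner Y y y = star a * a + (star c * c + star b * b)" by (simp add: cc b)
  hence "(norm a)\<^sup>2 \<le> (vnorm Y y)\<^sup>2"
    using norm_le_norm_add_squares[of a c b] by (simp add: vnorm_power2 cstar_identity)
  thus ?thesis by (simp add: a_def power2_le_iff_abs_le)
qed

lemma vnorm_scale: "x \<in> carrier Y \<Longrightarrow> vnorm Y (c \<odot> x) = cmod c * vnorm Y x"
  by (simp add: vnorm_def rinner_scale rinner_scale_left scaleC_scaleC norm_scaleC norm_mult real_sqrt_mult)

lemma cauchy_schwarz:
  assumes xy: "x \<in> carrier Y" "y \<in> carrier Y"
  shows "norm (rinner Y x y) \<le> vnorm Y x * vnorm Y y"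
proof -
  have *: "norm (rinner Y x y) \<le> t * vnorm Y y" if t: "vnorm Y x < t" for t
  proof -
    have "t > 0" using t vnorm_nonneg[of x] by linarith
    have "norm (rinner Y (complex_of_real (1 / t) \<odot> x) y) \<le> vnorm Y y"
      using \<open>t > 0\<close> t xy by (intro norm_rinner_le_of_vnorm_less_1) (auto simp: vnorm_scale norm_divide)
    thus ?thesis using \<open>t > 0\<close> xy by (simp add: rinner_scale_left norm_scaleC norm_divide field_simps)
  qed
  show ?thesis
  \<comment> \<open>Letting \<open>t\<close> decrease to \<open>vnorm Y x\<close> happens after
    division by \<open>vnorm Y y\<close>, hence the separate case.\<close>
  proof (cases "vnorm Y y = 0")
    case True
    thus ?thesis using *[of "vnorm Y x + 1"] by simp
  next
    case False
    hence "vnorm Y y > 0" using vnorm_nonneg[of y] by linarith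
    hence "norm (rinner Y x y) / vnorm Y y \<le> t" if "vnorm Y x < t" for t
      using *[OF that] by (simp add: pos_divide_le_eq)
    hence "norm (rinner Y x y) / vnorm Y y \<le> vnorm Y x" by (rule dense_ge)
    thus ?thesis using \<open>vnorm Y y > 0\<close> by (simp add: pos_divide_le_eq)
  qed
qed

lemma vnorm_add:
  assumes xy: "x \<in> carrier Y" "y \<in> carrier Y" shows "vnorm Y (x \<oplus> y) \<le> vnorm Y x + vnorm Y y"
proof -
  have "(vnorm Y (x \<oplus> y))\<^sup>2 = norm (rinner Y x x + rinner Y y x + (rinner Y x y + rinner Y y y))"
    using xy by (simp add: vnorm_power2 rinner_right_simps rinner_left_simps)
  also have "\<dots> \<le> (vnorm Y x * vnorm Y x + vnorm Y y * vnorm Y x) + (vnorm Y x * vnorm Y y + vnorm Y y * vnorm Y y)"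
    using xy by (intro norm_triangle_mono cauchy_schwarz)
  also have "\<dots> = (vnorm Y x + vnorm Y y)\<^sup>2" by (simp add: power2_eq_square algebra_simps)
  finally show ?thesis by (rule power2_le_imp_le) simp
qed

lemma vnorm_vminus_le:
  assumes "x \<in> carrier Y" "y \<in> carrier Y" "z \<in> carrier Y"
  shows "vnorm Y (vminus Y x z) \<le> vnorm Y (vminus Y x y) + vnorm Y (vminus Y y z)"
proof -
  have "vminus Y x z = vminus Y x y \<oplus> vminus Y y z"
    by (rule vector_eqI) (use assms in \<open>simp_all add: rinner_right_simps\<close>)
  thus ?thesis using assms by (simp add: vnorm_add)
qed

lemma vnorm_le_vminus_add:
  assumes "x \<in> carrier Y" "y \<in> carrier Y"
  shows "vnorm Y x \<le> vnorm Y (vminus Y x y) + vnorm Y y"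
proof -
  have "x = vminus Y x y \<oplus> y"
    by (rule vector_eqI) (use assms in \<open>simp_all add: rinner_right_simps\<close>)
  thus ?thesis using assms by (metis closed_simps(5) vnorm_add)
qed

lemma vnorm_vminus_commute:
  assumes "x \<in> carrier Y" "y \<in> carrier Y"
  shows "vnorm Y (vminus Y x y) = vnorm Y (vminus Y y x)"
proof -
  have "vminus Y x y = (-1) \<odot> vminus Y y x"
    by (rule vector_eqI) (use assms in \<open>simp_all add: rinner_right_simps\<close>)
  thus ?thesis using assms by (simp add: vnorm_scale)
qed

lemma vnorm_ract: "x \<in> carrier Y \<Longrightarrow> vnorm Y (ract Y x a) \<le> vnorm Y x * norm a"
proof (rule power2_le_imp_le)
  assume x: "x \<in> carrier Y"
  have "(vnorm Y (ract Y x a))\<^sup>2 = norm (star a * rinner Y x x * a)"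
    using x by (simp add: vnorm_power2 rinner_ract rinner_ract_left mult.assoc)
  also have "\<dots> \<le> norm a * norm (rinner Y x x) * norm a"
    by (rule order_trans[OF norm_mult_ineq mult_right_mono[OF order_trans[OF norm_mult_ineq]]]) auto
  finally show "(vnorm Y (ract Y x a))\<^sup>2 \<le> (vnorm Y x * norm a)\<^sup>2"
    by (simp add: power_mult_distrib vnorm_power2) (simp add: power2_eq_square algebra_simps)
qed simp

lemma vnorm_zero [simp]: "vnorm Y \<zero> = 0"
  by (simp add: vnorm_def rinner_zero_right)

lemma vnorm_eq_0: "x \<in> carrier Y \<Longrightarrow> vnorm Y x = 0 \<Longrightarrow> x = \<zero>"
  by (intro rinner_definite) (simp_all add: vnorm_def)

end

section \<open>Adjointable operators and presentations of finite rank operators\<close>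

text \<open>Explicit constants stand in for the operator norm, so that no supremum has to be
  formed.\<close>

definition op_dist_le ::
  "('a::cstar_algebra, 'x, 'z) hilbert_module_scheme \<Rightarrow> ('x \<Rightarrow> 'x) \<Rightarrow> ('x \<Rightarrow> 'x) \<Rightarrow> real \<Rightarrow> bool" where
  "op_dist_le Y S T c \<longleftrightarrow> (\<forall>z\<in>carrier Y. vnorm Y (vminus Y (S z) (T z)) \<le> c * vnorm Y z)"

definition op_norm_le ::
  "('a::cstar_algebra, 'x, 'z) hilbert_module_scheme \<Rightarrow> ('x \<Rightarrow> 'x) \<Rightarrow> real \<Rightarrow> bool" where
  "op_norm_le Y S c \<longleftrightarrow> (\<forall>z\<in>carrier Y. vnorm Y (S z) \<le> c * vnorm Y z)"

text \<open>The list keeps a presentation of the operator as a sum of rank one operators. The values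
  of a representation are first defined on lists, before independence of the presentation is
  known.\<close>

definition fin_op :: "('a::cstar_algebra, 'x, 'z) hilbert_module_scheme \<Rightarrow> ('x \<times> 'x) list \<Rightarrow> 'x \<Rightarrow> 'x" where
  "fin_op Y L = (\<lambda>z\<in>carrier Y. foldr (\<lambda>(x, y) v. ract Y x (rinner Y y z) \<oplus>\<^bsub>Y\<^esub> v) L \<zero>\<^bsub>Y\<^esub>)"

definition vec_pairs :: "('a::cstar_algebra, 'x, 'z) hilbert_module_scheme \<Rightarrow> ('x \<times> 'x) list set" where
  "vec_pairs Y = lists (carrier Y \<times> carrier Y)"

lemma vec_pairs_simps [simp]:
  "[] \<in> vec_pairs Y"
  "(x, y) # L \<in> vec_pairs Y \<longleftrightarrow> x \<in> carrier Y \<and> y \<in> carrier Y \<and> L \<in> vec_pairs Y"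
  "L @ M \<in> vec_pairs Y \<longleftrightarrow> L \<in> vec_pairs Y \<and> M \<in> vec_pairs Y"
  by (auto simp: vec_pairs_def)

lemma vec_pairs_induct [consumes 1, case_names Nil Cons, induct set: vec_pairs]:
  assumes "L \<in> vec_pairs Y" "Q []"
    "\<And>x y L. \<lbrakk>x \<in> carrier Y; y \<in> carrier Y; L \<in> vec_pairs Y; Q L\<rbrakk> \<Longrightarrow> Q ((x, y) # L)"
  shows "Q L"
  using assms(1) unfolding vec_pairs_def
  by (induction L rule: lists.induct) (use assms(2,3) in \<open>auto simp: vec_pairs_def\<close>)

context hilbert_module
begin

lemma op_eqI:
  assumes "S \<in> carrier Y \<rightarrow>\<^sub>E carrier Y" "T \<in> carrier Y \<rightarrow>\<^sub>E carrier Y"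
    and "\<And>w z. w \<in> carrier Y \<Longrightarrow> z \<in> carrier Y \<Longrightarrow> rinner Y w (S z) = rinner Y w (T z)"
  shows "S = T"
  using assms by (intro PiE_ext[of S "carrier Y" "\<lambda>_. carrier Y" T] vector_eqI) auto

lemma is_adjoint_unique: "is_adjoint Y T R \<Longrightarrow> is_adjoint Y T R' \<Longrightarrow> R = R'"
  unfolding is_adjoint_def
  by (rule op_eqI) (simp, simp, metis)

lemma adjointE:
  assumes "T \<in> adjointables Y" shows "is_adjoint Y T (adjoint Y T)"
proof -
  obtain R where "is_adjoint Y T R" using assms by (auto simp: adjointables_def)
  hence "\<exists>!R. is_adjoint Y T R" using is_adjoint_unique by blast
  thus ?thesis unfolding adjoint_def by (rule theI')
qed

lemma adjoint_eqI: "T \<in> adjointables Y \<Longrightarrow> is_adjoint Y T R \<Longrightarrow> adjoint Y T = R"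
  using adjointE is_adjoint_unique by blast

lemma adjointable_funcset: "T \<in> adjointables Y \<Longrightarrow> T \<in> carrier Y \<rightarrow>\<^sub>E carrier Y"
  by (simp add: adjointables_def)

lemma adjointable_closed: "T \<in> adjointables Y \<Longrightarrow> x \<in> carrier Y \<Longrightarrow> T x \<in> carrier Y"
  using adjointable_funcset by auto

lemma adjoint_closed [simp]: "T \<in> adjointables Y \<Longrightarrow> x \<in> carrier Y \<Longrightarrow> adjoint Y T x \<in> carrier Y"
  using adjointE by (auto simp: is_adjoint_def)

declare adjointable_closed [simp]

lemma rinner_adjoint:
  "T \<in> adjointables Y \<Longrightarrow> x \<in> carrier Y \<Longrightarrow> y \<in> carrier Y \<Longrightarrow> rinner Y (T x) y = rinner Y x (adjoint Y T y)"
  using adjointE by (auto simp: is_adjoint_def)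

lemma rinner_adjoint_right:
  "T \<in> adjointables Y \<Longrightarrow> x \<in> carrier Y \<Longrightarrow> y \<in> carrier Y \<Longrightarrow> rinner Y x (T y) = rinner Y (adjoint Y T x) y"
  using rinner_adjoint[of T y x] by (metis adjoint_closed adjointable_closed rinner_star)

lemma is_adjoint_adjoint: "T \<in> adjointables Y \<Longrightarrow> is_adjoint Y (adjoint Y T) T"
  by (simp add: is_adjoint_def adjointable_funcset rinner_adjoint_right)

lemma adjoint_adjointable [simp]: "T \<in> adjointables Y \<Longrightarrow> adjoint Y T \<in> adjointables Y"
  using adjointE[of T] is_adjoint_adjoint[of T] by (auto simp: adjointables_def is_adjoint_def)

lemma adjoint_adjoint [simp]: "T \<in> adjointables Y \<Longrightarrow> adjoint Y (adjoint Y T) = T"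
  by (rule adjoint_eqI) (simp_all add: is_adjoint_adjoint)

lemma adjointablesI:
  assumes "T \<in> carrier Y \<rightarrow>\<^sub>E carrier Y" "R \<in> carrier Y \<rightarrow>\<^sub>E carrier Y"
    "\<And>x y. x \<in> carrier Y \<Longrightarrow> y \<in> carrier Y \<Longrightarrow> rinner Y (T x) y = rinner Y x (R y)"
  shows "T \<in> adjointables Y" "adjoint Y T = R"
proof -
  have R: "is_adjoint Y T R" using assms by (simp add: is_adjoint_def)
  thus T: "T \<in> adjointables Y" using assms by (auto simp: adjointables_def)
  show "adjoint Y T = R" using T R by (rule adjoint_eqI)
qed

text \<open>Linearity is not part of being adjointable; it follows by moving the operator to the
  other side of the inner product.\<close>

lemma adjointable_vminus:
  assumes "T \<in> adjointables Y" "x \<in> carrier Y" "y \<in> carrier Y"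
  shows "T (vminus Y x y) = vminus Y (T x) (T y)"
  by (rule vector_eqI) (use assms in \<open>simp_all add: rinner_adjoint_right rinner_right_simps\<close>)

lemma op_apply [simp]:
  "z \<in> carrier Y \<Longrightarrow> op_add Y S T z = S z \<oplus> T z"
  "z \<in> carrier Y \<Longrightarrow> op_scale Y c S z = c \<odot> S z"
  "z \<in> carrier Y \<Longrightarrow> op_comp Y S T z = S (T z)"
  by (simp_all add: op_add_def op_scale_def op_comp_def compose_def)

lemma op_funcset:
  "S \<in> carrier Y \<rightarrow>\<^sub>E carrier Y \<Longrightarrow> T \<in> carrier Y \<rightarrow>\<^sub>E carrier Y \<Longrightarrow> op_add Y S T \<in> carrier Y \<rightarrow>\<^sub>E carrier Y"
  "S \<in> carrier Y \<rightarrow>\<^sub>E carrier Y \<Longrightarrow> op_scale Y c S \<in> carrier Y \<rightarrow>\<^sub>E carrier Y"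
  "S \<in> carrier Y \<rightarrow>\<^sub>E carrier Y \<Longrightarrow> T \<in> carrier Y \<rightarrow>\<^sub>E carrier Y \<Longrightarrow> op_comp Y S T \<in> carrier Y \<rightarrow>\<^sub>E carrier Y"
  by (auto simp: op_add_def op_scale_def op_comp_def compose_def intro!: closed_simps(1,2))

lemmas adjointable_funcsets = op_funcset adjointable_funcset adjoint_adjointable[THEN adjointable_funcset]

lemma op_add_adjointable:
  assumes "S \<in> adjointables Y" "T \<in> adjointables Y"
  shows "op_add Y S T \<in> adjointables Y" "adjoint Y (op_add Y S T) = op_add Y (adjoint Y S) (adjoint Y T)"
  by (rule adjointablesI[of _ "op_add Y (adjoint Y S) (adjoint Y T)"];
    use assms in \<open>simp add: adjointable_funcsets rinner_right_simps rinner_left_simps rinner_adjoint\<close>)+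

lemma op_scale_adjointable:
  assumes "S \<in> adjointables Y"
  shows "op_scale Y c S \<in> adjointables Y" "adjoint Y (op_scale Y c S) = op_scale Y (cnj c) (adjoint Y S)"
  by (rule adjointablesI[of _ "op_scale Y (cnj c) (adjoint Y S)"];
    use assms in \<open>simp add: adjointable_funcsets rinner_right_simps rinner_left_simps rinner_adjoint\<close>)+

lemma op_comp_adjointable:
  assumes "S \<in> adjointables Y" "T \<in> adjointables Y"
  shows "op_comp Y S T \<in> adjointables Y" "adjoint Y (op_comp Y S T) = op_comp Y (adjoint Y T) (adjoint Y S)"
  by (rule adjointablesI[of _ "op_comp Y (adjoint Y T) (adjoint Y S)"];
    use assms in \<open>simp add: adjointable_funcsets rinner_adjoint\<close>)+

lemmas op_adjointable = op_add_adjointable op_scale_adjointable op_comp_adjointable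

lemma fin_op_Nil: "z \<in> carrier Y \<Longrightarrow> fin_op Y [] z = \<zero>"
  and fin_op_Cons: "z \<in> carrier Y \<Longrightarrow> fin_op Y ((x, y) # L) z = ract Y x (rinner Y y z) \<oplus> fin_op Y L z"
  by (simp_all add: fin_op_def)

lemma fin_op_closed [simp]: "L \<in> vec_pairs Y \<Longrightarrow> z \<in> carrier Y \<Longrightarrow> fin_op Y L z \<in> carrier Y"
  by (induction L rule: vec_pairs_induct) (auto simp: fin_op_Nil fin_op_Cons)

lemma fin_op_funcset: "L \<in> vec_pairs Y \<Longrightarrow> fin_op Y L \<in> carrier Y \<rightarrow>\<^sub>E carrier Y"
  using fin_op_closed by (auto simp: PiE_def extensional_def) (simp add: fin_op_def)

lemma rinner_fin_op:
  "L \<in> vec_pairs Y \<Longrightarrow> z \<in> carrier Y \<Longrightarrow> w \<in> carrier Y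
    \<Longrightarrow> rinner Y w (fin_op Y L z) = (\<Sum>(x, y)\<leftarrow>L. rinner Y w x * rinner Y y z)"
  by (induction L rule: vec_pairs_induct) (auto simp: fin_op_Nil fin_op_Cons rinner_right_simps)

lemma rinner_fin_op_left:
  "L \<in> vec_pairs Y \<Longrightarrow> z \<in> carrier Y \<Longrightarrow> w \<in> carrier Y
    \<Longrightarrow> rinner Y (fin_op Y L z) w = (\<Sum>(x, y)\<leftarrow>L. rinner Y z y * rinner Y x w)"
proof (induction L rule: vec_pairs_induct)
  case Nil
  thus ?case using rinner_zero_right[of w] rinner_star[of w \<zero>] by (simp add: fin_op_Nil)
qed (auto simp: fin_op_Cons rinner_left_simps rinner_star)

lemma vec_pairs_map_swap [simp]: "L \<in> vec_pairs Y \<Longrightarrow> map prod.swap L \<in> vec_pairs Y"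
  by (induction L rule: vec_pairs_induct) auto

lemma fin_op_adjointable [simp]: "L \<in> vec_pairs Y \<Longrightarrow> fin_op Y L \<in> adjointables Y"
  and adjoint_fin_op: "L \<in> vec_pairs Y \<Longrightarrow> adjoint Y (fin_op Y L) = fin_op Y (map prod.swap L)"
  by (rule adjointablesI[of _ "fin_op Y (map prod.swap L)"];
    simp add: fin_op_funcset rinner_fin_op_left rinner_fin_op o_def case_prod_unfold)+

lemma fin_op_append:
  assumes "L \<in> vec_pairs Y" "M \<in> vec_pairs Y"
  shows "fin_op Y (L @ M) = op_add Y (fin_op Y L) (fin_op Y M)"
  by (rule op_eqI) (use assms in \<open>simp_all add: fin_op_funcset op_funcset rinner_fin_op rinner_add\<close>)

lemma fin_op_scale:
  assumes "L \<in> vec_pairs Y"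
  shows "map (\<lambda>(x, y). (c \<odot> x, y)) L \<in> vec_pairs Y"
    "fin_op Y (map (\<lambda>(x, y). (c \<odot> x, y)) L) = op_scale Y c (fin_op Y L)"
proof -
  show *: "map (\<lambda>(x, y). (c \<odot> x, y)) L \<in> vec_pairs Y"
    using assms by (induction L rule: vec_pairs_induct) auto
  show "fin_op Y (map (\<lambda>(x, y). (c \<odot> x, y)) L) = op_scale Y c (fin_op Y L)"
  proof (rule op_eqI)
    fix w z assume wz: "w \<in> carrier Y" "z \<in> carrier Y"
    have "(\<Sum>(x, y)\<leftarrow>map (\<lambda>(x, y). (c \<odot> x, y)) L. rinner Y w x * rinner Y y z) =
        c *\<^sub>C (\<Sum>(x, y)\<leftarrow>L. rinner Y w x * rinner Y y z)"
      using assms wz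
      by (induction L rule: vec_pairs_induct) (auto simp: scaleC_add_right rinner_scale mult_scaleC_left)
    thus "rinner Y w (fin_op Y (map (\<lambda>(x, y). (c \<odot> x, y)) L) z) = rinner Y w (op_scale Y c (fin_op Y L) z)"
      using assms * wz by (simp add: rinner_fin_op rinner_scale)
  qed (use assms * in \<open>simp_all add: fin_op_funcset op_funcset\<close>)
qed

text \<open>The explicit list matters beyond the ideal property: \<open>fin_rep_mult\<close>
  computes products of representing elements with it.\<close>

lemma fin_op_comp_left:
  assumes S: "S \<in> adjointables Y" and L: "L \<in> vec_pairs Y"
  shows "map (\<lambda>(x, y). (S x, y)) L \<in> vec_pairs Y"
    "fin_op Y (map (\<lambda>(x, y). (S x, y)) L) = op_comp Y S (fin_op Y L)"
proof -
  show *: "map (\<lambda>(x, y). (S x, y)) L \<in> vec_pairs Y"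
    using L S by (induction L rule: vec_pairs_induct) auto
  show "fin_op Y (map (\<lambda>(x, y). (S x, y)) L) = op_comp Y S (fin_op Y L)"
  proof (rule op_eqI)
    fix w z assume wz: "w \<in> carrier Y" "z \<in> carrier Y"
    have "(\<Sum>(x, y)\<leftarrow>map (\<lambda>(x, y). (S x, y)) L. rinner Y w x * rinner Y y z) =
        (\<Sum>(x, y)\<leftarrow>L. rinner Y (adjoint Y S w) x * rinner Y y z)"
      using L wz S
      by (induction L rule: vec_pairs_induct) (auto simp: rinner_adjoint_right[OF S])
    thus "rinner Y w (fin_op Y (map (\<lambda>(x, y). (S x, y)) L) z) = rinner Y w (op_comp Y S (fin_op Y L) z)"
      using S L * wz by (simp add: rinner_fin_op rinner_adjoint_right[OF S])
  qed (use S L * in \<open>simp_all add: fin_op_funcset op_funcset adjointable_funcset\<close>)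
qed

lemma fin_op_comp_right:
  assumes S: "S \<in> adjointables Y" and L: "L \<in> vec_pairs Y"
  shows "map (\<lambda>(x, y). (x, adjoint Y S y)) L \<in> vec_pairs Y"
    "fin_op Y (map (\<lambda>(x, y). (x, adjoint Y S y)) L) = op_comp Y (fin_op Y L) S"
proof -
  show *: "map (\<lambda>(x, y). (x, adjoint Y S y)) L \<in> vec_pairs Y"
    using L S by (induction L rule: vec_pairs_induct) auto
  show "fin_op Y (map (\<lambda>(x, y). (x, adjoint Y S y)) L) = op_comp Y (fin_op Y L) S"
  proof (rule op_eqI)
    fix w z assume wz: "w \<in> carrier Y" "z \<in> carrier Y"
    have "(\<Sum>(x, y)\<leftarrow>map (\<lambda>(x, y). (x, adjoint Y S y)) L. rinner Y w x * rinner Y y z) =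
        (\<Sum>(x, y)\<leftarrow>L. rinner Y w x * rinner Y y (S z))"
      using L wz S
      by (induction L rule: vec_pairs_induct) (auto simp: rinner_adjoint_right[OF S])
    thus "rinner Y w (fin_op Y (map (\<lambda>(x, y). (x, adjoint Y S y)) L) z) = rinner Y w (op_comp Y (fin_op Y L) S z)"
      using S L * wz by (simp add: rinner_fin_op)
  qed (use S L * in \<open>simp_all add: fin_op_funcset op_funcset adjointable_funcset\<close>)
qed

lemma rank_one_eq_fin_op:
  assumes "x \<in> carrier Y" "y \<in> carrier Y" shows "rank_one Y x y = fin_op Y [(x, y)]"
  by (rule ext) (use assms in \<open>auto simp: rank_one_def fin_op_def add_zero restrict_def\<close>)

text \<open>The coefficients of a linear combination are absorbed into the first vectors of the
  pairs.\<close>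

lemma finite_rank_eq: "finite_rank Y = fin_op Y ` vec_pairs Y"
proof (intro equalityI subsetI)
  fix F assume "F \<in> finite_rank Y"
  thus "F \<in> fin_op Y ` vec_pairs Y"
    unfolding finite_rank_def
  proof (induction rule: lin_span.induct)
    case span_zero
    have "(\<lambda>z\<in>carrier Y. \<zero>) = fin_op Y []" by (simp add: fin_op_def)
    thus ?case by (intro image_eqI[of _ _ "[]"]) simp_all
  next
    case (span_step R G c)
    then obtain x y L where R: "R = fin_op Y [(x, y)]" "x \<in> carrier Y" "y \<in> carrier Y"
      and L: "G = fin_op Y L" "L \<in> vec_pairs Y" by (auto simp: rank_one_eq_fin_op)
    have xy: "[(x, y)] \<in> vec_pairs Y" using R by simp
    have "op_add Y (op_scale Y c R) G = fin_op Y ([(c \<odot> x, y)] @ L)"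
      using fin_op_scale(2)[OF xy, of c] R L by (subst fin_op_append) auto
    thus ?case using R L by (intro image_eqI[where x = "[(c \<odot> x, y)] @ L"]) auto
  qed
next
  fix F assume "F \<in> fin_op Y ` vec_pairs Y"
  then obtain L where "L \<in> vec_pairs Y" "F = fin_op Y L" by auto
  thus "F \<in> finite_rank Y"
  proof (induction L arbitrary: F rule: vec_pairs_induct)
    case Nil
    have "fin_op Y [] = (\<lambda>z\<in>carrier Y. \<zero>)" by (simp add: fin_op_def)
    thus ?case unfolding Nil finite_rank_def by (simp only: lin_span.span_zero)
  next
    case (Cons x y L)
    note p = \<open>x \<in> carrier Y\<close> \<open>y \<in> carrier Y\<close>
    have xy: "[(x, y)] \<in> vec_pairs Y" using p by simp
    have "[(1 \<odot> x, y)] = [(x, y)]" using p by (simp add: scale_one)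
    hence "op_add Y (op_scale Y 1 (rank_one Y x y)) (fin_op Y L) = fin_op Y ([(x, y)] @ L)"
      using fin_op_scale(2)[OF xy, of 1] p Cons by (subst fin_op_append) (auto simp: rank_one_eq_fin_op)
    moreover have "op_add Y (op_scale Y 1 (rank_one Y x y)) (fin_op Y L) \<in> finite_rank Y"
      using Cons.IH[OF refl] p unfolding finite_rank_def by (intro lin_span.span_step) blast+
    ultimately show ?case using Cons p by simp
  qed
qed

lemma compacts_iff:
  "S \<in> compacts Y \<longleftrightarrow> S \<in> adjointables Y \<and> (\<forall>\<epsilon>>0. \<exists>L\<in>vec_pairs Y. op_dist_le Y S (fin_op Y L) \<epsilon>)"
  unfolding compacts_def finite_rank_eq op_dist_le_def by auto

end


section \<open>Compact operators\<close>

context hilbert_module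
begin

section \<open>Calculus of operator bounds\<close>

lemma op_norm_leD: "op_norm_le Y S c \<Longrightarrow> z \<in> carrier Y \<Longrightarrow> vnorm Y (S z) \<le> c * vnorm Y z"
  by (simp add: op_norm_le_def)

lemma op_dist_leD: "op_dist_le Y S T c \<Longrightarrow> z \<in> carrier Y \<Longrightarrow> vnorm Y (vminus Y (S z) (T z)) \<le> c * vnorm Y z"
  by (simp add: op_dist_le_def)

lemma op_dist_le_mono: "op_dist_le Y S T c \<Longrightarrow> c \<le> d \<Longrightarrow> op_dist_le Y S T d"
  unfolding op_dist_le_def by (meson mult_right_mono order_trans vnorm_nonneg)

lemma op_dist_le_refl: "S \<in> adjointables Y \<Longrightarrow> 0 \<le> c \<Longrightarrow> op_dist_le Y S S c"
proof -
  assume S: "S \<in> adjointables Y" and c: "0 \<le> c"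
  have "vminus Y x x = \<zero>" if "x \<in> carrier Y" for x
    using that by (simp add: vminus_def add_minus)
  thus ?thesis using S c by (simp add: op_dist_le_def)
qed

lemma op_dist_le_sym:
  "S \<in> adjointables Y \<Longrightarrow> T \<in> adjointables Y \<Longrightarrow> op_dist_le Y S T c \<Longrightarrow> op_dist_le Y T S c"
  unfolding op_dist_le_def by (metis adjointable_closed vnorm_vminus_commute)

lemma op_dist_le_trans:
  assumes "S \<in> adjointables Y" "T \<in> adjointables Y" "U \<in> adjointables Y"
    and "op_dist_le Y S T c" "op_dist_le Y T U d"
  shows "op_dist_le Y S U (c + d)"
  unfolding op_dist_le_def
proof
  fix z assume z: "z \<in> carrier Y"
  have "vnorm Y (vminus Y (S z) (U z)) \<le> vnorm Y (vminus Y (S z) (T z)) + vnorm Y (vminus Y (T z) (U z))"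
    using assms z by (intro vnorm_vminus_le) auto
  thus "vnorm Y (vminus Y (S z) (U z)) \<le> (c + d) * vnorm Y z"
    using op_dist_leD[OF assms(4) z] op_dist_leD[OF assms(5) z] by (simp add: distrib_right)
qed

lemma op_dist_le_add:
  assumes "S \<in> adjointables Y" "T \<in> adjointables Y" "S' \<in> adjointables Y" "T' \<in> adjointables Y"
    and "op_dist_le Y S T c" "op_dist_le Y S' T' d"
  shows "op_dist_le Y (op_add Y S S') (op_add Y T T') (c + d)"
  unfolding op_dist_le_def
proof
  fix z assume z: "z \<in> carrier Y"
  have "vminus Y (op_add Y S S' z) (op_add Y T T' z) = vminus Y (S z) (T z) \<oplus> vminus Y (S' z) (T' z)"
    by (rule vector_eqI) (use assms z in \<open>simp_all add: rinner_right_simps\<close>)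
  hence "vnorm Y (vminus Y (op_add Y S S' z) (op_add Y T T' z)) \<le>
      vnorm Y (vminus Y (S z) (T z)) + vnorm Y (vminus Y (S' z) (T' z))"
    using assms z by (simp add: vnorm_add)
  thus "vnorm Y (vminus Y (op_add Y S S' z) (op_add Y T T' z)) \<le> (c + d) * vnorm Y z"
    using op_dist_leD[OF assms(5) z] op_dist_leD[OF assms(6) z] by (simp add: distrib_right)
qed

lemma op_dist_le_scale:
  assumes "S \<in> adjointables Y" "T \<in> adjointables Y" "op_dist_le Y S T c"
  shows "op_dist_le Y (op_scale Y k S) (op_scale Y k T) (cmod k * c)"
  unfolding op_dist_le_def
proof
  fix z assume z: "z \<in> carrier Y"
  have "vminus Y (op_scale Y k S z) (op_scale Y k T z) = k \<odot> vminus Y (S z) (T z)"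
    by (rule vector_eqI) (use assms z in \<open>simp_all add: rinner_right_simps scaleC_diff_right\<close>)
  thus "vnorm Y (vminus Y (op_scale Y k S z) (op_scale Y k T z)) \<le> cmod k * c * vnorm Y z"
    using op_dist_leD[OF assms(3) z] assms z by (simp add: vnorm_scale mult.assoc mult_left_mono)
qed

lemma op_dist_le_comp_right:
  assumes "T \<in> adjointables Y" "op_dist_le Y S S' c" "op_norm_le Y T k" "0 \<le> c"
  shows "op_dist_le Y (op_comp Y S T) (op_comp Y S' T) (c * k)"
  unfolding op_dist_le_def
proof
  fix z assume z: "z \<in> carrier Y"
  have "vnorm Y (vminus Y (S (T z)) (S' (T z))) \<le> c * vnorm Y (T z)"
    using assms z by (intro op_dist_leD) auto
  also have "\<dots> \<le> c * (k * vnorm Y z)" using assms z by (intro mult_left_mono op_norm_leD)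
  finally show "vnorm Y (vminus Y (op_comp Y S T z) (op_comp Y S' T z)) \<le> c * k * vnorm Y z"
    using z by (simp add: mult.assoc)
qed

lemma op_dist_le_comp_left:
  assumes "S \<in> adjointables Y" "T \<in> adjointables Y" "T' \<in> adjointables Y"
    and "op_dist_le Y T T' c" "op_norm_le Y S k" "0 \<le> k"
  shows "op_dist_le Y (op_comp Y S T) (op_comp Y S T') (k * c)"
  unfolding op_dist_le_def
proof
  fix z assume z: "z \<in> carrier Y"
  have "vnorm Y (S (vminus Y (T z) (T' z))) \<le> k * vnorm Y (vminus Y (T z) (T' z))"
    using assms z by (intro op_norm_leD) auto
  also have "\<dots> \<le> k * (c * vnorm Y z)" using assms z by (intro mult_left_mono op_dist_leD)
  finally show "vnorm Y (vminus Y (op_comp Y S T z) (op_comp Y S T' z)) \<le> k * c * vnorm Y z"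
    using z assms by (simp add: mult.assoc adjointable_vminus)
qed

lemma op_norm_le_comp:
  assumes "T \<in> adjointables Y" "op_norm_le Y S c" "op_norm_le Y T k" "0 \<le> c"
  shows "op_norm_le Y (op_comp Y S T) (c * k)"
  unfolding op_norm_le_def
proof
  fix z assume z: "z \<in> carrier Y"
  have "vnorm Y (S (T z)) \<le> c * vnorm Y (T z)" using assms z by (intro op_norm_leD) auto
  also have "\<dots> \<le> c * (k * vnorm Y z)" using assms z by (intro mult_left_mono op_norm_leD)
  finally show "vnorm Y (op_comp Y S T z) \<le> c * k * vnorm Y z" using z by (simp add: mult.assoc)
qed

lemma op_norm_le_of_dist:
  assumes "S \<in> adjointables Y" "T \<in> adjointables Y" "op_dist_le Y S T c" "op_norm_le Y T k"
  shows "op_norm_le Y S (c + k)"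
  unfolding op_norm_le_def
proof
  fix z assume z: "z \<in> carrier Y"
  have "vnorm Y (S z) \<le> vnorm Y (vminus Y (S z) (T z)) + vnorm Y (T z)"
    using assms z by (intro vnorm_le_vminus_add) auto
  thus "vnorm Y (S z) \<le> (c + k) * vnorm Y z"
    using op_dist_leD[OF assms(3) z] op_norm_leD[OF assms(4) z] by (simp add: distrib_right)
qed

text \<open>The square of \<open>vnorm Y (R z)\<close> is
  \<open>norm (rinner Y (D (R z)) z)\<close>, to which Cauchy-Schwarz applies. Plain functions
  \<open>D\<close> and \<open>R\<close> make the result available for differences of
  operators.\<close>

lemma vnorm_adjoint_le:
  assumes DR: "\<And>z. z \<in> carrier Y \<Longrightarrow> D z \<in> carrier Y" "\<And>z. z \<in> carrier Y \<Longrightarrow> R z \<in> carrier Y"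
    and adj: "\<And>x y. x \<in> carrier Y \<Longrightarrow> y \<in> carrier Y \<Longrightarrow> rinner Y (D x) y = rinner Y x (R y)"
    and c: "\<And>z. z \<in> carrier Y \<Longrightarrow> vnorm Y (D z) \<le> c * vnorm Y z" and z: "z \<in> carrier Y"
  shows "vnorm Y (R z) \<le> c * vnorm Y z"
proof (cases "vnorm Y (R z) = 0")
  case True
  have "0 \<le> c * vnorm Y z" using c[OF z] vnorm_nonneg[of "D z"] by linarith
  thus ?thesis using True by simp
next
  case False
  have "(vnorm Y (R z))\<^sup>2 = norm (rinner Y (D (R z)) z)"
    using DR z by (simp add: vnorm_power2 adj)
  also have "\<dots> \<le> vnorm Y (D (R z)) * vnorm Y z" using DR z by (intro cauchy_schwarz) auto
  also have "\<dots> \<le> c * vnorm Y (R z) * vnorm Y z" by (intro mult_right_mono c DR(2) z vnorm_nonneg)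
  finally have "vnorm Y (R z) * vnorm Y (R z) \<le> (c * vnorm Y z) * vnorm Y (R z)"
    by (simp add: power2_eq_square algebra_simps)
  moreover have "vnorm Y (R z) > 0" using False vnorm_nonneg[of "R z"] by linarith
  ultimately show ?thesis by simp
qed

lemma op_norm_le_adjoint:
  assumes "S \<in> adjointables Y" "op_norm_le Y S c" shows "op_norm_le Y (adjoint Y S) c"
  unfolding op_norm_le_def
  by (rule ballI, rule vnorm_adjoint_le[where D = S]) (use assms in \<open>auto simp: rinner_adjoint op_norm_leD\<close>)

lemma op_dist_le_adjoint:
  assumes "S \<in> adjointables Y" "T \<in> adjointables Y" "op_dist_le Y S T c"
  shows "op_dist_le Y (adjoint Y S) (adjoint Y T) c"
  unfolding op_dist_le_def
proof (intro ballI)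
  fix z assume "z \<in> carrier Y"
  show "vnorm Y (vminus Y (adjoint Y S z) (adjoint Y T z)) \<le> c * vnorm Y z"
    by (rule vnorm_adjoint_le[where D = "\<lambda>z. vminus Y (S z) (T z)" and R = "\<lambda>z. vminus Y (adjoint Y S z) (adjoint Y T z)"])
      (use assms \<open>z \<in> carrier Y\<close> in \<open>auto simp: rinner_adjoint op_dist_leD rinner_right_simps rinner_left_simps\<close>)
qed

lemma op_eq_if_dist_small:
  assumes ST: "S \<in> adjointables Y" "T \<in> adjointables Y"
    and small: "\<And>c. c > 0 \<Longrightarrow> op_dist_le Y S T c"
  shows "S = T"
proof (rule op_eqI)
  fix w z assume wz: "w \<in> carrier Y" "z \<in> carrier Y"
  have "vnorm Y (vminus Y (S z) (T z)) \<le> 0"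
  proof (rule field_le_epsilon)
    fix e :: real assume e: "e > 0"
    define c where "c = e / (vnorm Y z + 1)"
    have "vnorm Y z + 1 > 0" using vnorm_nonneg[of z] by linarith
    hence "c > 0" "c * (vnorm Y z + 1) = e" using e by (simp_all add: c_def)
    thus "vnorm Y (vminus Y (S z) (T z)) \<le> 0 + e"
      using op_dist_leD[OF small[OF \<open>c > 0\<close>] wz(2)] by (simp add: distrib_left)
  qed
  hence "vnorm Y (vminus Y (S z) (T z)) = 0" using vnorm_nonneg by (rule antisym)
  hence "vminus Y (S z) (T z) = \<zero>" using ST wz by (intro vnorm_eq_0) auto
  hence "rinner Y w (S z) - rinner Y w (T z) = 0"
    using ST wz rinner_vminus_right[of w "S z" "T z"] by (simp add: rinner_zero_right)
  thus "rinner Y w (S z) = rinner Y w (T z)" by simp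
qed (use ST adjointable_funcset in auto)

lemma fin_op_bounded:
  assumes "L \<in> vec_pairs Y" shows "op_norm_le Y (fin_op Y L) (\<Sum>(x, y)\<leftarrow>L. vnorm Y x * vnorm Y y)"
  using assms
proof (induction rule: vec_pairs_induct)
  case Nil
  thus ?case by (simp add: op_norm_le_def fin_op_Nil)
next
  case (Cons x y L)
  show ?case unfolding op_norm_le_def
  proof
    fix z assume z: "z \<in> carrier Y"
    have "vnorm Y (ract Y x (rinner Y y z)) \<le> vnorm Y x * norm (rinner Y y z)"
      using Cons by (intro vnorm_ract)
    also have "\<dots> \<le> vnorm Y x * (vnorm Y y * vnorm Y z)"
      using Cons z by (intro mult_left_mono cauchy_schwarz) auto
    finally have "vnorm Y (ract Y x (rinner Y y z)) \<le> vnorm Y x * vnorm Y y * vnorm Y z" by (simp add: mult.assoc)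
    moreover have "vnorm Y (fin_op Y ((x, y) # L) z) \<le> vnorm Y (ract Y x (rinner Y y z)) + vnorm Y (fin_op Y L z)"
      using Cons z by (simp add: fin_op_Cons vnorm_add)
    ultimately show "vnorm Y (fin_op Y ((x, y) # L) z) \<le> (\<Sum>(x, y)\<leftarrow>(x, y) # L. vnorm Y x * vnorm Y y) * vnorm Y z"
      using op_norm_leD[OF Cons.IH z] by (simp add: distrib_right)
  qed
qed

section \<open>Closure properties of the compact operators\<close>

lemma compacts_adjointable [simp]: "S \<in> compacts Y \<Longrightarrow> S \<in> adjointables Y"
  by (simp add: compacts_def)

lemma compactsE:
  assumes "S \<in> compacts Y" "\<epsilon> > 0"
  obtains L where "L \<in> vec_pairs Y" "op_dist_le Y S (fin_op Y L) \<epsilon>"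
  using assms by (auto simp: compacts_iff)

lemma compacts_bounded:
  assumes "S \<in> compacts Y" obtains k where "0 < k" "op_norm_le Y S k"
proof -
  obtain L where L: "L \<in> vec_pairs Y" "op_dist_le Y S (fin_op Y L) 1"
    using compactsE[OF assms zero_less_one] .
  have "op_norm_le Y S (1 + (\<Sum>(x, y)\<leftarrow>L. vnorm Y x * vnorm Y y))"
    by (rule op_norm_le_of_dist[OF _ _ L(2) fin_op_bounded[OF L(1)]]) (use assms L in simp_all)
  moreover have "0 \<le> (\<Sum>(x, y)\<leftarrow>L. vnorm Y x * vnorm Y y)"
    by (rule sum_list_nonneg) auto
  ultimately show ?thesis by (intro that[of "1 + (\<Sum>(x, y)\<leftarrow>L. vnorm Y x * vnorm Y y)"]) auto
qed

lemma compacts_closed: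
  assumes S: "S \<in> adjointables Y"
    and approx: "\<And>\<epsilon>. \<epsilon> > 0 \<Longrightarrow> \<exists>T\<in>compacts Y. op_dist_le Y S T \<epsilon>"
  shows "S \<in> compacts Y"
  unfolding compacts_iff
proof (intro conjI allI impI S)
  fix \<epsilon> :: real assume "\<epsilon> > 0"
  hence e: "\<epsilon> / 2 > 0" by simp
  obtain T where T: "T \<in> compacts Y" "op_dist_le Y S T (\<epsilon> / 2)" using approx[OF e] by blast
  obtain L where L: "L \<in> vec_pairs Y" "op_dist_le Y T (fin_op Y L) (\<epsilon> / 2)" using compactsE[OF T(1) e] .
  have "op_dist_le Y S (fin_op Y L) (\<epsilon> / 2 + \<epsilon> / 2)"
    by (rule op_dist_le_trans[OF _ _ _ T(2) L(2)]) (use S T L in simp_all)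
  thus "\<exists>L\<in>vec_pairs Y. op_dist_le Y S (fin_op Y L) \<epsilon>" using L by auto
qed

lemma fin_op_compact [simp]: "L \<in> vec_pairs Y \<Longrightarrow> fin_op Y L \<in> compacts Y"
  unfolding compacts_iff by (auto intro!: bexI[of _ L] op_dist_le_refl)

lemma op_add_compact:
  assumes "S \<in> compacts Y" "T \<in> compacts Y" shows "op_add Y S T \<in> compacts Y"
proof (rule compacts_closed)
  fix \<epsilon> :: real assume "\<epsilon> > 0"
  hence e: "\<epsilon> / 2 > 0" by simp
  obtain L where L: "L \<in> vec_pairs Y" "op_dist_le Y S (fin_op Y L) (\<epsilon> / 2)" using compactsE[OF assms(1) e] .
  obtain M where M: "M \<in> vec_pairs Y" "op_dist_le Y T (fin_op Y M) (\<epsilon> / 2)" using compactsE[OF assms(2) e] .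
  have "op_dist_le Y (op_add Y S T) (op_add Y (fin_op Y L) (fin_op Y M)) (\<epsilon> / 2 + \<epsilon> / 2)"
    by (rule op_dist_le_add[OF _ _ _ _ L(2) M(2)]) (use assms L M in simp_all)
  thus "\<exists>T'\<in>compacts Y. op_dist_le Y (op_add Y S T) T' \<epsilon>"
    using L M fin_op_compact[of "L @ M"] by (intro bexI[of _ "fin_op Y (L @ M)"]) (simp_all add: fin_op_append)
qed (use assms op_adjointable in simp)

lemma op_scale_compact:
  assumes "S \<in> compacts Y" shows "op_scale Y c S \<in> compacts Y"
proof (rule compacts_closed)
  fix \<epsilon> :: real assume "\<epsilon> > 0"
  have c: "cmod c + 1 > 0" by (simp add: add_nonneg_pos)
  hence e: "\<epsilon> / (cmod c + 1) > 0" using \<open>\<epsilon> > 0\<close> by simp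
  obtain L where L: "L \<in> vec_pairs Y" "op_dist_le Y S (fin_op Y L) (\<epsilon> / (cmod c + 1))" using compactsE[OF assms e] .
  have "op_dist_le Y (op_scale Y c S) (op_scale Y c (fin_op Y L)) (cmod c * (\<epsilon> / (cmod c + 1)))"
    by (rule op_dist_le_scale[OF _ _ L(2)]) (use assms L in simp_all)
  moreover have "cmod c * (\<epsilon> / (cmod c + 1)) \<le> \<epsilon>" using c \<open>\<epsilon> > 0\<close> by (simp add: field_simps)
  ultimately have "op_dist_le Y (op_scale Y c S) (fin_op Y (map (\<lambda>(x, y). (c \<odot> x, y)) L)) \<epsilon>"
    using L by (auto simp: fin_op_scale intro: op_dist_le_mono)
  thus "\<exists>T'\<in>compacts Y. op_dist_le Y (op_scale Y c S) T' \<epsilon>"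
    using L fin_op_scale(1)[OF L(1), of c] by (meson fin_op_compact)
qed (use assms op_adjointable(3) in simp)

lemma op_comp_compact:
  assumes "S \<in> compacts Y" "T \<in> compacts Y" shows "op_comp Y S T \<in> compacts Y"
proof (rule compacts_closed)
  fix \<epsilon> :: real assume "\<epsilon> > 0"
  obtain k where k: "0 < k" "op_norm_le Y T k" using compacts_bounded[OF assms(2)] .
  hence e: "\<epsilon> / k > 0" using \<open>\<epsilon> > 0\<close> by simp
  obtain L where L: "L \<in> vec_pairs Y" "op_dist_le Y S (fin_op Y L) (\<epsilon> / k)" using compactsE[OF assms(1) e] .
  have "op_dist_le Y (op_comp Y S T) (op_comp Y (fin_op Y L) T) (\<epsilon> / k * k)"
    by (rule op_dist_le_comp_right[OF _ L(2) k(2)]) (use assms L e in simp_all)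
  thus "\<exists>T'\<in>compacts Y. op_dist_le Y (op_comp Y S T) T' \<epsilon>"
    using fin_op_comp_right[OF _ L(1), of T] assms k
    by (intro bexI[of _ "op_comp Y (fin_op Y L) T"]) (simp, metis compacts_adjointable fin_op_compact)
qed (use assms op_adjointable in simp)

lemma adjoint_compact:
  assumes "S \<in> compacts Y" shows "adjoint Y S \<in> compacts Y"
proof (rule compacts_closed)
  fix \<epsilon> :: real assume "\<epsilon> > 0"
  obtain L where L: "L \<in> vec_pairs Y" "op_dist_le Y S (fin_op Y L) \<epsilon>" using compactsE[OF assms \<open>\<epsilon> > 0\<close>] .
  have "op_dist_le Y (adjoint Y S) (adjoint Y (fin_op Y L)) \<epsilon>"
    by (rule op_dist_le_adjoint[OF _ _ L(2)]) (use assms L in simp_all)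
  thus "\<exists>T\<in>compacts Y. op_dist_le Y (adjoint Y S) T \<epsilon>"
    using L by (auto simp: adjoint_fin_op)
qed (use assms in simp)

end


section \<open>Square roots of compact operators\<close>

context hilbert_module
begin

text \<open>The limit is taken pointwise in the complete module, with the rate
  \<open>\<delta>\<close>. Self-adjointness survives, so the limit is its own adjoint and no second
  limit is needed to make it adjointable.\<close>

lemma adjointable_seq_limit:
  assumes e: "\<And>n. e n \<in> adjointables Y" "\<And>n. adjoint Y (e n) = e n"
    and close: "\<And>n k. op_dist_le Y (e (n + k)) (e n) (\<delta> n)" and \<delta>: "\<delta> \<longlonglongrightarrow> 0"
  obtains E where "E \<in> adjointables Y" "adjoint Y E = E" "\<And>n. op_dist_le Y E (e n) (\<delta> n)"
proof -
  have \<delta>0: "(\<lambda>n. \<delta> n * c) \<longlonglongrightarrow> 0" for c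
    using tendsto_mult_right[OF \<delta>, of c] by simp
  have close': "vnorm Y (vminus Y (e m z) (e n z)) \<le> \<delta> n * vnorm Y z" if "z \<in> carrier Y" "n \<le> m" for z m n
    using op_dist_leD[OF close[of n "m - n"] that(1)] that by simp
  have "\<exists>x\<in>carrier Y. (\<lambda>n. vnorm Y (vminus Y (e n z) x)) \<longlonglongrightarrow> 0" if z: "z \<in> carrier Y" for z
  proof (rule complete)
    show "\<forall>n. e n z \<in> carrier Y" using e z by simp
    show "\<forall>\<epsilon>>0. \<exists>N. \<forall>m\<ge>N. \<forall>n\<ge>N. vnorm Y (vminus Y (e m z) (e n z)) < \<epsilon>"
    proof (intro allI impI)
      fix \<epsilon> :: real assume "\<epsilon> > 0"
      hence "\<forall>\<^sub>F n in sequentially. \<delta> n * vnorm Y z < \<epsilon> / 2"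
        by (intro order_tendstoD[OF \<delta>0]) simp
      then obtain N where N: "\<delta> N * vnorm Y z < \<epsilon> / 2" by (auto simp: eventually_sequentially)
      have "vnorm Y (vminus Y (e m z) (e n z)) < \<epsilon>" if "m \<ge> N" "n \<ge> N" for m n
      proof -
        have "vnorm Y (vminus Y (e m z) (e n z)) \<le>
            vnorm Y (vminus Y (e m z) (e N z)) + vnorm Y (vminus Y (e N z) (e n z))"
          using e z by (intro vnorm_vminus_le) auto
        also have "vnorm Y (vminus Y (e N z) (e n z)) = vnorm Y (vminus Y (e n z) (e N z))"
          using e z by (intro vnorm_vminus_commute) auto
        finally show ?thesis using close'[OF z that(1)] close'[OF z that(2)] N by linarith
      qed
      thus "\<exists>N. \<forall>m\<ge>N. \<forall>n\<ge>N. vnorm Y (vminus Y (e m z) (e n z)) < \<epsilon>" by blast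
    qed
  qed
  then obtain E0 where E0: "\<And>z. z \<in> carrier Y \<Longrightarrow> E0 z \<in> carrier Y"
    "\<And>z. z \<in> carrier Y \<Longrightarrow> (\<lambda>n. vnorm Y (vminus Y (e n z) (E0 z))) \<longlonglongrightarrow> 0" by metis
  define E where "E = restrict E0 (carrier Y)"
  have E: "E \<in> carrier Y \<rightarrow>\<^sub>E carrier Y" using E0 by (simp add: E_def)
  have Ez: "E z \<in> carrier Y" if "z \<in> carrier Y" for z using E that by auto
  have dist: "vnorm Y (vminus Y (E z) (e n z)) \<le> \<delta> n * vnorm Y z" if z: "z \<in> carrier Y" for n z
  proof -
    have "(\<lambda>m. \<delta> n * vnorm Y z + vnorm Y (vminus Y (e m z) (E z))) \<longlonglongrightarrow> \<delta> n * vnorm Y z + 0"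
      using E0(2)[OF z] z by (intro tendsto_intros) (simp add: E_def)
    moreover have "vnorm Y (vminus Y (E z) (e n z)) \<le> \<delta> n * vnorm Y z + vnorm Y (vminus Y (e m z) (E z))"
      if "n \<le> m" for m
    proof -
      have "vnorm Y (vminus Y (E z) (e n z)) \<le> vnorm Y (vminus Y (E z) (e m z)) + vnorm Y (vminus Y (e m z) (e n z))"
        using e z Ez by (intro vnorm_vminus_le) auto
      also have "vnorm Y (vminus Y (E z) (e m z)) = vnorm Y (vminus Y (e m z) (E z))"
        using e z Ez by (intro vnorm_vminus_commute) auto
      finally show ?thesis using close'[OF z that] by linarith
    qed
    ultimately show ?thesis by (intro LIMSEQ_le_const) auto
  qed
  have herm: "rinner Y (E x) y = rinner Y x (E y)" if xy: "x \<in> carrier Y" "y \<in> carrier Y" for x y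
  proof -
    have "norm (rinner Y (E x) y - rinner Y x (E y)) \<le> \<delta> n * (2 * vnorm Y x * vnorm Y y)" for n
    proof -
      have "rinner Y (E x) y - rinner Y x (E y) =
          rinner Y (vminus Y (E x) (e n x)) y - rinner Y x (vminus Y (E y) (e n y))"
        using xy Ez e rinner_adjoint[OF e(1) xy, of n]
        by (simp add: rinner_right_simps rinner_left_simps)
      also have "norm \<dots> \<le> norm (rinner Y (vminus Y (E x) (e n x)) y) + norm (rinner Y x (vminus Y (E y) (e n y)))"
        by (rule norm_triangle_ineq4)
      also have "\<dots> \<le> \<delta> n * vnorm Y x * vnorm Y y + vnorm Y x * (\<delta> n * vnorm Y y)"
      proof (rule add_mono)
        have "norm (rinner Y (vminus Y (E x) (e n x)) y) \<le> vnorm Y (vminus Y (E x) (e n x)) * vnorm Y y"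
          using xy Ez e by (intro cauchy_schwarz) auto
        also have "\<dots> \<le> \<delta> n * vnorm Y x * vnorm Y y" by (intro mult_right_mono dist xy vnorm_nonneg)
        finally show "norm (rinner Y (vminus Y (E x) (e n x)) y) \<le> \<delta> n * vnorm Y x * vnorm Y y" .
        have "norm (rinner Y x (vminus Y (E y) (e n y))) \<le> vnorm Y x * vnorm Y (vminus Y (E y) (e n y))"
          using xy Ez e by (intro cauchy_schwarz) auto
        also have "\<dots> \<le> vnorm Y x * (\<delta> n * vnorm Y y)" by (intro mult_left_mono dist xy vnorm_nonneg)
        finally show "norm (rinner Y x (vminus Y (E y) (e n y))) \<le> vnorm Y x * (\<delta> n * vnorm Y y)" .
      qed
      finally show ?thesis by (simp add: algebra_simps)
    qed
    hence "norm (rinner Y (E x) y - rinner Y x (E y)) \<le> 0"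
      by (intro LIMSEQ_le_const[OF \<delta>0]) auto
    thus ?thesis by simp
  qed
  show ?thesis
  proof
    show "E \<in> adjointables Y" "adjoint Y E = E" using adjointablesI[OF E E herm] by auto
    show "op_dist_le Y E (e n) (\<delta> n)" for n using dist by (simp add: op_dist_le_def)
  qed
qed

text \<open>The analogue of \<open>one_minus_sqrt_exists\<close> for the square of \<open>W\<close>.
  Operators on a carrier do not form a type with a metric, so the fixed point iteration is carried
  out by hand.\<close>

lemma compact_one_minus_sqrt_exists:
  assumes W: "W \<in> compacts Y" "adjoint Y W = W" and q: "op_norm_le Y W q" "0 \<le> q" "q < 1"
  obtains E where "E \<in> compacts Y" "adjoint Y E = E" "op_comp Y W E = op_comp Y E W"
    "op_add Y E E = op_add Y (op_comp Y W W) (op_comp Y E E)"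
proof -
  define F where "F = (\<lambda>e. op_scale Y (1/2) (op_add Y (op_comp Y W W) (op_comp Y e e)))"
  \<comment> \<open>The iteration starts at the zero operator, written as a multiple of
    \<open>W\<close> so that its compactness is immediate.\<close>
  define e where "e = (\<lambda>n. (F ^^ n) (op_scale Y 0 W))"
  have e_simps: "e 0 = op_scale Y 0 W" "e (Suc n) = F (e n)" for n by (simp_all add: e_def)
  have W' [simp]: "W \<in> adjointables Y" using W by simp
  note comps = op_scale_compact op_add_compact op_comp_compact
  have F_adj: "F T \<in> adjointables Y" if "T \<in> adjointables Y" for T
    using that unfolding F_def by (intro op_adjointable W')
  have ind: "e n \<in> compacts Y \<and> adjoint Y (e n) = e n \<and> op_norm_le Y (e n) q
      \<and> (\<forall>z\<in>carrier Y. W (e n z) = e n (W z))" for n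
  proof (induction n)
    case 0
    have "vnorm Y (0 \<odot> z) = 0" if "z \<in> carrier Y" for z using that by (simp add: vnorm_scale)
    moreover have "W (0 \<odot> W z) = 0 \<odot> W (W z)" if "z \<in> carrier Y" for z
      by (rule vector_eqI) (use that in \<open>simp_all add: rinner_adjoint_right rinner_right_simps\<close>)
    ultimately show ?case
      using q W op_adjointable(4)[OF W', of 0] op_scale_compact[OF W(1)]
      by (simp add: e_simps op_norm_le_def)
  next
    case (Suc n)
    let ?e = "e n"
    have e: "?e \<in> compacts Y" "adjoint Y ?e = ?e" "op_norm_le Y ?e q" "\<And>z. z \<in> carrier Y \<Longrightarrow> W (?e z) = ?e (W z)"
      using Suc by auto
    have ea [simp]: "?e \<in> adjointables Y" using e by simp
    have "F ?e \<in> compacts Y" unfolding F_def by (intro comps W e)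
    moreover have "adjoint Y (F ?e) = F ?e"
      unfolding F_def
      by (simp only: op_adjointable(2,4,6) op_adjointable(1,3,5) W' ea W(2) e(2)) simp
    moreover have "op_norm_le Y (F ?e) q" unfolding op_norm_le_def
    proof
      fix z assume z: "z \<in> carrier Y"
      have "vnorm Y (W (W z) \<oplus> ?e (?e z)) \<le> vnorm Y (W (W z)) + vnorm Y (?e (?e z))"
        using z by (intro vnorm_add) auto
      also have "\<dots> \<le> q * (q * vnorm Y z) + q * (q * vnorm Y z)"
        using z q e(3) op_norm_leD[OF op_norm_le_comp[OF _ q(1,1)] z] op_norm_leD[OF op_norm_le_comp[OF _ e(3,3)] z]
        by (simp add: mult.assoc)
      also have "\<dots> \<le> 2 * (q * vnorm Y z)"
        using q mult_right_mono[of q 1 "q * vnorm Y z"] by simp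
      finally show "vnorm Y (F ?e z) \<le> q * vnorm Y z"
        using z by (simp add: F_def vnorm_scale)
    qed
    moreover have "W (F ?e z) = F ?e (W z)" if z: "z \<in> carrier Y" for z
      by (rule vector_eqI)
        (use z e in \<open>simp_all add: F_def rinner_adjoint_right[OF W'] rinner_right_simps W(2) flip: e(4)\<close>)
    ultimately show ?case by (simp add: e_simps)
  qed
  have ec: "e n \<in> compacts Y" and ea [simp]: "e n \<in> adjointables Y" and eh: "adjoint Y (e n) = e n"
    and en: "op_norm_le Y (e n) q" and ew: "z \<in> carrier Y \<Longrightarrow> W (e n z) = e n (W z)" for n z
    using ind[of n] by auto
  \<comment> \<open>The bound \<open>k\<close> for \<open>S\<close> is separate from
    \<open>q\<close>: it is \<open>q\<close> when \<open>S\<close> is an iterate, and the larger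
    \<open>K\<close> when \<open>S\<close> is the limit \<open>E\<close>, whose boundedness comes
    only from compactness.\<close>
  have F_dist: "op_dist_le Y (F S) (F T) ((k + q) / 2 * d)"
    if ST: "S \<in> adjointables Y" "T \<in> adjointables Y" and "op_dist_le Y S T d" "op_norm_le Y S k" "op_norm_le Y T q"
      "0 \<le> d" "0 \<le> k" for S T k d
  proof -
    have "op_dist_le Y (op_comp Y S S) (op_comp Y T T) (k * d + d * q)"
      by (rule op_dist_le_trans[OF _ _ _ op_dist_le_comp_left[OF _ _ _ that(3,4)] op_dist_le_comp_right[OF _ that(3,5)]])
        (use that in \<open>simp_all add: op_adjointable\<close>)
    hence "op_dist_le Y (F S) (F T) (cmod (1/2) * (0 + (k * d + d * q)))"
      unfolding F_def
      by (intro op_dist_le_scale op_dist_le_add op_dist_le_refl op_adjointable ST W') auto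
    thus ?thesis by (simp add: algebra_simps add_divide_distrib norm_divide)
  qed
  have step: "op_dist_le Y (e (Suc n)) (e n) (q ^ n)" for n
  proof (induction n)
    case 0
    have "vminus Y (e 1 z) (e 0 z) = e 1 z" if "z \<in> carrier Y" for z
      by (rule vector_eqI) (use that ea[of 1] in \<open>simp_all add: e_simps(1) rinner_right_simps\<close>)
    hence "op_dist_le Y (e 1) (e 0) q" using en[of 1] by (simp add: op_dist_le_def op_norm_le_def)
    thus ?case using q by (auto elim: op_dist_le_mono)
  next
    case (Suc n)
    have "op_dist_le Y (F (e (Suc n))) (F (e n)) ((q + q) / 2 * q ^ n)"
      using q by (intro F_dist ea Suc en) auto
    thus ?case by (simp add: e_simps)
  qed
  \<comment> \<open>The tail of the geometric series of the step sizes, which bounds the distance to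
    all later iterates.\<close>
  define \<delta> where "\<delta> = (\<lambda>n. q ^ n / (1 - q))"
  have \<delta>_Suc: "\<delta> n = q ^ n + \<delta> (Suc n)" for n
    using q by (simp add: \<delta>_def field_simps)
  have \<delta>_nonneg: "0 \<le> \<delta> n" for n using q by (simp add: \<delta>_def)
  have close: "op_dist_le Y (e (n + k)) (e n) (\<delta> n)" for n k
  proof (induction k arbitrary: n)
    case 0
    show ?case using \<delta>_nonneg by (simp add: op_dist_le_refl)
  next
    case (Suc k)
    have "op_dist_le Y (e (Suc n + k)) (e n) (\<delta> (Suc n) + q ^ n)"
      by (rule op_dist_le_trans[OF _ _ _ Suc.IH step]) simp_all
    thus ?case by (subst \<delta>_Suc) (simp add: add.commute)
  qed
  have \<delta>0: "\<delta> \<longlonglongrightarrow> 0"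
    unfolding \<delta>_def using q by (intro real_tendsto_divide_at_top LIMSEQ_power_zero tendsto_divide_zero) auto
  obtain E where E: "E \<in> adjointables Y" "adjoint Y E = E" "\<And>n. op_dist_le Y E (e n) (\<delta> n)"
    using adjointable_seq_limit[of e \<delta>, OF ea eh close \<delta>0] by blast
  have small: "\<exists>n. \<delta> n * K < c" if "c > 0" for c K
  proof -
    have "(\<lambda>n. \<delta> n * K) \<longlonglongrightarrow> 0" using tendsto_mult_right[OF \<delta>0, of K] by simp
    hence "\<forall>\<^sub>F n in sequentially. \<delta> n * K < c" using that by (rule order_tendstoD)
    thus ?thesis by (auto simp: eventually_sequentially)
  qed
  have Ec: "E \<in> compacts Y"
  proof (rule compacts_closed[OF E(1)])
    fix c :: real assume "c > 0"
    from small[OF this, of 1] obtain n where "\<delta> n < c" by auto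
    thus "\<exists>T\<in>compacts Y. op_dist_le Y E T c" using ec E(3)[of n] op_dist_le_mono by (metis less_imp_le)
  qed
  obtain K where K: "0 < K" "op_norm_le Y E K" using compacts_bounded[OF Ec] .
  have comm: "op_comp Y W E = op_comp Y E W"
  proof (rule op_eq_if_dist_small)
    fix c :: real assume "c > 0"
    from small[OF this, of "q + q"] obtain n where n: "\<delta> n * (q + q) < c" by auto
    have eq: "op_comp Y W (e n) = op_comp Y (e n) W"
      by (rule op_eqI) (use ew[of _ n] in \<open>auto intro!: adjointable_funcset op_adjointable\<close>)
    have "op_dist_le Y (op_comp Y W E) (op_comp Y W (e n)) (q * \<delta> n)"
      using q by (intro op_dist_le_comp_left E ea W') auto
    moreover have "op_dist_le Y (op_comp Y (e n) W) (op_comp Y E W) (\<delta> n * q)"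
      using q \<delta>_nonneg E(3) by (intro op_dist_le_comp_right W' op_dist_le_sym[of E]) (auto simp: E)
    ultimately have "op_dist_le Y (op_comp Y W E) (op_comp Y E W) (q * \<delta> n + \<delta> n * q)"
      unfolding eq by (intro op_dist_le_trans[where T = "op_comp Y (e n) W"]) (auto simp: op_adjointable E)
    thus "op_dist_le Y (op_comp Y W E) (op_comp Y E W) c"
      by (rule op_dist_le_mono) (use n in \<open>simp add: algebra_simps\<close>)
  qed (simp_all add: op_adjointable E)
  have "E = F E"
  proof (rule op_eq_if_dist_small)
    fix c :: real assume "c > 0"
    from small[OF this, of "1 + (K + q) / 2"] obtain n where n: "\<delta> n * (1 + (K + q) / 2) < c" by auto
    have "\<delta> (Suc n) \<le> \<delta> n" using \<delta>_Suc[of n] q by simp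
    hence "op_dist_le Y E (F (e n)) (\<delta> n)"
      using E(3)[of "Suc n"] by (auto simp: e_simps elim: op_dist_le_mono)
    moreover have "op_dist_le Y (F E) (F (e n)) ((K + q) / 2 * \<delta> n)"
      using K by (intro F_dist E ea en \<delta>_nonneg) auto
    hence "op_dist_le Y (F (e n)) (F E) ((K + q) / 2 * \<delta> n)"
      by (rule op_dist_le_sym[OF F_adj[OF E(1)] F_adj[OF ea]])
    ultimately have "op_dist_le Y E (F E) (\<delta> n + (K + q) / 2 * \<delta> n)"
      by (intro op_dist_le_trans[of E "F (e n)" "F E"] F_adj E ea)
    thus "op_dist_le Y E (F E) c"
      by (rule op_dist_le_mono) (use n in \<open>simp add: algebra_simps\<close>)
  qed (simp_all add: F_adj E)
  have "op_add Y E E = op_add Y (op_comp Y W W) (op_comp Y E E)"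
  proof (rule op_eqI)
    fix w z assume wz: "w \<in> carrier Y" "z \<in> carrier Y"
    have "rinner Y w (E z) = rinner Y w (F E z)" using \<open>E = F E\<close> by simp
    also have "\<dots> = (1/2) *\<^sub>C (rinner Y w (W (W z)) + rinner Y w (E (E z)))"
      using wz E by (simp add: F_def rinner_right_simps)
    finally have "rinner Y w (E z) = (1/2) *\<^sub>R (rinner Y w (W (W z)) + rinner Y w (E (E z)))"
      by (simp add: scaleR_scaleC)
    hence "2 *\<^sub>R rinner Y w (E z) = rinner Y w (W (W z)) + rinner Y w (E (E z))" by simp
    thus "rinner Y w (op_add Y E E z) = rinner Y w (op_add Y (op_comp Y W W) (op_comp Y E E) z)"
      using wz E by (simp add: rinner_right_simps scaleR_2)
  qed (auto intro!: adjointable_funcset op_adjointable E)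
  thus ?thesis using that Ec E comm by blast
qed

end


section \<open>The induced representation of the compact operators\<close>

text \<open>The part of a Toeplitz representation visible on one fibre, with \<open>\<rho>\<close>
  in the role of \<open>\<psi>\<close> on the coefficient algebra.\<close>

locale toeplitz_module = hilbert_module Y + rho: star_homomorphism \<rho>
  for Y :: "('a::cstar_algebra, 'x, 'z) hilbert_module_scheme" (structure)
    and \<rho> :: "'a \<Rightarrow> 'b::cstar_algebra" +
  fixes \<psi> :: "'x \<Rightarrow> 'b"
  assumes psi_add: "\<lbrakk>x \<in> carrier Y; y \<in> carrier Y\<rbrakk> \<Longrightarrow> \<psi> (x \<oplus> y) = \<psi> x + \<psi> y"
    and psi_scale: "x \<in> carrier Y \<Longrightarrow> \<psi> (c \<odot> x) = c *\<^sub>C \<psi> x"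
    and psi_ract: "x \<in> carrier Y \<Longrightarrow> \<psi> (ract Y x a) = \<psi> x * \<rho> a"
    and psi_inner: "\<lbrakk>x \<in> carrier Y; y \<in> carrier Y\<rbrakk> \<Longrightarrow> star (\<psi> x) * \<psi> y = \<rho> (rinner Y x y)"
begin

definition fin_rep :: "('x \<times> 'x) list \<Rightarrow> 'b" where
  "fin_rep L = (\<Sum>(x, y)\<leftarrow>L. \<psi> x * star (\<psi> y))"

lemma fin_rep_simps [simp]:
  "fin_rep [] = 0" "fin_rep ((x, y) # L) = \<psi> x * star (\<psi> y) + fin_rep L"
  "fin_rep (L @ M) = fin_rep L + fin_rep M"
  by (simp_all add: fin_rep_def)

lemma psi_zero: "\<psi> \<zero> = 0"
  using psi_add[of \<zero> \<zero>] by (simp add: add_zero)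

lemma norm_psi: "x \<in> carrier Y \<Longrightarrow> norm (\<psi> x) \<le> vnorm Y x"
proof (rule power2_le_imp_le)
  assume x: "x \<in> carrier Y"
  have "(norm (\<psi> x))\<^sup>2 = norm (\<rho> (rinner Y x x))" using x by (simp add: psi_inner flip: cstar_identity)
  thus "(norm (\<psi> x))\<^sup>2 \<le> (vnorm Y x)\<^sup>2" by (simp add: vnorm_power2 rho.contractive)
qed simp

lemma fin_rep_mult_psi: "L \<in> vec_pairs Y \<Longrightarrow> z \<in> carrier Y \<Longrightarrow> fin_rep L * \<psi> z = \<psi> (fin_op Y L z)"
proof (induction rule: vec_pairs_induct)
  case (Cons x y L)
  thus ?case
    by (simp add: fin_op_Cons psi_add psi_ract distrib_right mult.assoc psi_inner)
qed (simp add: fin_op_Nil psi_zero)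

lemma star_fin_rep: "star (fin_rep L) = fin_rep (map prod.swap L)"
  by (induction L) (auto simp: star_add star_mult)

lemma fin_rep_scale: "L \<in> vec_pairs Y \<Longrightarrow> fin_rep (map (\<lambda>(x, y). (c \<odot> x, y)) L) = c *\<^sub>C fin_rep L"
  by (induction rule: vec_pairs_induct) (auto simp: psi_scale scaleC_add_right mult_scaleC_left)

lemma fin_rep_mult:
  assumes L: "L \<in> vec_pairs Y" and M: "M \<in> vec_pairs Y"
  shows "fin_rep L * fin_rep M = fin_rep (map (\<lambda>(x, y). (fin_op Y L x, y)) M)"
  using M by (induction rule: vec_pairs_induct) (auto simp: distrib_left fin_rep_mult_psi[OF L] simp flip: mult.assoc)

section \<open>Norm estimate on finite rank operators\<close>

lemma norm_fin_rep_le_hermitian: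
  assumes L: "L \<in> vec_pairs Y" "star (fin_rep L) = fin_rep L"
    and \<kappa>: "op_norm_le Y (fin_op Y L) \<kappa>" "0 < \<kappa>"
  shows "norm (fin_rep L) \<le> \<kappa>"
proof (rule le_if_powers_le[OF \<kappa>(2)])
  define M where "M = (\<lambda>n. map (\<lambda>(x, y). ((fin_op Y L ^^ n) x, y)) L)"
  define C where "C = (\<Sum>(x, y)\<leftarrow>L. vnorm Y x * vnorm Y y)"
  have it: "(fin_op Y L ^^ n) x \<in> carrier Y" "vnorm Y ((fin_op Y L ^^ n) x) \<le> \<kappa> ^ n * vnorm Y x"
    if "x \<in> carrier Y" for n x
  proof (induction n)
    case (Suc n)
    show "(fin_op Y L ^^ Suc n) x \<in> carrier Y" using Suc L by simp
    have "vnorm Y (fin_op Y L ((fin_op Y L ^^ n) x)) \<le> \<kappa> * vnorm Y ((fin_op Y L ^^ n) x)"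
      using \<kappa>(1) Suc(1) by (rule op_norm_leD)
    also have "\<dots> \<le> \<kappa> * (\<kappa> ^ n * vnorm Y x)" using Suc(2) \<kappa>(2) by (intro mult_left_mono) auto
    finally show "vnorm Y ((fin_op Y L ^^ Suc n) x) \<le> \<kappa> ^ Suc n * vnorm Y x" by (simp add: mult.assoc)
  qed (use that in auto)
  have M: "M n \<in> vec_pairs Y" for n
    using L(1) it(1) unfolding M_def vec_pairs_def by fastforce
  \<comment> \<open>Powers need a unit and are therefore taken among multipliers. The index is
    shifted: \<open>M n\<close> presents the power of exponent \<open>n + 1\<close>.\<close>
  have pow: "left_multiplier (fin_rep L) ^ Suc n = left_multiplier (fin_rep (M n))" for n
  proof (induction n)
    case 0
    show ?case by (simp add: M_def)
  next
    case (Suc n)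
    have "map (\<lambda>(x, y). (fin_op Y L x, y)) (M n) = M (Suc n)" by (auto simp: M_def)
    hence "fin_rep L * fin_rep (M n) = fin_rep (M (Suc n))" using L(1) M by (simp add: fin_rep_mult)
    thus ?case using Suc by (simp flip: left_multiplier_mult)
  qed
  have C: "norm (fin_rep (M n)) \<le> \<kappa> ^ n * C" for n
  proof -
    have "norm (fin_rep (map (\<lambda>(x, y). ((fin_op Y L ^^ n) x, y)) K)) \<le> \<kappa> ^ n * (\<Sum>(x, y)\<leftarrow>K. vnorm Y x * vnorm Y y)"
      if "K \<in> vec_pairs Y" for K
      using that
    proof (induction rule: vec_pairs_induct)
      case (Cons x y K)
      have "norm (\<psi> ((fin_op Y L ^^ n) x) * star (\<psi> y)) \<le> (\<kappa> ^ n * vnorm Y x) * vnorm Y y"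
        using Cons it[OF Cons(1)] \<kappa>(2)
        by (intro order_trans[OF norm_mult_ineq] mult_mono) (auto intro: norm_psi order_trans[OF norm_psi])
      thus ?case using Cons.IH by (auto simp: distrib_left mult.assoc intro: norm_triangle_mono)
    qed simp
    thus ?thesis using L(1) by (simp add: M_def C_def)
  qed
  have C0: "0 \<le> C" unfolding C_def by (rule sum_list_nonneg) auto
  fix m :: nat
  obtain n where n: "2 ^ m = Suc n" by (metis gr0_implies_Suc zero_less_numeral zero_less_power)
  have "star (left_multiplier (fin_rep L)) = left_multiplier (fin_rep L)"
    using L(2) by (simp flip: left_multiplier_star)
  hence "norm (fin_rep L) ^ (2 ^ m) = norm (left_multiplier (fin_rep L) ^ (2 ^ m))"
    by (simp add: norm_power_hermitian)
  also have "\<dots> \<le> \<kappa> ^ n * C" unfolding n pow using C by simp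
  \<comment> \<open>As \<open>2 ^ m = n + 1\<close>, one factor \<open>\<kappa>\<close> is missing
    and is moved into the constant. The harmless factor \<open>2 ^ m\<close> then brings the bound
    into the shape of \<open>le_if_powers_le\<close>.\<close>
  also have "\<dots> = (C / \<kappa>) * 1 * \<kappa> ^ (2 ^ m)" using \<kappa>(2) by (simp add: n)
  also have "\<dots> \<le> (C / \<kappa>) * 2 ^ m * \<kappa> ^ (2 ^ m)"
    using \<kappa>(2) C0 by (intro mult_right_mono mult_left_mono) auto
  finally show "norm (fin_rep L) ^ (2 ^ m) \<le> (C / \<kappa>) * 2 ^ m * \<kappa> ^ (2 ^ m)" .
qed

text \<open>Multiplying by the adjoint reduces to the self-adjoint case with bound
  \<open>\<kappa> * \<kappa>\<close>.\<close>

lemma norm_fin_rep_le: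
  assumes L: "L \<in> vec_pairs Y" and \<kappa>: "op_norm_le Y (fin_op Y L) \<kappa>" "0 < \<kappa>"
  shows "norm (fin_rep L) \<le> \<kappa>"
proof -
  define M where "M = map (\<lambda>(x, y). (fin_op Y L x, y)) (map prod.swap L)"
  have L': "map prod.swap L \<in> vec_pairs Y" using L by simp
  have M: "M \<in> vec_pairs Y" "fin_op Y M = op_comp Y (fin_op Y L) (adjoint Y (fin_op Y L))"
    unfolding M_def using L fin_op_comp_left[OF fin_op_adjointable[OF L] L']
    by (simp_all add: adjoint_fin_op)
  have M_rep: "fin_rep M = fin_rep L * star (fin_rep L)"
    unfolding M_def using L by (simp add: fin_rep_mult star_fin_rep)
  have "norm (fin_rep M) \<le> \<kappa> * \<kappa>"
  proof (rule norm_fin_rep_le_hermitian)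
    show "op_norm_le Y (fin_op Y M) (\<kappa> * \<kappa>)" unfolding M(2)
      using L \<kappa> by (intro op_norm_le_comp op_norm_le_adjoint) auto
  qed (use M(1) \<kappa> in \<open>auto simp: M_rep star_mult\<close>)
  hence "(norm (fin_rep L))\<^sup>2 \<le> \<kappa>\<^sup>2" by (simp add: M_rep norm_mult_star power2_eq_square)
  thus ?thesis using \<kappa> by (simp add: power2_le_iff_abs_le)
qed

text \<open>As \<open>\<kappa>\<close> may be arbitrarily small for equal operators,
  \<open>fin_rep\<close> does not depend on the presentation; it also extends by continuity.\<close>

lemma norm_fin_rep_diff_le:
  assumes L: "L \<in> vec_pairs Y" "M \<in> vec_pairs Y"
    and d: "op_dist_le Y (fin_op Y L) (fin_op Y M) \<kappa>" "0 < \<kappa>"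
  shows "norm (fin_rep L - fin_rep M) \<le> \<kappa>"
proof -
  define N where "N = L @ map (\<lambda>(x, y). ((-1) \<odot> x, y)) M"
  have N: "N \<in> vec_pairs Y" using L fin_op_scale(1) by (simp add: N_def)
  have "fin_op Y N z = vminus Y (fin_op Y L z) (fin_op Y M z)" if "z \<in> carrier Y" for z
    using L that fin_op_scale[of M "-1"] by (simp add: N_def fin_op_append vminus_def)
  hence "op_norm_le Y (fin_op Y N) \<kappa>" using d by (simp add: op_norm_le_def op_dist_le_def)
  hence "norm (fin_rep N) \<le> \<kappa>" using N d by (intro norm_fin_rep_le)
  thus ?thesis using L by (simp add: N_def fin_rep_scale)
qed

text \<open>The graph of the homomorphism on the compact operators induced by \<open>\<psi>\<close>.\<close>

definition rep_rel :: "('x \<Rightarrow> 'x) \<Rightarrow> 'b \<Rightarrow> bool" where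
  "rep_rel S b \<longleftrightarrow> (\<forall>\<epsilon>>0. \<exists>L\<in>vec_pairs Y. op_dist_le Y S (fin_op Y L) \<epsilon> \<and> norm (fin_rep L - b) \<le> \<epsilon>)"

lemma rep_relE:
  assumes "rep_rel S b" "0 < \<epsilon>"
  obtains L where "L \<in> vec_pairs Y" "op_dist_le Y S (fin_op Y L) \<epsilon>" "norm (fin_rep L - b) \<le> \<epsilon>"
  using assms by (auto simp: rep_rel_def)

lemma rep_relI:
  assumes "0 < K" "\<And>\<epsilon>. 0 < \<epsilon> \<Longrightarrow> \<exists>L\<in>vec_pairs Y. op_dist_le Y S (fin_op Y L) (K * \<epsilon>) \<and> norm (fin_rep L - b) \<le> K * \<epsilon>"
  shows "rep_rel S b"
  unfolding rep_rel_def
proof (intro allI impI)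
  fix \<epsilon> :: real assume "0 < \<epsilon>"
  thus "\<exists>L\<in>vec_pairs Y. op_dist_le Y S (fin_op Y L) \<epsilon> \<and> norm (fin_rep L - b) \<le> \<epsilon>"
    using assms(2)[of "\<epsilon> / K"] assms(1) by simp
qed

lemma rep_rel_fin: "L \<in> vec_pairs Y \<Longrightarrow> rep_rel (fin_op Y L) (fin_rep L)"
  unfolding rep_rel_def by (auto intro!: bexI[of _ L] op_dist_le_refl)

lemma rep_rel_norm_le:
  assumes S: "S \<in> compacts Y" "rep_rel S b" "op_norm_le Y S \<kappa>" "0 \<le> \<kappa>"
  shows "norm b \<le> \<kappa>"
proof (rule field_le_epsilon)
  fix e :: real assume "0 < e"
  hence e: "0 < e / 2" by simp
  obtain L where L: "L \<in> vec_pairs Y" "op_dist_le Y S (fin_op Y L) (e / 2)" "norm (fin_rep L - b) \<le> e / 2"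
    using rep_relE[OF S(2) e] .
  have "op_dist_le Y (fin_op Y L) S (e / 2)" by (rule op_dist_le_sym[OF _ _ L(2)]) (use L S in auto)
  hence "op_norm_le Y (fin_op Y L) (e / 2 + \<kappa>)" using L S by (intro op_norm_le_of_dist[of "fin_op Y L" S]) auto
  hence "norm (fin_rep L) \<le> e / 2 + \<kappa>" using L e S(4) by (intro norm_fin_rep_le) auto
  moreover have "norm b \<le> norm (fin_rep L) + norm (fin_rep L - b)"
    by (metis add.commute diff_add_cancel norm_minus_commute norm_triangle_ineq)
  ultimately show "norm b \<le> \<kappa> + e" using L(3) by simp
qed

lemma rep_rel_unique:
  assumes S: "S \<in> compacts Y" and b: "rep_rel S b" "rep_rel S b'" shows "b = b'"
proof -
  have "norm (b - b') \<le> 0"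
  proof (rule field_le_epsilon)
    fix e :: real assume "0 < e"
    hence e: "0 < e / 4" by simp
    obtain L where L: "L \<in> vec_pairs Y" "op_dist_le Y S (fin_op Y L) (e / 4)" "norm (fin_rep L - b) \<le> e / 4"
      using rep_relE[OF b(1) e] .
    obtain M where M: "M \<in> vec_pairs Y" "op_dist_le Y S (fin_op Y M) (e / 4)" "norm (fin_rep M - b') \<le> e / 4"
      using rep_relE[OF b(2) e] .
    have "op_dist_le Y (fin_op Y L) (fin_op Y M) (e / 4 + e / 4)"
      by (rule op_dist_le_trans[of _ S]) (use S L M in \<open>auto intro: op_dist_le_sym\<close>)
    hence "norm (fin_rep L - fin_rep M) \<le> e / 4 + e / 4"
      using L M e by (intro norm_fin_rep_diff_le) auto
    moreover have "b - b' = (fin_rep L - fin_rep M) - (fin_rep L - b) + (fin_rep M - b')" by simp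
    hence "norm (b - b') \<le> norm (fin_rep L - fin_rep M) + norm (fin_rep L - b) + norm (fin_rep M - b')"
      by (metis norm_triangle_le norm_triangle_ineq4 add_right_mono)
    ultimately show "norm (b - b') \<le> 0 + e" using L(3) M(3) by linarith
  qed
  thus ?thesis by simp
qed

text \<open>Presentations approximating \<open>S\<close> up to \<open>1 / Suc n\<close> have Cauchy
  images by \<open>norm_fin_rep_diff_le\<close>, and the algebra is complete.\<close>

lemma rep_rel_exists:
  assumes S: "S \<in> compacts Y" shows "\<exists>b. rep_rel S b"
proof -
  have "\<exists>L\<in>vec_pairs Y. op_dist_le Y S (fin_op Y L) (1 / Suc n)" for n
    using compactsE[OF S, of "1 / Suc n"] by auto
  then obtain L where L: "\<And>n. L n \<in> vec_pairs Y" "\<And>n. op_dist_le Y S (fin_op Y (L n)) (1 / Suc n)"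
    by metis
  have diff: "norm (fin_rep (L m) - fin_rep (L n)) \<le> 1 / Suc m + 1 / Suc n" for m n
  proof (rule norm_fin_rep_diff_le)
    show "op_dist_le Y (fin_op Y (L m)) (fin_op Y (L n)) (1 / Suc m + 1 / Suc n)"
      by (rule op_dist_le_trans[of _ S]) (use S L in \<open>auto intro: op_dist_le_sym\<close>)
  qed (use L in \<open>auto intro: add_pos_pos\<close>)
  have "Cauchy (\<lambda>n. fin_rep (L n))"
  proof (rule metric_CauchyI)
    fix e :: real assume "0 < e"
    then obtain N where N: "1 / Suc N < e / 2" using nat_approx_posE[of "e / 2"] by auto
    have "dist (fin_rep (L m)) (fin_rep (L n)) < e" if "N \<le> m" "N \<le> n" for m n
    proof -
      have "1 / Suc m \<le> 1 / Suc N" "1 / Suc n \<le> 1 / Suc N" using that by (auto simp: field_simps)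
      thus ?thesis using diff[of m n] N unfolding dist_norm by linarith
    qed
    thus "\<exists>N. \<forall>m\<ge>N. \<forall>n\<ge>N. dist (fin_rep (L m)) (fin_rep (L n)) < e" by blast
  qed
  then obtain b where b: "(\<lambda>n. fin_rep (L n)) \<longlonglongrightarrow> b" using Cauchy_convergent convergent_def by blast
  have "rep_rel S b" unfolding rep_rel_def
  proof (intro allI impI)
    fix \<epsilon> :: real assume "0 < \<epsilon>"
    then obtain N where N: "1 / Suc N < \<epsilon>" using nat_approx_posE by blast
    from b \<open>0 < \<epsilon>\<close> obtain N' where N': "\<And>n. n \<ge> N' \<Longrightarrow> norm (fin_rep (L n) - b) < \<epsilon>"
      unfolding LIMSEQ_iff by blast
    define n where "n = max N N'"
    have "1 / Suc n \<le> 1 / Suc N" by (auto simp: n_def field_simps)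
    hence "op_dist_le Y S (fin_op Y (L n)) \<epsilon>" using N by (intro op_dist_le_mono[OF L(2)]) linarith
    thus "\<exists>L\<in>vec_pairs Y. op_dist_le Y S (fin_op Y L) \<epsilon> \<and> norm (fin_rep L - b) \<le> \<epsilon>"
      using L(1) N'[of n] by (intro bexI[of _ "L n"]) (auto simp: n_def)
  qed
  thus ?thesis ..
qed

lemma rep_rel_add:
  assumes ST: "S \<in> compacts Y" "T \<in> compacts Y" and b: "rep_rel S b" "rep_rel T c"
  shows "rep_rel (op_add Y S T) (b + c)"
proof (rule rep_relI)
  fix e :: real assume e: "0 < e"
  obtain L where L: "L \<in> vec_pairs Y" "op_dist_le Y S (fin_op Y L) e" "norm (fin_rep L - b) \<le> e"
    using rep_relE[OF b(1) e] .
  obtain M where M: "M \<in> vec_pairs Y" "op_dist_le Y T (fin_op Y M) e" "norm (fin_rep M - c) \<le> e"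
    using rep_relE[OF b(2) e] .
  have "op_dist_le Y (op_add Y S T) (fin_op Y (L @ M)) (e + e)"
    unfolding fin_op_append[OF L(1) M(1)] using ST L M by (intro op_dist_le_add) auto
  moreover have "norm ((fin_rep L - b) + (fin_rep M - c)) \<le> e + e" using L M by (intro norm_triangle_mono)
  ultimately show "\<exists>L\<in>vec_pairs Y. op_dist_le Y (op_add Y S T) (fin_op Y L) (2 * e) \<and> norm (fin_rep L - (b + c)) \<le> 2 * e"
    using L M by (intro bexI[of _ "L @ M"]) (auto simp: algebra_simps)
qed simp

lemma rep_rel_scale:
  assumes S: "S \<in> compacts Y" and b: "rep_rel S b"
  shows "rep_rel (op_scale Y c S) (c *\<^sub>C b)"
proof (rule rep_relI)
  show "0 < cmod c + 1" by (simp add: add_nonneg_pos)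
  fix e :: real assume e: "0 < e"
  obtain L where L: "L \<in> vec_pairs Y" "op_dist_le Y S (fin_op Y L) e" "norm (fin_rep L - b) \<le> e"
    using rep_relE[OF b(1) e] .
  let ?M = "map (\<lambda>(x, y). (c \<odot> x, y)) L"
  have le: "cmod c * e \<le> (cmod c + 1) * e" using e by simp
  have "op_dist_le Y (op_scale Y c S) (op_scale Y c (fin_op Y L)) (cmod c * e)"
    using S L by (intro op_dist_le_scale) auto
  hence "op_dist_le Y (op_scale Y c S) (fin_op Y ?M) ((cmod c + 1) * e)"
    using L(1) le by (auto simp: fin_op_scale elim: op_dist_le_mono)
  moreover have "norm (fin_rep ?M - c *\<^sub>C b) = cmod c * norm (fin_rep L - b)"
    using L(1) by (simp add: fin_rep_scale norm_scaleC flip: scaleC_diff_right)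
  hence "norm (fin_rep ?M - c *\<^sub>C b) \<le> (cmod c + 1) * e"
    using le L(3) mult_left_mono[of "norm (fin_rep L - b)" e "cmod c"] by simp
  ultimately show "\<exists>L\<in>vec_pairs Y. op_dist_le Y (op_scale Y c S) (fin_op Y L) ((cmod c + 1) * e)
      \<and> norm (fin_rep L - c *\<^sub>C b) \<le> (cmod c + 1) * e"
    using fin_op_scale(1)[OF L(1)] by blast
qed

lemma rep_rel_comp:
  assumes ST: "S \<in> compacts Y" "T \<in> compacts Y" and b: "rep_rel S b" "rep_rel T c"
  shows "rep_rel (op_comp Y S T) (b * c)"
proof -
  obtain k where k: "0 < k" "op_norm_le Y S k" using compacts_bounded[OF ST(1)] .
  obtain l where l: "0 < l" "op_norm_le Y T l" using compacts_bounded[OF ST(2)] .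
  show ?thesis
  proof (rule rep_relI)
    define K where "K = k + l + 1"
    show "0 < K" using k l by (simp add: K_def)
    fix e' :: real assume e': "0 < e'"
    \<comment> \<open>Capping at 1 keeps the bound \<open>e + k\<close> on the approximants below
      \<open>k + 1\<close>, so that \<open>K\<close> can be fixed before \<open>e'\<close>.\<close>
    define e where "e = min e' 1"
    have e: "0 < e" "e \<le> e'" "e \<le> 1" using e' by (simp_all add: e_def)
    obtain L where L: "L \<in> vec_pairs Y" "op_dist_le Y S (fin_op Y L) e" "norm (fin_rep L - b) \<le> e"
      using rep_relE[OF b(1) e(1)] .
    obtain M where M: "M \<in> vec_pairs Y" "op_dist_le Y T (fin_op Y M) e" "norm (fin_rep M - c) \<le> e"
      using rep_relE[OF b(2) e(1)] .
    define N where "N = map (\<lambda>(x, y). (fin_op Y L x, y)) M"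
    have N: "N \<in> vec_pairs Y" "fin_op Y N = op_comp Y (fin_op Y L) (fin_op Y M)"
      unfolding N_def using fin_op_comp_left[OF fin_op_adjointable[OF L(1)] M(1)] by auto
    have "op_dist_le Y (fin_op Y L) S e" by (rule op_dist_le_sym[OF _ _ L(2)]) (use L ST in auto)
    hence Lk: "op_norm_le Y (fin_op Y L) (e + k)"
      using L ST k by (intro op_norm_le_of_dist[of "fin_op Y L" S]) auto
    have bound: "e * l + (e + k) * e \<le> K * e'"
    proof -
      have "e * l + (e + k) * e = (l + k + e) * e" by (simp add: algebra_simps)
      also have "\<dots> \<le> K * e'" using e k l by (intro mult_mono) (auto simp: K_def)
      finally show ?thesis .
    qed
    have "op_dist_le Y (op_comp Y S T) (fin_op Y N) (e * l + (e + k) * e)"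
      unfolding N(2)
      by (rule op_dist_le_trans[OF _ _ _ op_dist_le_comp_right[OF _ L(2) l(2)] op_dist_le_comp_left[OF _ _ _ M(2) Lk]])
        (use ST L M e k op_adjointable in simp_all)
    hence "op_dist_le Y (op_comp Y S T) (fin_op Y N) (K * e')" using bound by (rule op_dist_le_mono)
    moreover have "norm (fin_rep N - b * c) \<le> K * e'"
    proof -
      have "norm (fin_rep L) \<le> e + k" using L(1) Lk e k by (intro norm_fin_rep_le) auto
      moreover have "norm c \<le> l" using rep_rel_norm_le[OF ST(2) b(2) l(2)] l by simp
      moreover have "fin_rep N - b * c = (fin_rep L - b) * c + fin_rep L * (fin_rep M - c)"
        unfolding N_def using L(1) M(1) by (simp add: algebra_simps flip: fin_rep_mult)
      hence "norm (fin_rep N - b * c) \<le> norm (fin_rep L - b) * norm c + norm (fin_rep L) * norm (fin_rep M - c)"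
        by (metis norm_triangle_mono norm_mult_ineq)
      ultimately have "norm (fin_rep N - b * c) \<le> e * l + (e + k) * e"
        using L(3) M(3) e k l mult_mono[of "norm (fin_rep L - b)" e "norm c" l]
          mult_mono[of "norm (fin_rep L)" "e + k" "norm (fin_rep M - c)" e] by simp
      thus ?thesis using bound by linarith
    qed
    ultimately show "\<exists>L\<in>vec_pairs Y. op_dist_le Y (op_comp Y S T) (fin_op Y L) (K * e') \<and> norm (fin_rep L - b * c) \<le> K * e'"
      using N(1) by blast
  qed
qed

lemma rep_rel_adjoint:
  assumes S: "S \<in> compacts Y" and b: "rep_rel S b"
  shows "rep_rel (adjoint Y S) (star b)"
  unfolding rep_rel_def
proof (intro allI impI)
  fix e :: real assume e: "0 < e"
  obtain L where L: "L \<in> vec_pairs Y" "op_dist_le Y S (fin_op Y L) e" "norm (fin_rep L - b) \<le> e"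
    using rep_relE[OF b(1) e] .
  have "op_dist_le Y (adjoint Y S) (adjoint Y (fin_op Y L)) e" using S L by (intro op_dist_le_adjoint) auto
  moreover have "norm (star (fin_rep L) - star b) \<le> e" using L(3) by (simp flip: star_diff)
  ultimately show "\<exists>L\<in>vec_pairs Y. op_dist_le Y (adjoint Y S) (fin_op Y L) e \<and> norm (fin_rep L - star b) \<le> e"
    using L(1) by (intro bexI[of _ "map prod.swap L"]) (simp_all add: adjoint_fin_op star_fin_rep)
qed

text \<open>The restriction makes the function extensional, without which the definite description
  in \<open>rep_compacts\<close> could not single it out.\<close>

definition induced_rep :: "('x \<Rightarrow> 'x) \<Rightarrow> 'b" where
  "induced_rep = (\<lambda>S\<in>compacts Y. THE b. rep_rel S b)"

lemma induced_rep_eq: "S \<in> compacts Y \<Longrightarrow> rep_rel S b \<Longrightarrow> induced_rep S = b"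
  unfolding induced_rep_def using rep_rel_unique by (auto intro: the_equality)

lemma induced_rep_rel: "S \<in> compacts Y \<Longrightarrow> rep_rel S (induced_rep S)"
  using rep_rel_exists induced_rep_eq by metis

lemma compacts_homomorphism_induced_rep: "compacts_homomorphism Y induced_rep"
proof -
  have "induced_rep \<in> extensional (compacts Y)" by (simp add: induced_rep_def)
  thus ?thesis unfolding compacts_homomorphism_def
    by (auto intro!: induced_rep_eq op_add_compact op_scale_compact op_comp_compact adjoint_compact
        rep_rel_add rep_rel_scale rep_rel_comp rep_rel_adjoint induced_rep_rel)
qed

lemma induced_rep_rank_one:
  assumes "x \<in> carrier Y" "y \<in> carrier Y" shows "induced_rep (rank_one Y x y) = \<psi> x * star (\<psi> y)"
proof -
  have L: "[(x, y)] \<in> vec_pairs Y" using assms by simp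
  have "induced_rep (fin_op Y [(x, y)]) = fin_rep [(x, y)]"
    by (intro induced_rep_eq rep_rel_fin fin_op_compact L)
  thus ?thesis using assms by (simp add: rank_one_eq_fin_op)
qed

end

text \<open>The argument for homomorphisms of algebras, repeated on the carrier of compact
  operators. It is essential that the auxiliary \<open>E\<close> is compact itself, so that
  \<open>\<pi>\<close> can be applied to it.\<close>

lemma (in hilbert_module) compacts_homomorphism_contractive:
  assumes \<pi>: "compacts_homomorphism Y \<pi>" and S: "S \<in> compacts Y" "op_norm_le Y S \<kappa>" "0 \<le> \<kappa>"
  shows "norm (\<pi> S) \<le> \<kappa>"
proof -
  have add: "\<pi> (op_add Y S T) = \<pi> S + \<pi> T" and mult: "\<pi> (op_comp Y S T) = \<pi> S * \<pi> T"
    and scale: "\<pi> (op_scale Y c S) = c *\<^sub>C \<pi> S" and star: "\<pi> (adjoint Y S) = star (\<pi> S)"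
    if "S \<in> compacts Y" "T \<in> compacts Y" for S T c
    using \<pi> that by (simp_all add: compacts_homomorphism_def)
  note comps = op_add_compact op_scale_compact op_comp_compact adjoint_compact
  have *: "norm (\<pi> W) \<le> 1" if W: "W \<in> compacts Y" "adjoint Y W = W" "op_norm_le Y W q" "0 \<le> q" "q < 1" for W q
  proof -
    obtain E where E: "E \<in> compacts Y" "adjoint Y E = E" "op_comp Y W E = op_comp Y E W"
      "op_add Y E E = op_add Y (op_comp Y W W) (op_comp Y E E)"
      using compact_one_minus_sqrt_exists[OF W] .
    show ?thesis
    proof (rule norm_le_one_of_sum_squares)
      show "star (\<pi> W) = \<pi> W" "star (\<pi> E) = \<pi> E" using star[OF W(1,1)] star[OF E(1,1)] W(2) E(2) by simp_all
      show "\<pi> W * \<pi> E = \<pi> E * \<pi> W" using W(1) E(1,3) by (simp flip: mult)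
      show "\<pi> E + \<pi> E = \<pi> W * \<pi> W + \<pi> E * \<pi> E"
        using W(1) E(1,4) comps by (simp flip: mult add)
    qed
  qed
  have **: "norm (\<pi> W) \<le> q" if W: "W \<in> compacts Y" "adjoint Y W = W" "op_norm_le Y W q" "0 \<le> q" for W q
  proof (rule dense_ge)
    fix t assume t: "q < t"
    hence "0 < t" using W by linarith
    define V where "V = op_scale Y (complex_of_real (1 / t)) W"
    have "norm (\<pi> V) \<le> 1"
    proof (rule *)
      show "V \<in> compacts Y" unfolding V_def using W comps by blast
      show "adjoint Y V = V" unfolding V_def using W op_adjointable(4)[of W] by simp
      show "op_norm_le Y V (q / t)"
        using op_norm_leD[OF W(3)] W(1) \<open>0 < t\<close>
        by (auto simp: op_norm_le_def V_def vnorm_scale norm_divide divide_right_mono)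
    qed (use t \<open>0 < t\<close> W in auto)
    thus "norm (\<pi> W) \<le> t" using \<open>0 < t\<close> W by (simp add: V_def scale norm_scaleC norm_divide)
  qed
  have SS: "op_comp Y (adjoint Y S) S \<in> compacts Y" "adjoint Y S \<in> compacts Y" using S comps by auto
  have "norm (\<pi> (op_comp Y (adjoint Y S) S)) \<le> \<kappa> * \<kappa>"
    using S SS by (intro ** op_norm_le_comp op_norm_le_adjoint) (auto simp: op_adjointable)
  moreover have "\<pi> (op_comp Y (adjoint Y S) S) = star (\<pi> S) * \<pi> S" using S SS by (simp add: mult star)
  ultimately have "(norm (\<pi> S))\<^sup>2 \<le> \<kappa>\<^sup>2" by (simp add: cstar_identity power2_eq_square)
  thus ?thesis using S by (simp add: power2_le_iff_abs_le)
qed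

context toeplitz_module
begin

text \<open>Algebra settles the finite rank operators. Contractivity then puts every pair of
  \<open>S\<close> and \<open>\<pi> S\<close> into the graph \<open>rep_rel\<close>, which is single
  valued on compact operators.\<close>

lemma compacts_homomorphism_unique:
  assumes \<pi>: "compacts_homomorphism Y \<pi>"
    and rank_one: "\<And>x y. x \<in> carrier Y \<Longrightarrow> y \<in> carrier Y \<Longrightarrow> \<pi> (rank_one Y x y) = \<psi> x * star (\<psi> y)"
  shows "\<pi> = induced_rep"
proof (rule extensionalityI)
  show "\<pi> \<in> extensional (compacts Y)" "induced_rep \<in> extensional (compacts Y)"
    using \<pi> compacts_homomorphism_induced_rep by (auto simp: compacts_homomorphism_def)
  have add: "\<pi> (op_add Y S T) = \<pi> S + \<pi> T" and scale: "\<pi> (op_scale Y c S) = c *\<^sub>C \<pi> S"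
    if "S \<in> compacts Y" "T \<in> compacts Y" for S T c
    using \<pi> that by (simp_all add: compacts_homomorphism_def)
  have fin: "\<pi> (fin_op Y L) = fin_rep L" if "L \<in> vec_pairs Y" for L
    using that
  proof (induction rule: vec_pairs_induct)
    \<comment> \<open>The zero operator equals 0 times itself, so homogeneity sends it to 0.\<close>
    case Nil
    have "[] \<in> vec_pairs Y" by simp
    from fin_op_scale(2)[OF this, of 0] show ?case
      using scale[of "fin_op Y []" "fin_op Y []" 0] by simp
  next
    case (Cons x y L)
    have xy: "[(x, y)] \<in> vec_pairs Y" using Cons by simp
    have "fin_op Y ([(x, y)] @ L) = op_add Y (rank_one Y x y) (fin_op Y L)"
      using Cons by (subst fin_op_append[OF xy]) (simp_all add: rank_one_eq_fin_op)
    moreover have "rank_one Y x y \<in> compacts Y" using Cons fin_op_compact[OF xy] by (simp add: rank_one_eq_fin_op)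
    ultimately show ?case using Cons by (simp add: add rank_one)
  qed
  fix S assume S: "S \<in> compacts Y"
  have "rep_rel S (\<pi> S)" unfolding rep_rel_def
  proof (intro allI impI)
    fix e :: real assume e: "0 < e"
    obtain L where L: "L \<in> vec_pairs Y" "op_dist_le Y S (fin_op Y L) e" using compactsE[OF S e] .
    define D where "D = op_add Y (fin_op Y L) (op_scale Y (-1) S)"
    have "D \<in> compacts Y" unfolding D_def using S L by (intro op_add_compact op_scale_compact) auto
    moreover have "op_dist_le Y (fin_op Y L) S e" by (rule op_dist_le_sym[OF _ _ L(2)]) (use S L in auto)
    hence "op_norm_le Y D e" by (simp add: op_norm_le_def op_dist_le_def D_def vminus_def)
    ultimately have "norm (\<pi> D) \<le> e" using e by (intro compacts_homomorphism_contractive[OF \<pi>]) auto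
    moreover have "\<pi> D = fin_rep L - \<pi> S"
      unfolding D_def using S L op_scale_compact[OF S] by (simp add: add scale fin)
    ultimately show "\<exists>L\<in>vec_pairs Y. op_dist_le Y S (fin_op Y L) e \<and> norm (fin_rep L - \<pi> S) \<le> e"
      using L by auto
  qed
  thus "\<pi> S = induced_rep S" using induced_rep_eq[OF S] by simp
qed

lemma the_induced_rep:
  "(THE \<pi>. compacts_homomorphism Y \<pi> \<and>
    (\<forall>x\<in>carrier Y. \<forall>y\<in>carrier Y. \<pi> (rank_one Y x y) = \<psi> x * star (\<psi> y))) = induced_rep"
proof (rule the_equality)
  show "compacts_homomorphism Y induced_rep \<and>
      (\<forall>x\<in>carrier Y. \<forall>y\<in>carrier Y. induced_rep (rank_one Y x y) = \<psi> x * star (\<psi> y))"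
    using compacts_homomorphism_induced_rep induced_rep_rank_one by blast
qed (rule compacts_homomorphism_unique, blast+)

lemma induced_rep_compose:
  assumes \<sigma>: "star_homomorphism \<sigma>" and S: "S \<in> compacts Y"
  shows "toeplitz_module.induced_rep Y (\<sigma> \<circ> \<psi>) S = \<sigma> (induced_rep S)"
proof -
  interpret \<sigma>: star_homomorphism \<sigma> by fact
  interpret c: toeplitz_module Y "\<sigma> \<circ> \<rho>" "\<sigma> \<circ> \<psi>"
    by unfold_locales
      (simp_all add: psi_add psi_scale psi_ract psi_inner \<sigma>.hom_add \<sigma>.hom_scaleC \<sigma>.hom_mult \<sigma>.hom_star
        rho.hom_add rho.hom_scaleC rho.hom_mult rho.hom_star flip: \<sigma>.hom_mult \<sigma>.hom_star)
  \<comment> \<open>Restriction is needed because \<open>\<sigma>\<close> may move the default value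
    taken off the compact operators.\<close>
  have "restrict (\<sigma> \<circ> induced_rep) (compacts Y) = c.induced_rep"
  proof (rule c.compacts_homomorphism_unique)
    show "compacts_homomorphism Y (restrict (\<sigma> \<circ> induced_rep) (compacts Y))"
      using compacts_homomorphism_induced_rep
      by (auto simp: compacts_homomorphism_def op_add_compact op_scale_compact op_comp_compact adjoint_compact
          \<sigma>.hom_add \<sigma>.hom_scaleC \<sigma>.hom_mult \<sigma>.hom_star)
    fix x y assume xy: "x \<in> carrier Y" "y \<in> carrier Y"
    hence "[(x, y)] \<in> vec_pairs Y" by simp
    hence "rank_one Y x y \<in> compacts Y" using xy fin_op_compact by (simp add: rank_one_eq_fin_op)
    thus "restrict (\<sigma> \<circ> induced_rep) (compacts Y) (rank_one Y x y) = (\<sigma> \<circ> \<psi>) x * star ((\<sigma> \<circ> \<psi>) y)"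
      using xy by (simp add: induced_rep_rank_one \<sigma>.hom_mult \<sigma>.hom_star)
  qed
  thus ?thesis using S by (metis comp_apply restrict_apply')
qed

end

section \<open>Fibres of a product system and Nica covariance\<close>

text \<open>Compatibility with the right action comes from multiplicativity of
  \<open>\<psi>\<close>, since acting by \<open>a\<close> on the right is multiplication by
  \<open>emb X a\<close>.\<close>

lemma toeplitz_module_fibre:
  assumes X: "product_system P X" and \<psi>: "toeplitz_representation P X \<psi>" and s: "s \<in> carrier P"
  shows "toeplitz_module (fibre X s) (\<lambda>a. \<psi> (emb X a)) \<psi>"
proof -
  interpret product_system P X by fact
  interpret Y: hilbert_bimodule "fibre X s" by (rule fibre_bimodule[OF s])
  interpret star_homomorphism "\<lambda>a. \<psi> (emb X a)" using \<psi> by (simp add: toeplitz_representation_def)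
  have emb: "emb X a \<in> carrier X" for a
    using fibre_one carrier_fibre[of "\<one>\<^bsub>P\<^esub>"]
    by (auto simp: hilbert_bimodule_iso_def cstar_bimodule_def bij_betw_def)
  show ?thesis
  proof
    fix x a assume x: "x \<in> carrier (fibre X s)"
    hence "x \<in> carrier X" using carrier_fibre[OF s] by simp
    thus "\<psi> (ract (fibre X s) x a) = \<psi> x * \<psi> (emb X a)"
      using \<psi> emb x by (simp add: toeplitz_representation_def flip: pmult_emb[OF s x])
  qed (use \<psi> s in \<open>auto simp: toeplitz_representation_def\<close>)
qed

lemma toeplitz_representation_compose:
  assumes "toeplitz_representation P X \<psi>" "star_homomorphism \<sigma>"
  shows "toeplitz_representation P X (\<sigma> \<circ> \<psi>)"
proof -
  interpret \<sigma>: star_homomorphism \<sigma> by fact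
  interpret \<rho>: star_homomorphism "\<lambda>a. \<psi> (emb X a)" using assms by (simp add: toeplitz_representation_def)
  have "star_homomorphism (\<lambda>a. \<sigma> (\<psi> (emb X a)))"
    by unfold_locales (simp_all add: \<rho>.hom_add \<rho>.hom_scaleC \<rho>.hom_mult \<rho>.hom_star
        \<sigma>.hom_add \<sigma>.hom_scaleC \<sigma>.hom_mult \<sigma>.hom_star)
  moreover have "star (\<sigma> (\<psi> x)) * \<sigma> (\<psi> y) = \<sigma> (\<psi> (emb X (rinner (fibre X s) x y)))"
    if "s \<in> carrier P" "x \<in> carrier (fibre X s)" "y \<in> carrier (fibre X s)" for s x y
  proof -
    have "star (\<psi> x) * \<psi> y = \<psi> (emb X (rinner (fibre X s) x y))"
      using assms(1) that by (simp add: toeplitz_representation_def)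
    thus ?thesis by (metis \<sigma>.hom_mult \<sigma>.hom_star)
  qed
  ultimately show ?thesis using assms(1)
    by (simp add: toeplitz_representation_def \<sigma>.hom_add \<sigma>.hom_scaleC \<sigma>.hom_mult)
qed

lemma rep_compacts_compose:
  assumes X: "product_system P X" and \<psi>: "toeplitz_representation P X \<psi>" and \<sigma>: "star_homomorphism \<sigma>"
    and s: "s \<in> carrier P" and S: "S \<in> compacts (fibre X s)"
  shows "rep_compacts X (\<sigma> \<circ> \<psi>) s S = \<sigma> (rep_compacts X \<psi> s S)"
proof -
  interpret Y: toeplitz_module "fibre X s" "\<lambda>a. \<psi> (emb X a)" \<psi>
    by (rule toeplitz_module_fibre[OF X \<psi> s])
  interpret Z: toeplitz_module "fibre X s" "\<lambda>a. (\<sigma> \<circ> \<psi>) (emb X a)" "\<sigma> \<circ> \<psi>"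
    by (rule toeplitz_module_fibre[OF X toeplitz_representation_compose[OF \<psi> \<sigma>] s])
  show ?thesis
    unfolding rep_compacts_def Y.the_induced_rep Z.the_induced_rep
    by (rule Y.induced_rep_compose[OF \<sigma> S])
qed

text \<open>For two least upper bounds \<open>v\<close> and \<open>w\<close>, both
  \<open>inv v \<otimes> w\<close> and its inverse lie in \<open>P\<close>, so pointedness
  identifies \<open>v\<close> with \<open>w\<close> and the description defining \<open>join\<close>
  is proper.\<close>

lemma (in quasi_lattice_ordered) join_in:
  assumes st: "s \<in> P" "t \<in> P" and j: "joinable G P s t"
  shows "join G P s t \<in> P"
proof -
  have PG: "P \<subseteq> carrier G" by (rule subset)
  obtain v where v: "is_lub G P {s, t} v"
    using lub_exists[of "{s, t}"] st PG j by (auto simp: joinable_def)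
  have "w = v" if w: "is_lub G P {s, t} w" for w
  proof -
    have vw: "v \<in> P" "w \<in> P" "inv v \<otimes> w \<in> P" "inv w \<otimes> v \<in> P"
      using v w by (auto simp: is_lub_def upper_bounds_def ql_le_def)
    hence c: "v \<in> carrier G" "w \<in> carrier G" using PG by auto
    hence "inv (inv w \<otimes> v) = inv v \<otimes> w" by (simp add: inv_mult_group)
    hence "inv v \<otimes> w \<in> P \<inter> (\<lambda>s. inv s) ` P" using vw by (metis IntI imageI)
    hence "inv v \<otimes> w = \<one>" using pointed by blast
    hence "v \<otimes> (inv v \<otimes> w) = v" using c by simp
    thus ?thesis using c by (simp flip: m_assoc)
  qed
  hence "join G P s t = v" unfolding join_def using v by (intro the_equality)
  thus ?thesis using v by (simp add: is_lub_def upper_bounds_def)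
qed

theorem proposition5p9:
  fixes G :: "('g, 'k) monoid_scheme"
    and P :: "'g set"
    and X :: "('g, 'a::cstar_algebra, 'x, 'z) product_system_scheme"
    and \<psi> :: "'x \<Rightarrow> 'b::cstar_algebra"
    and \<sigma> :: "'b \<Rightarrow> 'c::cstar_algebra"
  assumes "separable_space (euclidean :: 'a topology)"
    and "countable P"
    and "quasi_lattice_ordered G P"
    and "product_system (G\<lparr>carrier := P\<rparr>) X"
    and "\<And>s. s \<in> P \<Longrightarrow> essential (fibre X s)"
    and "compactly_aligned G P X"
    and "toeplitz_representation (G\<lparr>carrier := P\<rparr>) X \<psi>"
    and "nica_covariant G P X \<psi>"
    and "star_homomorphism \<sigma>"
  shows "toeplitz_representation (G\<lparr>carrier := P\<rparr>) X (\<sigma> \<circ> \<psi>) \<and> nica_covariant G P X (\<sigma> \<circ> \<psi>)"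
proof
  show "toeplitz_representation (G\<lparr>carrier := P\<rparr>) X (\<sigma> \<circ> \<psi>)"
    using assms by (intro toeplitz_representation_compose)
  interpret \<sigma>: star_homomorphism \<sigma> by fact
  interpret quasi_lattice_ordered G P by fact
  have rep: "rep_compacts X (\<sigma> \<circ> \<psi>) s S = \<sigma> (rep_compacts X \<psi> s S)"
    if "s \<in> P" "S \<in> compacts (fibre X s)" for s S
    using that by (intro rep_compacts_compose[OF assms(4,7,9)]) auto
  \<comment> \<open>Needed for the pairs without a common upper bound.\<close>
  have zero: "\<sigma> 0 = 0" using \<sigma>.hom_add[of 0 0] by simp
  show "nica_covariant G P X (\<sigma> \<circ> \<psi>)"
    unfolding nica_covariant_def
  proof (intro ballI)
    fix s t S T
    assume st: "s \<in> P" "t \<in> P" and ST: "S \<in> compacts (fibre X s)" "T \<in> compacts (fibre X t)"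
    have "rep_compacts X \<psi> s S * rep_compacts X \<psi> t T =
        (if joinable G P s t
         then rep_compacts X \<psi> (join G P s t) (amplified_product G P X s t S T)
         else 0)"
      using assms(8) st ST unfolding nica_covariant_def by blast
    \<comment> \<open>Compact alignment enters here: \<open>rep\<close> may be used over the join
      only at compact operators.\<close>
    moreover have "amplified_product G P X s t S T \<in> compacts (fibre X (join G P s t))"
      if "joinable G P s t"
      using assms(6) st ST that unfolding compactly_aligned_def by blast
    ultimately show "rep_compacts X (\<sigma> \<circ> \<psi>) s S * rep_compacts X (\<sigma> \<circ> \<psi>) t T =
        (if joinable G P s t
         then rep_compacts X (\<sigma> \<circ> \<psi>) (join G P s t) (amplified_product G P X s t S T)
         else 0)"
      using st ST by (simp add: rep join_in zero flip: \<sigma>.hom_mult)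
  qed
qed

end
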